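(* Let $D\neq\mathbb C_\infty$ be a domain in $\mathbb C_\infty$, let $D_0\Subset D$ be a non-empty subdomain of $D$, let $M\in\mathrm{sbh}(D)$ with Riesz measure $\nu_M$, let $f\in\mathrm{Hol}(D)$ with $f\not\equiv0$, let $\mathtt Z=\{\mathtt z_k\}_{k=1,2,\dots}\subset D$ be a sequence on which $f$ vanishes, and suppose $\log|f|\le M$ on $D\setminus D_0$. If $v\in\mathrm{sbh}^+(D\setminus D_0)$ and $\lim_{z\to\partial D}v=0$, then the following implication is true: $$ \left(\int_{D\setminus D_0}v\,d\nu_M<+\infty\right)\ \Longrightarrow\ \left(\sum_{\mathtt z_k\in D\setminus D_0}v(\mathtt z_k)<+\infty\right). $$
   Context: $\mathbb C_\infty=\mathbb C\cup\{\infty\}$ is the Riemann sphere; closures and boundaries are taken in $\mathbb C_\infty$. $S\Subset D$ means that $\overline S$ is a compact subset of $D$. $\mathrm{Hol}(D)$ and $\mathrm{sbh}(D)$ are the classes of holomorphic and subharmonic functions on $D$. For $S\subset\mathbb C_\infty$, $\mathrm{sbh}(S)$ is the class of functions subharmonic on some open set containing $S$, and $\mathrm{sbh}^+(S)=\{u\in\mathrm{sbh}(S):u\ge0\text{ on }S\}$. The Riesz measure of a subharmonic function $M\not\equiv-\infty$ is $\nu_M=\frac1{2\pi}\Delta M$ (distributional Laplacian). The condition $\lim_{z\to\partial D}v=0$ means that for each $\varepsilon>0$ there is $D_\varepsilon\Subset D$ with $|v|<\varepsilon$ on $D\setminus(D_\varepsilon\cup D_0)$. That $f$ vanishes on the sequence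 $\mathtt Z$ (written $f(\mathtt Z)=0$) is understood with multiplicity: each point $z\in D$ occurring in $\mathtt Z$ is a zero of $f$ of multiplicity at least the number of indices $k$ with $\mathtt z_k=z$. *)

theory Defs
  imports "HOL-Complex_Analysis.Complex_Analysis"
begin

section \<open>The Riemann sphere\<close>

text \<open>The point at infinity is \<^term>\<open>None\<close>. The sphere is described by the two charts
  \<^term>\<open>Some\<close> and \<open>inv_chart\<close>.\<close>

type_synonym sphere = "complex option"

definition riemann_sphere :: "sphere topology" where
  "riemann_sphere = Alexandroff_compactification euclidean"

definition inv_chart :: "complex \<Rightarrow> sphere" where
  "inv_chart w = (if w = 0 then None else Some (inverse w))"

definition sphere_domain :: "sphere set \<Rightarrow> bool" where
  "sphere_domain D \<longleftrightarrow> D \<noteq> {} \<and> openin riemann_sphere D \<and> connectedin riemann_sphere D"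

definition relatively_compact_in :: "sphere set \<Rightarrow> sphere set \<Rightarrow> bool" (infix "\<Subset>" 50) where
  "S \<Subset> D \<longleftrightarrow> compactin riemann_sphere (riemann_sphere closure_of S) \<and>
             riemann_sphere closure_of S \<subseteq> D"

section \<open>Holomorphic functions and their zeros\<close>

definition Hol :: "sphere set \<Rightarrow> (sphere \<Rightarrow> complex) set" where
  "Hol D = {f. (f \<circ> Some) holomorphic_on (Some -` D) \<and>
               (f \<circ> inv_chart) holomorphic_on (inv_chart -` D)}"

fun sphere_zorder :: "(sphere \<Rightarrow> complex) \<Rightarrow> sphere \<Rightarrow> int" where
  "sphere_zorder f (Some c) = zorder (f \<circ> Some) c"
| "sphere_zorder f None = zorder (f \<circ> inv_chart) 0"

text \<open>A sequence may be finite or infinite: it is given by its length \<open>N\<close> (possibly \<open>\<infinity>\<close>) and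
  its terms \<open>Z k\<close> for \<open>1 \<le> k \<le> N\<close>.\<close>

definition seq_indices :: "enat \<Rightarrow> nat set" where
  "seq_indices N = {k. 1 \<le> k \<and> enat k \<le> N}"

text \<open>The finiteness condition is needed because \<^const>\<open>card\<close> is \<open>0\<close> on infinite sets.
  At a point where \<open>f\<close> is holomorphic and not locally zero, \<^const>\<open>zorder\<close> is the
  multiplicity of the zero.\<close>

definition vanishes_on_seq ::
  "(sphere \<Rightarrow> complex) \<Rightarrow> sphere set \<Rightarrow> enat \<Rightarrow> (nat \<Rightarrow> sphere) \<Rightarrow> bool" where
  "vanishes_on_seq f D N Z \<longleftrightarrow>
     (\<forall>p \<in> D \<inter> Z ` seq_indices N.
        f p = 0 \<and>
        finite {k \<in> seq_indices N. Z k = p} \<and>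
        int (card {k \<in> seq_indices N. Z k = p}) \<le> sphere_zorder f p)"

definition log_norm :: "complex \<Rightarrow> ereal" where
  "log_norm w = (if w = 0 then -\<infinity> else ereal (ln (cmod w)))"

section \<open>Subharmonic functions\<close>

text \<open>The mean over a circle as a Lebesgue integral with values in the extended reals: the integral
  of the positive part minus that of the negative part (\<^const>\<open>e2ennreal\<close> maps negative numbers
  to \<open>0\<close>). For an upper semicontinuous \<open>u < \<infinity>\<close> the former is finite.\<close>

definition circle_mean :: "(complex \<Rightarrow> ereal) \<Rightarrow> complex \<Rightarrow> real \<Rightarrow> ereal" where
  "circle_mean u c r =
     (enn2ereal (\<integral>\<^sup>+t\<in>{0..2*pi}. e2ennreal (u (c + of_real r * cis t)) \<partial>lborel) -
      enn2ereal (\<integral>\<^sup>+t\<in>{0..2*pi}. e2ennreal (- u (c + of_real r * cis t)) \<partial>lborel)) / ereal (2*pi)"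

text \<open>The function that is identically \<open>-\<infinity>\<close> is admitted.\<close>

definition subharmonic_on :: "(complex \<Rightarrow> ereal) \<Rightarrow> complex set \<Rightarrow> bool" where
  "subharmonic_on u U \<longleftrightarrow>
     open U \<and>
     (\<forall>z\<in>U. u z < \<infinity>) \<and>
     (\<forall>a. open {z \<in> U. u z < a}) \<and>
     (\<forall>c r. r > 0 \<longrightarrow> cball c r \<subseteq> U \<longrightarrow> u c \<le> circle_mean u c r)"

definition sbh_open :: "sphere set \<Rightarrow> (sphere \<Rightarrow> ereal) set" where
  "sbh_open U = {u. openin riemann_sphere U \<and>
                    subharmonic_on (u \<circ> Some) (Some -` U) \<and>
                    subharmonic_on (u \<circ> inv_chart) (inv_chart -` U)}"

definition sbh :: "sphere set \<Rightarrow> (sphere \<Rightarrow> ereal) set" where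
  "sbh S = {u. \<exists>U. openin riemann_sphere U \<and> S \<subseteq> U \<and> u \<in> sbh_open U}"

definition sbh_pos :: "sphere set \<Rightarrow> (sphere \<Rightarrow> ereal) set" where
  "sbh_pos S = {u \<in> sbh S. \<forall>z\<in>S. 0 \<le> u z}"

section \<open>Riesz measure\<close>

fun Ck :: "nat \<Rightarrow> (complex \<Rightarrow> real) \<Rightarrow> bool" where
  "Ck 0 g \<longleftrightarrow> continuous_on UNIV g"
| "Ck (Suc k) g \<longleftrightarrow>
     (\<forall>z. g differentiable (at z)) \<and> (\<forall>h. Ck k (\<lambda>z. frechet_derivative g (at z) h))"

definition laplacian :: "(complex \<Rightarrow> real) \<Rightarrow> complex \<Rightarrow> real" where
  "laplacian g z =
     frechet_derivative (\<lambda>w. frechet_derivative g (at w) 1) (at z) 1 +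
     frechet_derivative (\<lambda>w. frechet_derivative g (at w) \<i>) (at z) \<i>"

definition test_functions :: "sphere set \<Rightarrow> (sphere \<Rightarrow> real) set" where
  "test_functions D = {\<phi>. (\<forall>k. Ck k (\<phi> \<circ> Some)) \<and> (\<forall>k. Ck k (\<phi> \<circ> inv_chart)) \<and>
                          {p. \<phi> p \<noteq> 0} \<Subset> D}"

text \<open>\<open>\<nu>\<close> is the Radon measure on \<open>D\<close> that represents the distributional Laplacian of \<open>M\<close> divided
  by \<open>2\<pi>\<close>. The form \<open>M \<Delta>\<phi> d\<lambda>\<close> is invariant under conformal changes of the coordinate, so the
  integral in the coordinate \<^term>\<open>Some\<close> is also correct for \<open>\<phi>\<close> supported near infinity: it omits
  only the one point \<^term>\<open>None\<close>, which is a null set in the other coordinate. The set where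
  \<open>M = -\<infinity>\<close> is a null set as well, hence \<^const>\<open>real_of_ereal\<close>.\<close>

definition is_riesz_measure :: "sphere set \<Rightarrow> (sphere \<Rightarrow> ereal) \<Rightarrow> sphere measure \<Rightarrow> bool" where
  "is_riesz_measure D M \<nu> \<longleftrightarrow>
     (\<exists>z\<in>D. M z \<noteq> -\<infinity>) \<and>
     sets \<nu> = sets (sigma D {U. openin riemann_sphere U \<and> U \<subseteq> D}) \<and>
     (\<forall>K. compactin riemann_sphere K \<and> K \<subseteq> D \<longrightarrow> emeasure \<nu> K < \<infinity>) \<and>
     (\<forall>\<phi> \<in> test_functions D.
        (\<integral>p. \<phi> p \<partial>\<nu>) =
        1 / (2*pi) * (\<integral>z. real_of_ereal (M (Some z)) * laplacian (\<phi> \<circ> Some) z \<partial>lborel))"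

section \<open>Vanishing at the boundary\<close>

definition tends_to_zero_at_boundary ::
  "sphere set \<Rightarrow> sphere set \<Rightarrow> (sphere \<Rightarrow> ereal) \<Rightarrow> bool" where
  "tends_to_zero_at_boundary D D0 v \<longleftrightarrow>
     (\<forall>\<epsilon>::real. \<epsilon> > 0 \<longrightarrow> (\<exists>D\<epsilon>. D\<epsilon> \<Subset> D \<and> (\<forall>z \<in> D - (D\<epsilon> \<union> D0). \<bar>v z\<bar> < ereal \<epsilon>)))"

end

theory Submission
  imports Defs
begin

text \<open>Write \<open>u = ln |f|\<close>. Its Riesz measure is the sum of the point masses at the zeros of \<open>f\<close>, so the
claim compares the integrals of \<open>v\<close> against the Riesz measures of \<open>u\<close> and of \<open>M\<close>. If \<open>v\<close> were smooth,
compactly supported in \<open>D - D0\<close> and subharmonic everywhere, Green's formula would settle it: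
\<open>\<integral> v d\<nu>\<^sub>u = (1/2\<pi>) \<integral> u \<Delta>v \<le> (1/2\<pi>) \<integral> M \<Delta>v = \<integral> v d\<nu>\<^sub>M\<close>, because \<open>\<Delta>v \<ge> 0\<close> and \<open>u \<le> M\<close>. Three
modifications of \<open>v\<close> make this argument work.

Near the boundary of \<open>D\<close> the function \<open>v - \<epsilon>\<close> is negative, so \<open>max (v - \<epsilon>) 0\<close> vanishes there and is
still subharmonic.

Near \<open>D0\<close> a function \<open>g \<ge> 0\<close> is subtracted that exceeds \<open>v\<close> close to \<open>D0\<close> and vanishes away from \<open>D0\<close>.
The choice \<open>g = L * (dist(z, Y))\<^sup>2\<close>, with \<open>Y\<close> the set of points far from \<open>D0\<close>, costs only a bounded
negative part of the Laplacian: \<open>|z - y|\<^sup>2\<close> has circular mean \<open>|z - y|\<^sup>2 + r\<^sup>2\<close>, hence the infimum over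
\<open>y\<close> has circular mean at most its value plus \<open>r\<^sup>2\<close>. So \<open>W = max (v - g - \<epsilon>) 0\<close> satisfies
\<open>\<Delta>W \<ge> - C\<close> on a fixed compact collar \<open>K\<close>, \<open>\<Delta>W \<ge> 0\<close> elsewhere, with \<open>C\<close> independent of \<open>\<epsilon>\<close>
(lemma \<open>truncated_weight_approximation\<close>). If \<open>\<infinity>\<close> lies in \<open>D\<close>, a neighbourhood of \<open>\<infinity>\<close> is removed together
with \<open>D0\<close>; after that everything happens in the finite plane.

Finally \<open>W\<close> is convolved with a radial mollifier, which preserves the bounds on the Laplacian and gives
test functions \<open>\<psi>\<close> that converge to \<open>W\<close> pointwise (lemma \<open>smooth_approximation\<close>).

For such a \<open>\<psi>\<close> the product \<open>(M - u) * (\<Delta>\<psi> + C * 1\<^sub>K)\<close> is nonnegative, and integrating it gives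
\<open>\<integral> u \<Delta>\<psi> \<le> \<integral> M \<Delta>\<psi> + C * \<integral>\<^sub>K (M - u)\<close>. The last term is finite because \<open>M\<close> lies between \<open>u\<close>, which is
locally integrable, and a constant. The integral of \<open>M \<Delta>\<psi>\<close> is \<open>2\<pi> \<integral> \<psi> d\<nu>\<^sub>M\<close> by definition of the Riesz
measure. On the other side \<open>u\<close> is locally a harmonic function plus a sum of terms \<open>ln |z - a|\<close>, and it is
enough to know that \<open>\<integral> ln |z - a| \<Delta>\<psi> \<ge> c * \<psi> a\<close> for some constant \<open>c > 0\<close>
(lemma \<open>log_potential_lower_bound\<close>): only finiteness is at stake, so the sharp value \<open>2\<pi>\<close> is replaced by
\<open>\<pi>/2\<close>. Letting the mollification radius and then \<open>\<epsilon>\<close> tend to \<open>0\<close> bounds the sum of \<open>v\<close> over all finite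
sets of zeros away from \<open>D0\<close> by one constant. The zeros that remain lie in a compact subset of \<open>D\<close>; there
are finitely many of them by the identity theorem on the connected set \<open>D\<close>.\<close>

section \<open>The topology of the sphere\<close>

lemma open_vimage_Some:
  assumes "openin riemann_sphere U"
  shows "open (Some -` U)"
  using openin_continuous_map_preimage[OF continuous_map_Some assms[unfolded riemann_sphere_def]]
  by (simp add: vimage_def)

lemma openin_Some_image: "openin riemann_sphere (Some ` U) \<longleftrightarrow> open U"
  by (simp add: riemann_sphere_def)

lemma topspace_riemann_sphere: "topspace riemann_sphere = UNIV"
  by (simp add: riemann_sphere_def UNIV_option_conv)

lemma openin_inv_chart_ball:
  assumes "e > 0"
  shows "openin riemann_sphere (inv_chart ` ball 0 e)"
proof -
  have "inv_chart ` ball 0 e = insert None (Some ` (- cball 0 (1/e)))"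
  proof (intro equalityI subsetI)
    fix x :: sphere assume "x \<in> inv_chart ` ball 0 e"
    then obtain w where w: "norm w < e" "x = inv_chart w" by auto
    show "x \<in> insert None (Some ` (- cball 0 (1/e)))"
    proof (cases "w = 0")
      case False
      with w(1) assms have "1/e < norm (inverse w)"
        by (simp add: norm_inverse divide_inverse less_imp_inverse_less)
      with False w(2) show ?thesis by (simp add: inv_chart_def image_iff)
    qed (simp add: w inv_chart_def)
  next
    fix x :: sphere assume "x \<in> insert None (Some ` (- cball 0 (1/e)))"
    then consider "x = None" | z where "x = Some z" "norm z > 1/e" by (auto simp: not_le)
    then show "x \<in> inv_chart ` ball 0 e"
    proof cases
      case 1
      then show ?thesis using assms by (auto simp: inv_chart_def image_iff intro!: bexI[of _ 0])
    next
      case 2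
      then have "z \<noteq> 0" using assms by auto
      with 2 assms have "norm (inverse z) < e"
        by (simp add: norm_divide norm_inverse field_simps)
      note \<open>z \<noteq> 0\<close> this
      with 2 show ?thesis by (auto simp: inv_chart_def image_iff intro!: bexI[of _ "inverse z"])
    qed
  qed
  moreover have "openin riemann_sphere (insert None (Some ` (- cball 0 (1/e))))"
    unfolding riemann_sphere_def openin_Alexandroff_compactification
    by (intro disjI2 exI[of _ "cball 0 (1/e)"]) (auto simp: Compl_eq_Diff_UNIV)
  ultimately show ?thesis by simp
qed

text \<open>Neighbourhoods of \<open>\<infinity>\<close> are complements of compact sets, and inversion turns them into neighbourhoods of
\<open>0\<close>. This makes the one-point compactification agree with the topology given by the two charts.\<close>

lemma openin_riemann_sphere_iff_nbhd:
  "openin riemann_sphere U \<longleftrightarrow> open (Some -` U) \<and> (None \<in> U \<longrightarrow> (\<exists>e>0. inv_chart ` ball 0 e \<subseteq> U))"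
proof (intro iffI conjI impI)
  assume U: "openin riemann_sphere U"
  then show "open (Some -` U)" by (rule open_vimage_Some)
  assume "None \<in> U"
  with U obtain C where C: "compact C" "U = insert None (Some ` (UNIV - C))"
    unfolding riemann_sphere_def openin_Alexandroff_compactification by auto
  obtain b where b: "b > 0" "\<And>x. x \<in> C \<Longrightarrow> norm x \<le> b"
    using compact_imp_bounded[OF C(1)] unfolding bounded_pos by blast
  have "inv_chart ` ball 0 (1/b) \<subseteq> U"
  proof (intro image_subsetI)
    fix w :: complex assume w: "w \<in> ball 0 (1/b)"
    show "inv_chart w \<in> U"
    proof (cases "w = 0")
      case False
      with w b(1) have "norm (inverse w) > b" by (simp add: norm_divide norm_inverse field_simps)
      with b(2) have "inverse w \<notin> C" by force
      with False show ?thesis by (auto simp: C inv_chart_def)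
    qed (auto simp: C inv_chart_def)
  qed
  with b(1) show "\<exists>e>0. inv_chart ` ball 0 e \<subseteq> U"
    by (intro exI[of _ "1/b"]) auto
next
  assume *: "open (Some -` U) \<and> (None \<in> U \<longrightarrow> (\<exists>e>0. inv_chart ` ball 0 e \<subseteq> U))"
  have S: "openin riemann_sphere (Some ` (Some -` U))" using * openin_Some_image by blast
  show "openin riemann_sphere U"
  proof (cases "None \<in> U")
    case False
    then have "Some ` (Some -` U) = U" by (auto simp: image_iff) (metis not_None_eq)
    with S show ?thesis by simp
  next
    case True
    with * obtain e where e: "e > 0" "inv_chart ` ball 0 e \<subseteq> U" by auto
    have "U = Some ` (Some -` U) \<union> inv_chart ` ball 0 e"
    proof (intro equalityI subsetI)
      fix x assume "x \<in> U"
      show "x \<in> Some ` (Some -` U) \<union> inv_chart ` ball 0 e"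
      proof (cases x)
        case None
        then have "x = inv_chart 0" by (simp add: inv_chart_def)
        with e(1) show ?thesis by force
      qed (use \<open>x \<in> U\<close> in auto)
    qed (use e in auto)
    with S openin_inv_chart_ball[OF e(1)] show ?thesis by (metis openin_Un)
  qed
qed

lemma openin_riemann_sphereI:
  assumes "open (Some -` U)" "open (inv_chart -` U)"
  shows "openin riemann_sphere U"
  unfolding openin_riemann_sphere_iff_nbhd
proof (intro conjI impI assms(1))
  assume "None \<in> U"
  then have "0 \<in> inv_chart -` U" by (simp add: inv_chart_def)
  with assms(2) obtain e where "e > 0" "ball 0 e \<subseteq> inv_chart -` U" by (meson openE)
  then show "\<exists>e>0. inv_chart ` ball 0 e \<subseteq> U" by auto
qed

lemma open_vimage_inv_chart:
  assumes "openin riemann_sphere U"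
  shows "open (inv_chart -` U)"
proof (subst open_subopen, rule ballI)
  fix w assume w: "w \<in> inv_chart -` U"
  show "\<exists>T. open T \<and> w \<in> T \<and> T \<subseteq> inv_chart -` U" 
  proof (cases "w = 0")
    case True
    with w have "None \<in> U" by (simp add: inv_chart_def)
    with assms obtain e where "e > 0" "inv_chart ` ball 0 e \<subseteq> U"
      unfolding openin_riemann_sphere_iff_nbhd by auto
    then have "open (ball 0 e)" "0 \<in> ball 0 e" "ball 0 e \<subseteq> inv_chart -` U"
      by auto
    with True show ?thesis by blast
  next
    case False
    have "continuous_on (- {0}) (inverse :: complex \<Rightarrow> complex)" by (intro continuous_intros) auto
    then have "open ((-{0}) \<inter> inverse -` (Some -` U) :: complex set)"
      using open_vimage_Some[OF assms] by (rule continuous_open_preimage[OF _ open_Compl[OF closed_singleton]])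
    moreover have "w \<in> (-{0}) \<inter> inverse -` (Some -` U)" using w False by (simp add: inv_chart_def)
    moreover have "(-{0}) \<inter> inverse -` (Some -` U) \<subseteq> inv_chart -` U" by (auto simp: inv_chart_def)
    ultimately show ?thesis by blast
  qed
qed

lemma compact_space_riemann_sphere: "compact_space riemann_sphere"
  by (simp add: riemann_sphere_def)

lemma Hausdorff_riemann_sphere: "Hausdorff_space riemann_sphere"
  unfolding riemann_sphere_def
  by (auto simp: Hausdorff_space_Alexandroff_compactification Hausdorff_space_euclidean locally_compact_space_euclidean)

lemma compactin_Some_image: "compact K \<Longrightarrow> compactin riemann_sphere (Some ` K)"
  unfolding riemann_sphere_def
  by (rule image_compactin[OF _ continuous_map_Some]) simp

lemma closedin_imp_compactin_sphere: "closedin riemann_sphere C \<Longrightarrow> compactin riemann_sphere C"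
  using closedin_compact_space compact_space_riemann_sphere by blast

text \<open>Images of compact plane sets are closed because the sphere is Hausdorff, so closures stay inside them.\<close>

lemma relatively_compact_Some:
  assumes "compact K" "S \<subseteq> Some ` K" "Some ` K \<subseteq> D"
  shows "S \<Subset> D"
proof -
  have "closedin riemann_sphere (Some ` K)"
    using compactin_imp_closedin[OF Hausdorff_riemann_sphere compactin_Some_image[OF assms(1)]] .
  then have "riemann_sphere closure_of S \<subseteq> Some ` K"
    using assms(2) by (simp add: closure_of_minimal)
  then show ?thesis
    unfolding relatively_compact_in_def
    using assms(3) closedin_imp_compactin_sphere closedin_closure_of by blast
qed

section \<open>Zeros of holomorphic functions on the sphere\<close>

lemma holomorphic_zeros_isolated_or_locally_zero:
  assumes "F holomorphic_on U" "open U" "w \<in> U"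
  shows "\<exists>e>0. ball w e \<subseteq> U \<and> ((\<forall>z\<in>ball w e. F z = 0) \<or> (\<forall>z\<in>ball w e - {w}. F z \<noteq> 0))"
proof -
  obtain e where e: "e > 0" "ball w e \<subseteq> U" using assms openE by blast
  show ?thesis
  proof (cases "\<forall>z\<in>ball w e. F z = 0")
    case False
    then obtain b where b: "b \<in> ball w e" "F b \<noteq> 0" by auto
    have "F holomorphic_on ball w e" using assms(1) e(2) holomorphic_on_subset by blast
    from non_zero_neighbour_alt[OF this _ _ _ b] e(1)
    have "eventually (\<lambda>z. F z \<noteq> 0 \<and> z \<in> ball w e) (at w)" by auto
    then obtain d where d: "d > 0" "\<And>z. z \<noteq> w \<Longrightarrow> dist z w < d \<Longrightarrow> F z \<noteq> 0"
      unfolding eventually_at by auto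
    with e show ?thesis
      by (intro exI[of _ "min d e"]) (auto simp: dist_commute)
  qed (use e in auto)
qed

lemma sphere_chart_cases:
  assumes "openin riemann_sphere D" "p \<in> D" "f \<in> Hol D"
  shows "\<exists>V. openin riemann_sphere V \<and> p \<in> V \<and> V \<subseteq> D \<and> ((\<forall>q\<in>V. f q = 0) \<or> (\<forall>q\<in>V - {p}. f q \<noteq> 0))"
proof (cases p)
  case (Some c)
  have "f \<circ> Some holomorphic_on Some -` D" using assms(3) by (simp add: Hol_def)
  from holomorphic_zeros_isolated_or_locally_zero[OF this open_vimage_Some[OF assms(1)], of c]
  obtain e where e: "e > 0" "ball c e \<subseteq> Some -` D"
     "(\<forall>z\<in>ball c e. f (Some z) = 0) \<or> (\<forall>z\<in>ball c e - {c}. f (Some z) \<noteq> 0)"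
    using Some assms(2) by auto
  show ?thesis
    by (rule exI[of _ "Some ` ball c e"]) (use e Some in \<open>auto simp: openin_Some_image\<close>)
next
  case None
  have "f \<circ> inv_chart holomorphic_on inv_chart -` D" using assms(3) by (simp add: Hol_def)
  from holomorphic_zeros_isolated_or_locally_zero[OF this open_vimage_inv_chart[OF assms(1)], of 0]
  obtain e where e: "e > 0" "ball 0 e \<subseteq> inv_chart -` D"
     "(\<forall>z\<in>ball 0 e. f (inv_chart z) = 0) \<or> (\<forall>z\<in>ball 0 e - {0}. f (inv_chart z) \<noteq> 0)"
    using None assms(2) by (auto simp: inv_chart_def)
  have 0: "inv_chart 0 = None" by (simp add: inv_chart_def)
  have "None \<in> inv_chart ` ball 0 e" unfolding 0[symmetric] by (rule imageI) (use e(1) in simp)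
  then show ?thesis
    by (intro exI[of _ "inv_chart ` ball 0 e"]) (use e None openin_inv_chart_ball 0 in \<open>auto\<close>)
qed

text \<open>The identity theorem on the sphere. Points where \<open>f\<close> vanishes locally and points with a punctured
neighbourhood free of zeros form two disjoint open sets that cover \<open>D\<close>; the latter is nonempty, so by
connectedness it is all of \<open>D\<close>. Disjointness uses that no point of the sphere is isolated.\<close>

lemma Hol_zeros_isolated:
  assumes D: "sphere_domain D" and f: "f \<in> Hol D" and nz: "\<exists>z\<in>D. f z \<noteq> 0" and p: "p \<in> D"
  shows "\<exists>V. openin riemann_sphere V \<and> p \<in> V \<and> V \<subseteq> D \<and> (\<forall>q\<in>V - {p}. f q \<noteq> 0)"
proof -
  have oD: "openin riemann_sphere D" and cD: "connectedin riemann_sphere D"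
    using D by (auto simp: sphere_domain_def)
  define A where "A = \<Union>{V. openin riemann_sphere V \<and> V \<subseteq> D \<and> (\<forall>q\<in>V. f q = 0)}"
  define C where "C = \<Union>{V. openin riemann_sphere V \<and> V \<subseteq> D \<and> (\<exists>p\<in>V. \<forall>q\<in>V - {p}. f q \<noteq> 0)}"
  have "openin riemann_sphere A" "openin riemann_sphere C" unfolding A_def C_def by blast+
  have noiso: "\<not> openin riemann_sphere {q}" for q
  proof
    assume q: "openin riemann_sphere {q}"
    show False
    proof (cases q)
      case (Some c)
      then have "Some -` {q} = {c}" by auto
      with open_vimage_Some[OF q] show False by (simp add: not_open_singleton)
    next
      case None
      then have "inv_chart -` {q} = {0}" by (auto simp: inv_chart_def split: if_splits)
      with open_vimage_inv_chart[OF q] show False by (simp add: not_open_singleton)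
    qed
  qed
  have "A \<inter> C = {}"
  proof (rule ccontr)
    assume "A \<inter> C \<noteq> {}"
    then obtain x V W q where *: "x \<in> V" "x \<in> W" "openin riemann_sphere V" "openin riemann_sphere W"
       "\<forall>y\<in>V. f y = 0" "\<forall>y\<in>W - {q}. f y \<noteq> 0"
      unfolding A_def C_def by blast
    then have "V \<inter> W \<subseteq> {q}" "x \<in> V \<inter> W" by auto
    then have "V \<inter> W = {q}" by auto
    with * noiso[of q] show False by (metis openin_Int)
  qed
  moreover have "D \<subseteq> A \<union> C"
  proof
    fix p assume "p \<in> D"
    from sphere_chart_cases[OF oD this f] show "p \<in> A \<union> C" unfolding A_def C_def by blast
  qed
  moreover have "C \<inter> D \<noteq> {}"
  proof -
    obtain z where "z \<in> D" "f z \<noteq> 0" using nz by auto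
    with \<open>D \<subseteq> A \<union> C\<close> show ?thesis unfolding A_def by auto
  qed
  ultimately have "A \<inter> D = {}"
    using cD \<open>openin riemann_sphere A\<close> \<open>openin riemann_sphere C\<close>
    unfolding connectedin by (metis inf_assoc inf_bot_left inf_bot_right)
  then have "\<not> (p \<in> V \<and> openin riemann_sphere V \<and> V \<subseteq> D \<and> (\<forall>q\<in>V. f q = 0))" for V
    using p unfolding A_def by blast
  with sphere_chart_cases[OF oD p f] show ?thesis by blast
qed

lemma Hol_finite_zeros:
  assumes "sphere_domain D" "f \<in> Hol D" "\<exists>z\<in>D. f z \<noteq> 0"
    and K: "compactin riemann_sphere K" "K \<subseteq> D"
  shows "finite {p \<in> K. f p = 0}"
proof -
  define \<U> where "\<U> = {V. openin riemann_sphere V \<and> finite {q\<in>V. f q = 0}}"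
  have "K \<subseteq> \<Union>\<U>"
  proof
    fix p assume "p \<in> K"
    then obtain V where V: "openin riemann_sphere V" "p \<in> V" "\<forall>q\<in>V - {p}. f q \<noteq> 0"
      using Hol_zeros_isolated[OF assms(1-3)] K(2) by blast
    then have "{q\<in>V. f q = 0} \<subseteq> {p}" by auto
    then have "finite {q\<in>V. f q = 0}" using finite_subset by blast
    with V show "p \<in> \<Union>\<U>" by (auto simp: \<U>_def)
  qed
  then obtain \<F> where \<F>: "finite \<F>" "\<F> \<subseteq> \<U>" "K \<subseteq> \<Union>\<F>"
    using compactinD[OF K(1), of \<U>] by (auto simp: \<U>_def)
  have "finite (\<Union>V\<in>\<F>. {q\<in>V. f q = 0})" using \<F> by (auto simp: \<U>_def)
  moreover have "{p \<in> K. f p = 0} \<subseteq> (\<Union>V\<in>\<F>. {q\<in>V. f q = 0})" using \<F>(3) by auto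
  ultimately show ?thesis using finite_subset by blast
qed

text \<open>The sets \<open>{u < n}\<close> form an open cover of \<open>K\<close>.\<close>

lemma usc_bounded_above_on_compactin:
  fixes u :: "'a \<Rightarrow> ereal"
  assumes fin: "\<And>p. p \<in> U \<Longrightarrow> u p < \<infinity>" and usc: "\<And>a. openin X {p\<in>U. u p < a}"
    and K: "compactin X K" "K \<subseteq> U"
  shows "\<exists>b::real. \<forall>p\<in>K. u p < ereal b"
proof -
  define W where "W n = {p\<in>U. u p < ereal (real n)}" for n :: nat
  have "K \<subseteq> \<Union>(range W)"
  proof
    fix p assume "p \<in> K"
    then have "p \<in> U" "u p < \<infinity>" using K fin by auto
    moreover from this(2) obtain n :: nat where "u p < ereal (real n)" using less_PInf_Ex_of_nat by auto
    ultimately show "p \<in> \<Union>(range W)" by (auto simp: W_def)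
  qed
  then obtain \<F> where \<F>: "finite \<F>" "\<F> \<subseteq> range W" "K \<subseteq> \<Union>\<F>"
    using compactinD[OF K(1), of "range W"] usc unfolding W_def by blast
  then obtain I where I: "finite I" "\<F> = W ` I" using finite_subset_image by metis
  have "u p < ereal (real (Max (insert 0 I)))" if pK: "p \<in> K" for p
  proof -
    obtain n where n: "n \<in> I" "p \<in> W n" using pK \<F>(3) I(2) by auto
    then have "u p < ereal (real n)" by (simp add: W_def)
    moreover have "n \<le> Max (insert 0 I)" using I n by simp
    then have "ereal (real n) \<le> ereal (real (Max (insert 0 I)))" by simp
    ultimately show ?thesis by (rule less_le_trans)
  qed
  then show ?thesis by blast
qed

lemma usc_bounded_above_on_compact:
  fixes u :: "complex \<Rightarrow> ereal"
  assumes "\<And>z. z \<in> U \<Longrightarrow> u z < \<infinity>" "\<And>a. open {z\<in>U. u z < a}" "compact K" "K \<subseteq> U"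
  shows "\<exists>b::real. \<forall>z\<in>K. u z < ereal b"
  using usc_bounded_above_on_compactin[of U u euclidean K] assms by simp

lemma sbh_open_bounded_above:
  assumes "u \<in> sbh_open U" "compactin riemann_sphere K" "K \<subseteq> U"
  shows "\<exists>b::real. \<forall>p\<in>K. u p < ereal b"
proof (rule usc_bounded_above_on_compactin[OF _ _ assms(2,3)])
  have s1: "subharmonic_on (u \<circ> Some) (Some -` U)" and s2: "subharmonic_on (u \<circ> inv_chart) (inv_chart -` U)"
    using assms(1) by (auto simp: sbh_open_def)
  show "openin riemann_sphere {p\<in>U. u p < a}" for a
  proof (rule openin_riemann_sphereI)
    have "Some -` {p\<in>U. u p < a} = {z \<in> Some -` U. (u \<circ> Some) z < a}" by auto
    then show "open (Some -` {p\<in>U. u p < a})" using s1 unfolding subharmonic_on_def by metis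
    have "inv_chart -` {p\<in>U. u p < a} = {z \<in> inv_chart -` U. (u \<circ> inv_chart) z < a}" by auto
    then show "open (inv_chart -` {p\<in>U. u p < a})" using s2 unfolding subharmonic_on_def by metis
  qed
  show "u p < \<infinity>" if pU: "p \<in> U" for p
  proof (cases p)
    case (Some c)
    with s1 pU show ?thesis by (auto simp: subharmonic_on_def)
  next
    case None
    then have "p = inv_chart 0" by (simp add: inv_chart_def)
    with s2 pU show ?thesis by (auto simp: subharmonic_on_def)
  qed
qed

section \<open>Smooth functions on the plane\<close>

text \<open>A version of \<^const>\<open>Ck\<close> localised to an open set, so that smoothness can be checked on the pieces of an
open cover; this is how functions on the sphere are seen to be smooth in the chart at \<open>\<infinity>\<close>.\<close>

fun Ck_on :: "nat \<Rightarrow> complex set \<Rightarrow> (complex \<Rightarrow> real) \<Rightarrow> bool" where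
  "Ck_on 0 U g \<longleftrightarrow> continuous_on U g"
| "Ck_on (Suc k) U g \<longleftrightarrow>
     (\<forall>z\<in>U. g differentiable (at z)) \<and> (\<forall>h. Ck_on k U (\<lambda>z. frechet_derivative g (at z) h))"

lemma Ck_on_UNIV: "Ck_on k UNIV g = Ck k g"
  by (induction k arbitrary: g) auto

lemma Ck_on_cong:
  assumes "open U" and "\<And>z. z \<in> U \<Longrightarrow> g z = g' z"
  shows "Ck_on k U g = Ck_on k U g'"
  using assms(2)
proof (induction k arbitrary: g g')
  case 0
  then show ?case by (simp cong: continuous_on_cong)
next
  case (Suc k)
  have *: "(g has_derivative X) (at z) = (g' has_derivative X) (at z)" if "z \<in> U" for z X
    using has_derivative_transform_within_open[OF _ assms(1) that, of g X UNIV g']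
      has_derivative_transform_within_open[OF _ assms(1) that, of g' X UNIV g] Suc.prems
    by auto
  have "frechet_derivative g (at z) = frechet_derivative g' (at z)" if "z \<in> U" for z
    unfolding frechet_derivative_def using *[OF that] by simp
  then have "Ck_on k U (\<lambda>z. frechet_derivative g (at z) h) = Ck_on k U (\<lambda>z. frechet_derivative g' (at z) h)" for h
    by (intro Suc.IH) simp
  moreover have "g differentiable (at z) \<longleftrightarrow> g' differentiable (at z)" if "z \<in> U" for z
    unfolding differentiable_def using *[OF that] by simp
  ultimately show ?case by simp
qed

lemma Ck_on_SucI:
  assumes "open U" and D: "\<And>z. z \<in> U \<Longrightarrow> (g has_derivative D z) (at z)"
    and "\<And>h. Ck_on k U (\<lambda>z. D z h)"
  shows "Ck_on (Suc k) U g"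
proof -
  have "Ck_on k U (\<lambda>z. frechet_derivative g (at z) h)" for h
    using Ck_on_cong[OF assms(1), of "\<lambda>z. frechet_derivative g (at z) h" "\<lambda>z. D z h"]
      frechet_derivative_at[OF D] assms(3) by metis
  with D show ?thesis by (auto simp: differentiable_def)
qed

lemma Ck_on_SucD: "Ck_on (Suc k) U g \<Longrightarrow> Ck_on k U g"
proof (induction k arbitrary: g)
  case 0
  then show ?case
    by (auto intro!: continuous_at_imp_continuous_on differentiable_imp_continuous_within)
next
  case (Suc k)
  have "Ck_on k U (\<lambda>z. frechet_derivative g (at z) h)" for h
    using Suc.prems by (intro Suc.IH) (simp only: Ck_on.simps(2)[of "Suc k"])
  then show ?case using Suc.prems by (simp only: Ck_on.simps(2)) simp
qed

lemma Ck_on_Un: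
  assumes "open U" "open V" "Ck_on k U g" "Ck_on k V g"
  shows "Ck_on k (U \<union> V) g"
  using assms(3,4)
  by (induction k arbitrary: g) (auto intro: continuous_on_open_Un[OF assms(1,2)])

lemma Ck_on_const: "open U \<Longrightarrow> Ck_on k U (\<lambda>z. c)"
proof (induction k arbitrary: c)
  case (Suc k)
  show ?case by (rule Ck_on_SucI[where D="\<lambda>z h. 0"]) (use Suc in auto)
qed auto

lemma frechet_derivative_worksI:
  "f differentiable F \<Longrightarrow> (f has_derivative frechet_derivative f F) F"
  by (simp add: frechet_derivative_works)

lemma Ck_on_add:
  assumes "open U"
  shows "Ck_on k U f \<Longrightarrow> Ck_on k U g \<Longrightarrow> Ck_on k U (\<lambda>z. f z + g z)"
proof (induction k arbitrary: f g)
  case 0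
  then show ?case by (auto intro: continuous_intros)
next
  case (Suc k)
  show ?case
    by (rule Ck_on_SucI[OF assms, where D="\<lambda>z h. frechet_derivative f (at z) h + frechet_derivative g (at z) h"])
      (use Suc in \<open>auto intro!: has_derivative_add frechet_derivative_worksI\<close>)
qed

lemma Ck_on_mult:
  assumes "open U"
  shows "Ck_on k U f \<Longrightarrow> Ck_on k U g \<Longrightarrow> Ck_on k U (\<lambda>z. f z * g z)"
proof (induction k arbitrary: f g)
  case 0
  then show ?case by (auto intro: continuous_intros)
next
  case (Suc k)
  have "Ck_on k U f" "Ck_on k U g"
    using Suc.prems Ck_on_SucD by blast+
  then show ?case
    using Suc
    by (intro Ck_on_SucI[OF assms, where D="\<lambda>z h. f z * frechet_derivative g (at z) h + frechet_derivative f (at z) h * g z"])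
      (auto intro!: has_derivative_mult Ck_on_add[OF assms] frechet_derivative_worksI)
qed

lemma Ck_on_bounded_linear:
  assumes "bounded_linear l" "open U"
  shows "Ck_on k U l"
proof (cases k)
  case 0
  then show ?thesis using assms by (simp add: bounded_linear.continuous_on[OF _ continuous_on_id])
next
  case (Suc m)
  show ?thesis unfolding Suc
    by (rule Ck_on_SucI[OF assms(2), where D="\<lambda>z. l"])
      (use assms bounded_linear_imp_has_derivative Ck_on_const in auto)
qed

lemma Ck_on_Re_holomorphic:
  assumes "open U"
  shows "h holomorphic_on U \<Longrightarrow> Ck_on k U (\<lambda>z. Re (h z))"
proof (induction k arbitrary: h)
  case 0
  then show ?case by (auto intro!: continuous_intros holomorphic_on_imp_continuous_on)
next
  case (Suc k)
  show ?case
  proof (rule Ck_on_SucI[OF assms, where D="\<lambda>z w. Re (deriv h z * w)"])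
    show "((\<lambda>z. Re (h z)) has_derivative (\<lambda>w. Re (deriv h z * w))) (at z)" if "z \<in> U" for z
      by (rule has_derivative_Re)
        (use holomorphic_derivI[OF Suc.prems assms that] in \<open>simp add: has_field_derivative_def\<close>)
    show "Ck_on k U (\<lambda>z. Re (deriv h z * w))" for w
      by (intro Suc.IH holomorphic_intros holomorphic_deriv Suc.prems assms)
  qed
qed

text \<open>A real derivative is determined by the directions \<open>1\<close> and \<open>\<i>\<close>. The chain rule below needs this, since
there the direction of differentiation varies with the point.\<close>

lemma derivative_along_Re_Im:
  fixes D :: "complex \<Rightarrow> real"
  assumes "(g has_derivative D) F"
  shows "D h = Re h * D 1 + Im h * D \<i>"
proof -
  have l: "linear D" using assms has_derivative_linear by auto
  have "h = Re h *\<^sub>R 1 + Im h *\<^sub>R \<i>" by (simp add: complex_eq_iff)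
  then have "D h = D (Re h *\<^sub>R 1 + Im h *\<^sub>R \<i>)" by simp
  also have "\<dots> = Re h * D 1 + Im h * D \<i>"
    by (simp only: linear_add[OF l] linear_scale[OF l] real_scaleR_def)
  finally show ?thesis .
qed

lemma Ck_on_compose_holomorphic:
  assumes "open U" "open V" "h holomorphic_on V" "h ` V \<subseteq> U"
  shows "Ck_on k U g \<Longrightarrow> Ck_on k V (\<lambda>z. g (h z))"
proof (induction k arbitrary: g)
  case 0
  have "continuous_on V (g \<circ> h)"
    using 0 assms by (intro continuous_on_compose holomorphic_on_imp_continuous_on) (auto elim: continuous_on_subset)
  then show ?case by (simp add: o_def)
next
  case (Suc k)
  define G where "G e z = frechet_derivative g (at z) e" for e z
  have gd: "(g has_derivative (\<lambda>e. G e z)) (at z)" if "z \<in> U" for z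
    using Suc.prems that frechet_derivative_works unfolding G_def by auto
  show ?case
  proof (rule Ck_on_SucI[OF assms(2), where D="\<lambda>z w. Re (deriv h z * w) * G 1 (h z) + Re (- \<i> * deriv h z * w) * G \<i> (h z)"])
    fix z assume z: "z \<in> V"
    then have hz: "h z \<in> U" using assms by auto
    have "(h has_derivative (\<lambda>w. deriv h z * w)) (at z)"
      using holomorphic_derivI[OF assms(3,2) z] by (simp add: has_field_derivative_def)
    from diff_chain_at[OF this gd[OF hz]]
    have "((\<lambda>z. g (h z)) has_derivative (\<lambda>w. G (deriv h z * w) (h z))) (at z)"
      by (simp add: o_def)
    moreover have "G (deriv h z * w) (h z) = Re (deriv h z * w) * G 1 (h z) + Re (- \<i> * deriv h z * w) * G \<i> (h z)" for w
    proof -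
      have "Im (deriv h z * w) = Re (- \<i> * deriv h z * w)" by simp
      with derivative_along_Re_Im[OF gd[OF hz], of "deriv h z * w"] show ?thesis by (simp only:)
    qed
    ultimately show "((\<lambda>z. g (h z)) has_derivative (\<lambda>w. Re (deriv h z * w) * G 1 (h z) + Re (- \<i> * deriv h z * w) * G \<i> (h z))) (at z)"
      by (simp only:)
  next
    fix w
    have "Ck_on k V (\<lambda>z. G e (h z))" for e
      using Suc unfolding G_def by auto
    then show "Ck_on k V (\<lambda>z. Re (deriv h z * w) * G 1 (h z) + Re (- \<i> * deriv h z * w) * G \<i> (h z))"
      using assms by (intro Ck_on_add Ck_on_mult Ck_on_Re_holomorphic holomorphic_intros holomorphic_deriv)
  qed
qed

text \<open>The functions \<open>exp (-1/x) / x\<^sup>n\<close>, extended by \<open>0\<close>. The family is closed under differentiation up to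
linear combinations, so smoothness of \<open>bump 0\<close>, the classical flat function, follows by induction over the
order for all \<open>n\<close> simultaneously.\<close>

definition bump :: "nat \<Rightarrow> real \<Rightarrow> real" where
  "bump n x = (if 0 < x then exp (- (1/x)) / x ^ n else 0)"

lemma bump_tendsto_0: "(bump n \<longlongrightarrow> 0) (at 0)"
proof -
  have "((\<lambda>x::real. (inverse x) ^ n / exp (inverse x)) \<longlongrightarrow> 0) (at_right 0)"
    by (rule filterlim_compose[OF tendsto_power_div_exp_0 filterlim_inverse_at_top_right])
  then have r: "(bump n \<longlongrightarrow> 0) (at_right 0)"
    by (rule Lim_transform_eventually)
      (auto intro!: eventually_at_right_less[THEN eventually_mono] simp: bump_def exp_minus field_simps)
  have l: "(bump n \<longlongrightarrow> 0) (at_left 0)"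
    by (rule Lim_transform_eventually[OF tendsto_const])
      (auto simp: eventually_at_filter bump_def)
  from l r show ?thesis by (simp add: filterlim_at_split)
qed

lemma DERIV_bump: "(bump n has_real_derivative bump (n + 2) x - real n * bump (n + 1) x) (at x)"
proof -
  consider "x > 0" | "x < 0" | "x = 0" by linarith
  then show ?thesis
  proof cases
    case 1
    have "((\<lambda>x. exp (- (1/x)) / x ^ n) has_real_derivative bump (n + 2) x - real n * bump (n + 1) x) (at x)"
      using 1
      apply (cases n)
       apply (auto intro!: derivative_eq_intros simp: bump_def divide_simps power2_eq_square algebra_simps)
      subgoal for m by (cases m) auto
      done
    then show ?thesis
      by (rule has_field_derivative_transform_within_open[where S="{0<..}"])
        (use 1 in \<open>auto simp: bump_def\<close>)
  next
    case 2
    have "((\<lambda>x. 0) has_real_derivative bump (n + 2) x - real n * bump (n + 1) x) (at x)"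
      using 2 by (auto simp: bump_def)
    then show ?thesis
      by (rule has_field_derivative_transform_within_open[where S="{..<0}"])
        (use 2 in \<open>auto simp: bump_def\<close>)
  next
    case 3
    have "((\<lambda>h. (bump n h - bump n 0) / h) \<longlongrightarrow> 0) (at 0)"
      by (rule Lim_transform_eventually[OF bump_tendsto_0[of "Suc n"]])
        (auto simp: bump_def eventually_at_filter divide_simps)
    then have "(bump n has_real_derivative 0) (at 0)"
      unfolding DERIV_def by simp
    with 3 show ?thesis by (simp add: bump_def)
  qed
qed

lemma Ck_bump: "Ck_on k UNIV (\<lambda>z. bump n (s - (norm z)\<^sup>2))"
proof (induction k arbitrary: n)
  case 0
  have "continuous_on UNIV (bump n)"
    using DERIV_bump DERIV_isCont continuous_at_imp_continuous_on by blast
  then have "continuous_on UNIV (bump n \<circ> (\<lambda>z::complex. s - (norm z)\<^sup>2))"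
    by (intro continuous_on_compose continuous_intros) (auto elim: continuous_on_subset)
  then show ?case by (simp add: o_def)
next
  case (Suc k)
  show ?case
  proof (rule Ck_on_SucI[where D="\<lambda>z h. (bump (n+2) (s - (norm z)\<^sup>2) + (- real n) * bump (n+1) (s - (norm z)\<^sup>2)) * (- 2 * (z \<bullet> h))"])
    fix z :: complex
    have "((\<lambda>z. s - (norm z)\<^sup>2) has_derivative (\<lambda>h. - 2 * (z \<bullet> h))) (at z)"
      unfolding power2_norm_eq_inner
      by (auto intro!: derivative_eq_intros simp: inner_commute)
    from diff_chain_at[OF this DERIV_bump[unfolded has_field_derivative_def]]
    show "((\<lambda>z. bump n (s - (norm z)\<^sup>2)) has_derivative
       (\<lambda>h. (bump (n+2) (s - (norm z)\<^sup>2) + (- real n) * bump (n+1) (s - (norm z)\<^sup>2)) * (- 2 * (z \<bullet> h)))) (at z)"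
      by (simp add: o_def)
  next
    fix h
    show "Ck_on k UNIV (\<lambda>z. (bump (n+2) (s - (norm z)\<^sup>2) + (- real n) * bump (n+1) (s - (norm z)\<^sup>2)) * (- 2 * (z \<bullet> h)))"
      by (intro Ck_on_add Ck_on_mult Ck_on_const Suc.IH open_UNIV Ck_on_bounded_linear[OF bounded_linear_inner_left])
  qed auto
qed

section \<open>Lebesgue measure on the plane\<close>

lemma nn_integral_lborel_translate:
  fixes f :: "complex \<Rightarrow> ennreal"
  assumes [measurable]: "f \<in> borel_measurable borel"
  shows "(\<integral>\<^sup>+z. f (c + z) \<partial>lborel) = (\<integral>\<^sup>+z. f z \<partial>lborel)"
  by (subst (2) lborel_distr_plus[of c, symmetric]) (simp add: nn_integral_distr)

lemma integral_lborel_translate: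
  fixes f :: "complex \<Rightarrow> real"
  assumes [measurable]: "f \<in> borel_measurable borel"
  shows "(\<integral>z. f (c + z) \<partial>lborel) = (\<integral>z. f z \<partial>lborel)"
  by (subst (2) lborel_distr_plus[of c, symmetric]) (simp add: integral_distr)

text \<open>Rotations commute with translations up to rotating the translation vector, and the unit ball is rotation
invariant. Computing the convolution of \<open>1\<^sub>A\<close>, taken against the rotated measure, with \<open>1\<close> on the unit
ball in the two possible orders yields \<open>|c\<^sup>-\<^sup>1 A| |ball| = |A| |ball|\<close>, as in the uniqueness proof for
Haar measure.\<close>

lemma lborel_distr_rotation:
  fixes c :: complex
  assumes c: "norm c = 1"
  shows "distr lborel borel ((*) c) = lborel"
proof (rule measure_eqI)
  show "sets (distr lborel borel ((*) c)) = sets lborel" by simp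
  fix A assume "A \<in> sets (distr lborel borel ((*) c))"
  then have A[measurable]: "A \<in> sets borel" by simp
  have c0: "c \<noteq> 0" using c by auto
  define b where "b = emeasure lborel (ball (0::complex) 1)"
  have b: "b \<noteq> 0" "b \<noteq> \<infinity>" "b \<noteq> top"
    using emeasure_lborel_ball_finite[of "0::complex" 1] 
    unfolding b_def by (auto simp: emeasure_ball unit_ball_vol_2)
  have bc: "emeasure lborel (ball p 1) = b" for p :: complex
    unfolding b_def by (simp add: emeasure_ball)
  let ?h = "indicator A :: complex \<Rightarrow> ennreal" and ?k = "indicator (ball 0 1) :: complex \<Rightarrow> ennreal"
  have [measurable]: "?h \<in> borel_measurable borel" "?k \<in> borel_measurable borel"
    by (auto intro!: borel_measurable_indicator)
  have "emeasure (distr lborel borel ((*) c)) A = (\<integral>\<^sup>+x. ?h (c * x) \<partial>lborel)"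
    by (subst nn_integral_indicator[symmetric], simp, subst nn_integral_distr) auto
  then have "emeasure (distr lborel borel ((*) c)) A * b = (\<integral>\<^sup>+x. ?h (c * x) \<partial>lborel) * (\<integral>\<^sup>+y. ?k y \<partial>lborel)"
    unfolding b_def by simp
  also have "\<dots> = (\<integral>\<^sup>+y. (\<integral>\<^sup>+x. ?h (c * x) \<partial>lborel) * ?k y \<partial>lborel)"
    by (rule nn_integral_cmult[symmetric]) simp
  also have "\<dots> = (\<integral>\<^sup>+y. (\<integral>\<^sup>+x. ?h (c * x) * ?k y \<partial>lborel) \<partial>lborel)"
    by (rule nn_integral_cong, rule nn_integral_multc[symmetric]) simp
  also have "\<dots> = (\<integral>\<^sup>+y. (\<integral>\<^sup>+x. ?h (c * (inverse c * y + x)) * ?k y \<partial>lborel) \<partial>lborel)"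
  proof (rule nn_integral_cong)
    fix y
    show "(\<integral>\<^sup>+x. ?h (c * x) * ?k y \<partial>lborel) = (\<integral>\<^sup>+x. ?h (c * (inverse c * y + x)) * ?k y \<partial>lborel)"
      using nn_integral_lborel_translate[of "\<lambda>x. ?h (c * x) * ?k y" "inverse c * y"] by simp
  qed
  also have "\<dots> = (\<integral>\<^sup>+y. (\<integral>\<^sup>+x. ?h (y + c * x) * ?k y \<partial>lborel) \<partial>lborel)"
    using c0 by (simp add: distrib_left mult.assoc[symmetric])
  also have "\<dots> = (\<integral>\<^sup>+x. (\<integral>\<^sup>+y. ?h (y + c * x) * ?k y \<partial>lborel) \<partial>lborel)"
    by (rule lborel_pair.Fubini'[symmetric]) measurable
  also have "\<dots> = (\<integral>\<^sup>+x. (\<integral>\<^sup>+y. ?h (y + c * x) * ?k ((y + c * x) - c * x) \<partial>lborel) \<partial>lborel)"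
    by simp
  also have "\<dots> = (\<integral>\<^sup>+x. (\<integral>\<^sup>+y. ?h y * ?k (y - c * x) \<partial>lborel) \<partial>lborel)"
  proof (rule nn_integral_cong)
    fix x
    show "(\<integral>\<^sup>+y. ?h (y + c * x) * ?k ((y + c * x) - c * x) \<partial>lborel) = (\<integral>\<^sup>+y. ?h y * ?k (y - c * x) \<partial>lborel)"
      using nn_integral_lborel_translate[of "\<lambda>y. ?h y * ?k (y - c * x)" "c * x"] by (simp add: add.commute)
  qed
  also have "\<dots> = (\<integral>\<^sup>+y. (\<integral>\<^sup>+x. ?h y * ?k (y - c * x) \<partial>lborel) \<partial>lborel)"
    by (rule lborel_pair.Fubini') measurable
  also have "\<dots> = (\<integral>\<^sup>+y. ?h y * (\<integral>\<^sup>+x. ?k (y - c * x) \<partial>lborel) \<partial>lborel)"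
    by (rule nn_integral_cong, rule nn_integral_cmult) simp
  also have "\<dots> = (\<integral>\<^sup>+y. ?h y * b \<partial>lborel)"
  proof (rule nn_integral_cong)
    fix y
    have "norm (y - c * x) = dist (inverse c * y) x" for x
    proof -
      have "y - c * x = c * (inverse c * y - x)" using c0 by (simp add: algebra_simps)
      then show ?thesis using c by (simp add: norm_mult dist_norm)
    qed
    then have "?k (y - c * x) = indicator (ball (inverse c * y) 1) x" for x
      by (simp add: indicator_def)
    then show "?h y * (\<integral>\<^sup>+x. ?k (y - c * x) \<partial>lborel) = ?h y * b"
      by (simp add: bc)
  qed
  also have "\<dots> = emeasure lborel A * b"
    by (simp add: nn_integral_multc)
  finally show "emeasure (distr lborel borel ((*) c)) A = emeasure lborel A"
    using b by (metis ennreal_mult_divide_eq)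
qed

lemma integral_lborel_rotate:
  fixes f :: "complex \<Rightarrow> real"
  assumes [measurable]: "f \<in> borel_measurable borel" and "norm c = 1"
  shows "(\<integral>z. f (c * z) \<partial>lborel) = (\<integral>z. f z \<partial>lborel)"
  by (subst (2) lborel_distr_rotation[OF assms(2), symmetric]) (simp add: integral_distr)

lemma integrable_bounded_support:
  fixes f :: "complex \<Rightarrow> real"
  assumes [measurable]: "f \<in> borel_measurable borel" and "\<And>z. \<bar>f z\<bar> \<le> B" and "\<And>z. norm z > R \<Longrightarrow> f z = 0"
  shows "integrable lborel f"
proof (rule Bochner_Integration.integrable_bound)
  show "integrable lborel (\<lambda>z::complex. B * indicator (cball 0 R) z)"
    using emeasure_lborel_cball_finite[of "0::complex" R]
    by (intro integrable_mult_right integrable_real_indicator) auto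
  show "AE z in lborel. norm (f z) \<le> norm (B * indicator (cball 0 R) z)"
    using assms(2,3) by (intro AE_I2) (auto simp: indicator_def not_le intro: order_trans[OF _ abs_ge_self])
qed simp

text \<open>Functions such as \<open>ln |G| * \<Delta>\<psi>\<close> make sense on \<open>U\<close> only, but vanish off a compact subset of \<open>U\<close>; they can
be treated as continuous functions on the whole plane.\<close>

lemma continuous_on_zero_extension:
  assumes "open U" "closed K" "K \<subseteq> U" "continuous_on U f" "\<And>z. z \<notin> K \<Longrightarrow> f z = (0::real)"
  shows "continuous_on UNIV f"
proof -
  have "continuous_on (- K) f"
    by (rule continuous_on_eq[of _ "\<lambda>_. 0"]) (use assms in auto)
  then have "continuous_on (U \<union> - K) f"
    using assms by (intro continuous_on_open_Un) auto
  moreover have "U \<union> - K = UNIV" using assms(3) by auto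
  ultimately show ?thesis by simp
qed

lemma compact_support_bounded:
  fixes f :: "complex \<Rightarrow> real"
  assumes "continuous_on UNIV f" "compact K" "\<And>z. z \<notin> K \<Longrightarrow> f z = 0"
  shows "\<exists>C\<ge>0. \<forall>z. \<bar>f z\<bar> \<le> C"
proof -
  obtain B where B: "\<And>z. z \<in> K \<Longrightarrow> norm (f z) \<le> B"
    using compact_imp_bounded[OF compact_continuous_image[OF continuous_on_subset[OF assms(1)] assms(2)]]
    unfolding bounded_iff by auto
  have "\<bar>f z\<bar> \<le> max B 0" for z using B[of z] assms(3)[of z] by (cases "z \<in> K") auto
  then show ?thesis by (intro exI[of _ "max B 0"]) auto
qed

lemma integrable_continuous_support:
  fixes f :: "complex \<Rightarrow> real"
  assumes "continuous_on UNIV f" "compact K" "\<And>z. z \<notin> K \<Longrightarrow> f z = 0"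
  shows "integrable lborel f"
proof -
  obtain R where R: "\<And>z. z \<in> K \<Longrightarrow> norm z \<le> R"
    using compact_imp_bounded[OF assms(2)] unfolding bounded_iff by auto
  obtain C where C: "\<And>z. \<bar>f z\<bar> \<le> C"
    using compact_support_bounded[OF assms] by blast
  show ?thesis
  proof (rule integrable_bounded_support[of f C R, OF _ C])
    show "f \<in> borel_measurable borel" using assms(1) by (rule borel_measurable_continuous_onI)
    show "f z = 0" if "norm z > R" for z using assms(3)[of z] R[of z] that by force
  qed
qed

text \<open>By translation invariance each difference quotient \<open>(F (z + t e) - F z) / t\<close> has integral \<open>0\<close>. The
quotients are bounded by the mean value theorem and converge to the directional derivative.\<close>

lemma integral_derivative_eq_0:
  fixes F :: "complex \<Rightarrow> real"
  assumes K: "compact K" and F0: "\<And>z. z \<notin> K \<Longrightarrow> F z = 0"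
    and D: "\<And>z. (F has_derivative D z) (at z)"
    and cont: "continuous_on UNIV (\<lambda>z. D z e)"
  shows "(\<integral>z. D z e \<partial>lborel) = 0"
proof -
  have contF: "continuous_on UNIV F"
    using D has_derivative_continuous continuous_at_imp_continuous_on by blast
  then have [measurable]: "F \<in> borel_measurable borel" by (rule borel_measurable_continuous_onI)
  have [measurable]: "(\<lambda>z. D z e) \<in> borel_measurable borel" using cont by (rule borel_measurable_continuous_onI)
  have intF: "integrable lborel F" by (rule integrable_continuous_support[OF contF K F0])
  have D0: "D z e = 0" if "z \<notin> K" for z
  proof -
    have "(F has_derivative (\<lambda>_. 0)) (at z)"
      by (rule has_derivative_transform_within_open[of "\<lambda>_. 0" _ _ _ "- K"])
        (use that F0 compact_imp_closed[OF K] in auto)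
    with D[of z] have "D z = (\<lambda>_. 0)" by (rule has_derivative_unique)
    then show ?thesis by simp
  qed
  obtain B where B: "\<And>z. z \<in> K \<Longrightarrow> norm (D z e) \<le> B"
    using compact_imp_bounded[OF compact_continuous_image[OF continuous_on_subset[OF cont] K]]
    unfolding bounded_iff by auto
  define B' where "B' = max B 0"
  have B': "\<bar>D z e\<bar> \<le> B'" for z using B[of z] D0[of z] by (cases "z \<in> K") (auto simp: B'_def)
  obtain R where R: "\<And>z. z \<in> K \<Longrightarrow> norm z \<le> R"
    using compact_imp_bounded[OF K] unfolding bounded_iff by auto
  define t where "t n = inverse (real (Suc n))" for n
  have t: "0 < t n" "t n \<le> 1" for n unfolding t_def by (auto simp: field_simps)
  (* difference quotients in direction e, with step sizes tending to 0 *)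
  define q where "q n z = (F (t n *\<^sub>R e + z) - F z) / t n" for n z
  have F_line: "((\<lambda>s. F (z + s *\<^sub>R e)) has_real_derivative D (z + s *\<^sub>R e) e) (at s)" for z s
  proof -
    have "((\<lambda>s. z + s *\<^sub>R e) has_derivative (\<lambda>h. h *\<^sub>R e)) (at s)"
      by (auto intro!: derivative_eq_intros)
    from diff_chain_at[OF this D] have "((\<lambda>s. F (z + s *\<^sub>R e)) has_derivative (\<lambda>h. D (z + s *\<^sub>R e) (h *\<^sub>R e))) (at s)"
      by (simp add: o_def)
    moreover have "D (z + s *\<^sub>R e) (h *\<^sub>R e) = D (z + s *\<^sub>R e) e * h" for h
      using linear_scale[OF has_derivative_linear[OF D]] by simp
    ultimately show ?thesis by (simp add: has_field_derivative_def)
  qed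
  have q_bound: "\<bar>q n z\<bar> \<le> B'" for n z
  proof -
    have "norm (F (z + t n *\<^sub>R e) - F (z + 0 *\<^sub>R e)) \<le> B' * norm (t n - 0)"
      by (rule field_differentiable_bound[of UNIV _ "\<lambda>s. D (z + s *\<^sub>R e) e"])
        (use F_line B' in \<open>auto intro: has_field_derivative_at_within\<close>)
    then show ?thesis using t(1)[of n] by (simp add: q_def field_simps)
  qed
  have q_int: "(\<integral>z. q n z \<partial>lborel) = 0" for n
  proof -
    have "integrable lborel (\<lambda>z. F (t n *\<^sub>R e + z))"
    proof (rule integrable_continuous_support[of _ "(\<lambda>z. z - t n *\<^sub>R e) ` K"])
      show "continuous_on UNIV (\<lambda>z. F (t n *\<^sub>R e + z))"
        by (rule continuous_on_compose2[OF contF]) (auto intro!: continuous_intros)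
      show "compact ((\<lambda>z. z - t n *\<^sub>R e) ` K)"
        by (intro compact_continuous_image continuous_intros K)
      show "F (t n *\<^sub>R e + z) = 0" if "z \<notin> (\<lambda>z. z - t n *\<^sub>R e) ` K" for z
      proof (rule F0, rule notI)
        assume "t n *\<^sub>R e + z \<in> K"
        then have "(t n *\<^sub>R e + z) - t n *\<^sub>R e \<in> (\<lambda>z. z - t n *\<^sub>R e) ` K" by (rule imageI)
        with that show False by simp
      qed
    qed
    then have "(\<integral>z. q n z \<partial>lborel) = ((\<integral>z. F (t n *\<^sub>R e + z) \<partial>lborel) - (\<integral>z. F z \<partial>lborel)) / t n"
      unfolding q_def using intF by simp
    then show ?thesis by (simp add: integral_lborel_translate)
  qed
  have "(\<lambda>n. \<integral>z. q n z \<partial>lborel) \<longlonglongrightarrow> (\<integral>z. D z e \<partial>lborel)"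
  proof (rule integral_dominated_convergence[where w="\<lambda>z. B' * indicator (cball 0 (R + norm e)) z"])
    show "integrable lborel (\<lambda>z::complex. B' * indicator (cball 0 (R + norm e)) z)"
      by (rule integrable_bounded_support[of _ "\<bar>B'\<bar>" "R + norm e"]) (auto simp: indicator_def)
    show "AE z in lborel. (\<lambda>n. q n z) \<longlonglongrightarrow> D z e"
    proof (rule AE_I2)
      fix z
      have "((\<lambda>s. (F (z + s *\<^sub>R e) - F z) / s) \<longlongrightarrow> D z e) (at 0)"
        using F_line[of z 0] by (simp add: DERIV_def)
      moreover have "filterlim t (at 0) sequentially"
        using LIMSEQ_inverse_real_of_nat unfolding t_def filterlim_at by auto
      ultimately show "(\<lambda>n. q n z) \<longlonglongrightarrow> D z e"
        unfolding q_def using filterlim_compose by (fastforce simp: add.commute)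
    qed
    show "AE z in lborel. norm (q n z) \<le> B' * indicator (cball 0 (R + norm e)) z" for n
    proof (rule AE_I2)
      fix z
      show "norm (q n z) \<le> B' * indicator (cball 0 (R + norm e)) z"
      proof (cases "norm z \<le> R + norm e")
        case True
        then show ?thesis using q_bound by simp
      next
        case False
        have "norm z \<le> norm (t n *\<^sub>R e + z) + norm (t n *\<^sub>R e)"
          by (metis add_diff_cancel_left' norm_triangle_sub norm_triangle_ineq4 add.commute)
        moreover have "norm (t n *\<^sub>R e) \<le> norm e"
          using t[of n] by (simp add: mult_left_le_one_le)
        ultimately have n: "R < norm (t n *\<^sub>R e + z)" "R < norm z"
          using False norm_ge_zero[of e] by linarith+
        then have "t n *\<^sub>R e + z \<notin> K" "z \<notin> K" using R by force+
        then show ?thesis using False F0 by (simp add: q_def)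
      qed
    qed
  qed (auto simp: q_def)
  then have "(\<lambda>n. 0) \<longlonglongrightarrow> (\<integral>z. D z e \<partial>lborel)" by (simp only: q_int)
  then show ?thesis by (simp add: LIMSEQ_const_iff)
qed

section \<open>Smooth functions with compact support\<close>

text \<open>The support condition is stated without a closure: \<open>K\<close> is any set off which \<open>\<psi>\<close> vanishes. It is
inherited by derivatives as soon as \<open>K\<close> is closed.\<close>

definition smooth_in :: "complex set \<Rightarrow> (complex \<Rightarrow> real) \<Rightarrow> bool" where
  "smooth_in K \<psi> \<longleftrightarrow> (\<forall>k. Ck k \<psi>) \<and> (\<forall>z. z \<notin> K \<longrightarrow> \<psi> z = 0)"

definition dir_deriv :: "complex \<Rightarrow> (complex \<Rightarrow> real) \<Rightarrow> complex \<Rightarrow> real" where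
  "dir_deriv e g z = frechet_derivative g (at z) e"

lemma laplacian_dir_deriv:
  "laplacian g z = dir_deriv 1 (dir_deriv 1 g) z + dir_deriv \<i> (dir_deriv \<i> g) z"
  by (simp add: laplacian_def dir_deriv_def[abs_def])

lemma smooth_in_has_derivative:
  assumes "smooth_in K \<psi>"
  shows "(\<psi> has_derivative (\<lambda>e. dir_deriv e \<psi> z)) (at z)"
proof -
  have "Ck (Suc 0) \<psi>" using assms by (auto simp: smooth_in_def)
  then show ?thesis unfolding dir_deriv_def by (auto intro: frechet_derivative_worksI)
qed

lemma smooth_in_zero: "smooth_in K \<psi> \<Longrightarrow> z \<notin> K \<Longrightarrow> \<psi> z = 0"
  by (simp add: smooth_in_def)

lemma smooth_in_continuous: "smooth_in K \<psi> \<Longrightarrow> continuous_on A \<psi>"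
  using continuous_on_subset[of UNIV \<psi> A] unfolding smooth_in_def by (metis Ck.simps(1) subset_UNIV)

lemma smooth_in_dir_deriv:
  assumes "smooth_in K \<psi>" "closed K"
  shows "smooth_in K (dir_deriv e \<psi>)"
  unfolding smooth_in_def
proof (intro conjI allI impI)
  fix k
  have "Ck (Suc k) \<psi>" using assms by (simp add: smooth_in_def del: Ck.simps)
  then show "Ck k (dir_deriv e \<psi>)" by (simp add: dir_deriv_def[abs_def])
next
  fix z assume "z \<notin> K"
  have "(\<psi> has_derivative (\<lambda>_. 0)) (at z)"
    by (rule has_derivative_transform_within_open[of "\<lambda>_. 0" _ _ _ "- K"])
      (use \<open>z \<notin> K\<close> assms in \<open>auto simp: smooth_in_def\<close>)
  from has_derivative_unique[OF smooth_in_has_derivative[OF assms(1)] this]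
  show "dir_deriv e \<psi> z = 0" by metis
qed

lemma smooth_in_laplacian:
  assumes "smooth_in K \<psi>" "closed K"
  shows "continuous_on A (laplacian \<psi>)" and "z \<notin> K \<Longrightarrow> laplacian \<psi> z = 0"
proof -
  have *: "smooth_in K (dir_deriv e (dir_deriv e \<psi>))" for e
    using assms by (intro smooth_in_dir_deriv)
  show "continuous_on A (laplacian \<psi>)"
    unfolding laplacian_dir_deriv[abs_def] by (intro continuous_intros smooth_in_continuous[OF *])
  show "z \<notin> K \<Longrightarrow> laplacian \<psi> z = 0"
    using * unfolding laplacian_dir_deriv smooth_in_def by simp
qed

text \<open>Green's second identity in one direction: \<open>h * \<partial>\<^sub>e\<partial>\<^sub>e\<psi> - \<psi> * \<partial>\<^sub>e\<partial>\<^sub>eh\<close> is the derivative of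
\<open>h * \<partial>\<^sub>e\<psi> - \<psi> * \<partial>\<^sub>eh\<close>, which has compact support. The function \<open>h\<close> is differentiable on \<open>\<Omega>\<close> only; its
values elsewhere are multiplied by \<open>0\<close>.\<close>

lemma integral_ibp_twice:
  assumes \<psi>: "smooth_in K \<psi>" and K: "compact K" "K \<subseteq> \<Omega>" "open \<Omega>"
    and h: "\<And>z. z \<in> \<Omega> \<Longrightarrow> (h has_derivative h' z) (at z)"
    and h2: "\<And>z. z \<in> \<Omega> \<Longrightarrow> ((\<lambda>z. h' z e) has_derivative h'' z) (at z)"
    and cont: "continuous_on \<Omega> (\<lambda>z. h'' z e)"
  shows "integrable lborel (\<lambda>z. h z * dir_deriv e (dir_deriv e \<psi>) z)"
    and "integrable lborel (\<lambda>z. \<psi> z * h'' z e)"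
    and "(\<integral>z. h z * dir_deriv e (dir_deriv e \<psi>) z \<partial>lborel) = (\<integral>z. \<psi> z * h'' z e \<partial>lborel)"
proof -
  have cK: "closed K" using K compact_imp_closed by blast
  define \<psi>1 where "\<psi>1 = dir_deriv e \<psi>"
  define \<psi>2 where "\<psi>2 = dir_deriv e \<psi>1"
  have s1: "smooth_in K \<psi>1" unfolding \<psi>1_def by (intro smooth_in_dir_deriv \<psi> cK)
  have s2: "smooth_in K \<psi>2" unfolding \<psi>2_def by (intro smooth_in_dir_deriv s1 cK)
  have zero: "\<psi> z = 0" "\<psi>1 z = 0" "\<psi>2 z = 0" if "z \<notin> K" for z
    using \<psi> s1 s2 that by (auto simp: smooth_in_def)
  have conth: "continuous_on \<Omega> h"
    using h has_derivative_continuous continuous_at_imp_continuous_on by blast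
  have c1: "continuous_on UNIV (\<lambda>z. h z * \<psi>2 z)"
    by (rule continuous_on_zero_extension[OF K(3) cK K(2)])
      (auto intro!: continuous_intros conth smooth_in_continuous[OF s2] zero)
  have c2: "continuous_on UNIV (\<lambda>z. \<psi> z * h'' z e)"
    by (rule continuous_on_zero_extension[OF K(3) cK K(2)])
      (auto intro!: continuous_intros cont smooth_in_continuous[OF \<psi>] zero)
  show i1: "integrable lborel (\<lambda>z. h z * dir_deriv e (dir_deriv e \<psi>) z)"
    using integrable_continuous_support[OF c1 K(1)] zero by (simp add: \<psi>2_def \<psi>1_def)
  show i2: "integrable lborel (\<lambda>z. \<psi> z * h'' z e)"
    using integrable_continuous_support[OF c2 K(1)] zero by simp
  define D where "D z w = (if z \<in> K then h z * dir_deriv w \<psi>1 z + h' z w * \<psi>1 z - (\<psi> z * h'' z w + dir_deriv w \<psi> z * h' z e) else 0)" for z w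
  have De: "D z e = h z * \<psi>2 z - \<psi> z * h'' z e" for z
    using zero[of z] by (auto simp: D_def \<psi>2_def \<psi>1_def)
  have "(\<integral>z. D z e \<partial>lborel) = 0"
  proof (rule integral_derivative_eq_0[OF K(1), of "\<lambda>z. h z * \<psi>1 z - \<psi> z * h' z e"])
    show "h z * \<psi>1 z - \<psi> z * h' z e = 0" if "z \<notin> K" for z using zero[OF that] by simp
    show "((\<lambda>z. h z * \<psi>1 z - \<psi> z * h' z e) has_derivative D z) (at z)" for z
    proof (cases "z \<in> K")
      case True
      then have "z \<in> \<Omega>" using K by auto
      have "((\<lambda>z. h z * \<psi>1 z - \<psi> z * h' z e) has_derivative 
         (\<lambda>w. h z * dir_deriv w \<psi>1 z + h' z w * \<psi>1 z - (\<psi> z * h'' z w + dir_deriv w \<psi> z * h' z e))) (at z)"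
        by (intro has_derivative_diff has_derivative_mult h h2 \<open>z \<in> \<Omega>\<close> smooth_in_has_derivative[OF s1] smooth_in_has_derivative[OF \<psi>])
      moreover have "D z = (\<lambda>w. h z * dir_deriv w \<psi>1 z + h' z w * \<psi>1 z - (\<psi> z * h'' z w + dir_deriv w \<psi> z * h' z e))"
        using True by (auto simp: D_def)
      ultimately show ?thesis by simp
    next
      case False
      then have "D z = (\<lambda>_. 0)" by (auto simp: D_def)
      moreover have "((\<lambda>z. h z * \<psi>1 z - \<psi> z * h' z e) has_derivative (\<lambda>_. 0)) (at z)"
        by (rule has_derivative_transform_within_open[of "\<lambda>_. 0" _ _ _ "- K"])
          (use False cK zero in auto)
      ultimately show ?thesis by simp
    qed
    show "continuous_on UNIV (\<lambda>z. D z e)" unfolding De by (intro continuous_intros c1 c2)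
  qed
  then show "(\<integral>z. h z * dir_deriv e (dir_deriv e \<psi>) z \<partial>lborel) = (\<integral>z. \<psi> z * h'' z e \<partial>lborel)"
    unfolding De using i1 i2 by (simp add: \<psi>2_def \<psi>1_def)
qed

section \<open>Logarithmic potentials\<close>

text \<open>If \<open>k\<close> is least with \<open>2\<^sup>-\<^sup>k \<le> x\<close>, then \<open>- ln x \<le> k * ln 2\<close> and exactly \<open>k\<close> terms on the right are
nonzero. The bound replaces polar coordinates in the integration of the logarithm.\<close>

lemma minus_ln_le_count:
  assumes "0 < x" 
  shows "ennreal (- ln x) \<le> (\<Sum>n. ennreal (ln 2) * indicator {x. x < (1/2) ^ n} x)"
proof (cases "x < 1")
  case False
  then have "ennreal (- ln x) = 0" using assms by (simp add: ennreal_neg)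
  then show ?thesis by simp
next
  case True
  obtain m where m: "(1/2) ^ m \<le> x"
    using real_arch_pow_inv[of x "1/2"] assms by (auto intro: less_imp_le)
  define k where "k = (LEAST m. (1/2) ^ m \<le> x)"
  have k: "(1/2) ^ k \<le> x" unfolding k_def by (rule LeastI[of _ m]) (rule m)
  have less: "x < (1/2) ^ n" if "n < k" for n
    using not_less_Least[of n "\<lambda>m. (1/2) ^ m \<le> x"] that unfolding k_def by auto
  have "ln ((1/2) ^ k) \<le> ln x" using k assms by simp
  then have "- ln x \<le> real k * ln 2" by (simp add: ln_realpow ln_div)
  then have "ennreal (- ln x) \<le> ennreal (real k * ln 2)" by (rule ennreal_leI)
  also have "\<dots> = (\<Sum>n<k. ennreal (ln 2) * indicator {x. x < (1/2) ^ n} x)"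
    using less by (simp add: ennreal_mult ennreal_of_nat_eq_real_of_nat)
  also have "\<dots> \<le> (\<Sum>n. ennreal (ln 2) * indicator {x. x < (1/2) ^ n} x)"
    by (intro sum_le_suminf) auto
  finally show ?thesis .
qed

text \<open>By the preceding bound the integral is at most \<open>ln 2\<close> times the sum of the areas \<open>\<pi> * 4\<^sup>-\<^sup>n\<close>.\<close>

lemma nn_integral_minus_ln_finite:
  "(\<integral>\<^sup>+z. ennreal (- ln (norm (z::complex))) \<partial>lborel) < \<infinity>"
proof -
  have "(\<integral>\<^sup>+z. ennreal (- ln (norm (z::complex))) \<partial>lborel) \<le>
     (\<integral>\<^sup>+z. (\<Sum>n. ennreal (ln 2) * indicator (ball 0 ((1/2) ^ n)) z) \<partial>(lborel :: complex measure))"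
  proof (rule nn_integral_mono)
    fix z :: complex
    show "ennreal (- ln (norm z)) \<le> (\<Sum>n. ennreal (ln 2) * indicator (ball 0 ((1/2) ^ n)) z)"
    proof (cases "z = 0")
      case False
      then show ?thesis using minus_ln_le_count[of "norm z"] by (simp add: indicator_def)
    qed simp
  qed
  also have "\<dots> = (\<Sum>n. \<integral>\<^sup>+z. ennreal (ln 2) * indicator (ball 0 ((1/2) ^ n)) z \<partial>(lborel :: complex measure))"
    by (rule nn_integral_suminf) (intro borel_measurable_times_ennreal borel_measurable_const borel_measurable_indicator, simp)
  also have "\<dots> = (\<Sum>n. ennreal (ln 2) * emeasure lborel (ball (0::complex) ((1/2) ^ n)))"
    by (intro suminf_cong nn_integral_cmult_indicator) simp
  also have "\<dots> = (\<Sum>n. ennreal (ln 2 * (pi * (1/4) ^ n)))"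
    by (intro suminf_cong) (simp add: emeasure_ball unit_ball_vol_2 ennreal_mult'[symmetric] power_mult_distrib[symmetric] power2_eq_square power_divide)
  also have "\<dots> = ennreal (\<Sum>n. ln 2 * (pi * (1/4) ^ n))"
    by (intro suminf_ennreal_eq sums_unique[symmetric] summable_sums[THEN sums_unique, THEN sym] summable_sums) (auto intro!: summable_mult summable_geometric)
  also have "\<dots> < \<infinity>" by simp
  finally show ?thesis .
qed

lemma integrable_ln_norm:
  fixes a :: complex
  assumes "bounded K" and [measurable]: "K \<in> sets borel"
  shows "integrable lborel (\<lambda>z. indicator K z * ln (norm (z - a)))"
proof -
  obtain R where R: "R > 0" "\<And>z. z \<in> K \<Longrightarrow> norm z \<le> R"
    using assms(1) unfolding bounded_pos by blast
  define C where "C = \<bar>ln (R + norm a)\<bar>"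
  have m: "(\<lambda>z::complex. ennreal (- ln (norm z))) \<in> borel_measurable borel" by measurable
  have "(\<integral>\<^sup>+z. ennreal (indicator K z * \<bar>ln (norm (z - a))\<bar>) \<partial>lborel)
     \<le> (\<integral>\<^sup>+z. ennreal (- ln (norm (- a + z))) + ennreal (C * indicator K z) \<partial>lborel)"
  proof (rule nn_integral_mono)
    fix z
    show "ennreal (indicator K z * \<bar>ln (norm (z - a))\<bar>) \<le> ennreal (- ln (norm (- a + z))) + ennreal (C * indicator K z)"
    proof (cases "z \<in> K \<and> z \<noteq> a")
      case True
      then have zK: "z \<in> K" and za: "0 < norm (z - a)" by auto
      have "norm (z - a) \<le> R + norm a" using R(2)[OF zK] norm_triangle_ineq4[of z a] by linarith
      then have "ln (norm (z - a)) \<le> ln (R + norm a)" using za by (subst ln_le_cancel_iff) linarith+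
      then have le: "ln (norm (z - a)) \<le> C" unfolding C_def by linarith
      have eq: "norm (- a + z) = norm (z - a)" by (simp add: add.commute)
      show ?thesis
      proof (cases "ln (norm (z - a)) \<ge> 0")
        case True
        then have "ennreal (indicator K z * \<bar>ln (norm (z - a))\<bar>) \<le> ennreal (C * indicator K z)"
          using le zK by (intro ennreal_leI) simp
        then show ?thesis by (simp add: add_increasing)
      next
        case False
        then have "ennreal (indicator K z * \<bar>ln (norm (z - a))\<bar>) = ennreal (- ln (norm (- a + z)))"
          using zK eq by simp
        then show ?thesis by (simp add: add_increasing2)
      qed
    next
      case False
      then show ?thesis by (auto simp: indicator_def)
    qed
  qed
  also have "\<dots> = (\<integral>\<^sup>+z. ennreal (- ln (norm (- a + z))) \<partial>lborel) + (\<integral>\<^sup>+z. ennreal (C * indicator K z) \<partial>lborel)"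
    by (rule nn_integral_add) auto
  also have "(\<integral>\<^sup>+z. ennreal (- ln (norm (- a + z))) \<partial>lborel) = (\<integral>\<^sup>+z. ennreal (- ln (norm (z::complex))) \<partial>lborel)"
    using nn_integral_lborel_translate[OF m, of "- a"] .
  also have "(\<integral>\<^sup>+z. ennreal (C * indicator K z) \<partial>lborel) = ennreal C * emeasure lborel K"
    by (subst nn_integral_cmult_indicator[symmetric]) (auto simp: C_def ennreal_mult' ennreal_indicator)
  also have "(\<integral>\<^sup>+z. ennreal (- ln (norm (z::complex))) \<partial>lborel) + ennreal C * emeasure lborel K < \<infinity>"
    using nn_integral_minus_ln_finite emeasure_bounded_finite[OF assms(1)] by (simp add: ennreal_mult_less_top)
  finally have fin: "(\<integral>\<^sup>+z. ennreal (indicator K z * \<bar>ln (norm (z - a))\<bar>) \<partial>lborel) < \<infinity>" .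
  have "integrable lborel (\<lambda>z. indicator K z * \<bar>ln (norm (z - a))\<bar>)"
    by (rule integrableI_nonneg) (use fin in \<open>auto intro!: AE_I2\<close>)
  then show ?thesis
    by (rule Bochner_Integration.integrable_bound) (auto simp: abs_mult)
qed

text \<open>The function \<open>ln (|z - a|\<^sup>2 + s\<^sup>2) / 2\<close> is a smooth approximation of \<open>ln |z - a|\<close> from above. Its Laplacian
\<open>2 s\<^sup>2 / (|z - a|\<^sup>2 + s\<^sup>2)\<^sup>2\<close> is positive and concentrates at \<open>a\<close> as \<open>s\<close> tends to \<open>0\<close>.\<close>

lemma integral_regularized_log_laplacian:
  assumes \<psi>: "smooth_in K \<psi>" and K: "compact K" and s: "s > 0"
  shows "(\<integral>z. ln ((norm (z - a))\<^sup>2 + s\<^sup>2) / 2 * laplacian \<psi> z \<partial>lborel)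
         = (\<integral>z. \<psi> z * (2 * s\<^sup>2 / ((norm (z - a))\<^sup>2 + s\<^sup>2)\<^sup>2) \<partial>lborel)"
    and "integrable lborel (\<lambda>z. ln ((norm (z - a))\<^sup>2 + s\<^sup>2) / 2 * laplacian \<psi> z)"
    and "integrable lborel (\<lambda>z. \<psi> z * (2 * s\<^sup>2 / ((norm (z - a))\<^sup>2 + s\<^sup>2)\<^sup>2))"
proof -
  define N where "N z = (norm (z - a))\<^sup>2 + s\<^sup>2" for z
  have Npos: "N z > 0" for z using s by (simp add: N_def add_nonneg_pos)
  have N: "(N has_derivative (\<lambda>w. 2 * ((z - a) \<bullet> w))) (at z)" for z
    unfolding N_def[abs_def] power2_norm_eq_inner
    by (auto intro!: derivative_eq_intros simp: inner_commute)
  define h where "h z = ln (N z) / 2" for z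
  define h' where "h' z w = ((z - a) \<bullet> w) / N z" for z w
  define h'' where "h'' e z w = (w \<bullet> e) / N z - ((z - a) \<bullet> e) * (2 * ((z - a) \<bullet> w)) / (N z)\<^sup>2" for e z w
  have h: "(h has_derivative h' z) (at z)" for z
    unfolding h_def[abs_def] h'_def[abs_def]
    using Npos[of z] by (auto intro!: derivative_eq_intros N simp: field_simps)
  have h2: "((\<lambda>z. h' z e) has_derivative h'' e z) (at z)" for z e
    unfolding h'_def h''_def[abs_def]
    using Npos[of z] by (auto intro!: derivative_eq_intros N ext simp: field_simps power2_eq_square)
  have cN: "continuous_on UNIV N" 
    using N has_derivative_continuous continuous_at_imp_continuous_on by blast
  have c: "continuous_on UNIV (\<lambda>z. h'' e z e)" for e
    unfolding h''_def using Npos by (intro continuous_intros cN) (auto simp: less_imp_neq[symmetric] dual_order.strict_implies_not_eq)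
  note ibp = integral_ibp_twice[OF \<psi> K subset_UNIV open_UNIV h h2 c]
  have sum: "h'' 1 z 1 + h'' \<i> z \<i> = 2 * s\<^sup>2 / (N z)\<^sup>2" for z
  proof -
    have "(norm (z - a))\<^sup>2 = ((z - a) \<bullet> 1)\<^sup>2 + ((z - a) \<bullet> \<i>)\<^sup>2"
      by (simp add: cmod_power2 inner_complex_def)
    then have "N z - ((z - a) \<bullet> 1)\<^sup>2 - ((z - a) \<bullet> \<i>)\<^sup>2 = s\<^sup>2" by (simp add: N_def)
    moreover have "h'' 1 z 1 + h'' \<i> z \<i> = 2 * (N z - ((z - a) \<bullet> 1)\<^sup>2 - ((z - a) \<bullet> \<i>)\<^sup>2) / (N z)\<^sup>2"
      using Npos[of z] by (simp add: h''_def field_simps power2_eq_square)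
    ultimately show ?thesis by simp
  qed
  have lap: "h z * laplacian \<psi> z = h z * dir_deriv 1 (dir_deriv 1 \<psi>) z + h z * dir_deriv \<i> (dir_deriv \<i> \<psi>) z" for z
    by (simp add: laplacian_dir_deriv algebra_simps)
  have L: "\<psi> z * (2 * s\<^sup>2 / (N z)\<^sup>2) = \<psi> z * h'' 1 z 1 + \<psi> z * h'' \<i> z \<i>" for z
    unfolding sum[symmetric] by (simp add: algebra_simps)
  have "integrable lborel (\<lambda>z. h z * laplacian \<psi> z)"
    unfolding lap by (intro Bochner_Integration.integrable_add ibp(1))
  then show "integrable lborel (\<lambda>z. ln ((norm (z - a))\<^sup>2 + s\<^sup>2) / 2 * laplacian \<psi> z)"
    by (simp add: h_def N_def)
  have "integrable lborel (\<lambda>z. \<psi> z * (2 * s\<^sup>2 / (N z)\<^sup>2))"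
    unfolding L by (intro Bochner_Integration.integrable_add ibp(2))
  then show "integrable lborel (\<lambda>z. \<psi> z * (2 * s\<^sup>2 / ((norm (z - a))\<^sup>2 + s\<^sup>2)\<^sup>2))"
    by (simp add: N_def)
  have "(\<integral>z. h z * laplacian \<psi> z \<partial>lborel) = (\<integral>z. \<psi> z * (2 * s\<^sup>2 / (N z)\<^sup>2) \<partial>lborel)"
    unfolding lap L by (simp add: ibp)
  then show "(\<integral>z. ln ((norm (z - a))\<^sup>2 + s\<^sup>2) / 2 * laplacian \<psi> z \<partial>lborel)
         = (\<integral>z. \<psi> z * (2 * s\<^sup>2 / ((norm (z - a))\<^sup>2 + s\<^sup>2)\<^sup>2) \<partial>lborel)"
    by (simp add: h_def N_def)
qed

text \<open>Local integrability of \<open>h\<close> suffices, as \<open>\<Delta>\<psi>\<close> is bounded and vanishes off \<open>K\<close>.\<close>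

lemma integrable_mult_laplacian:
  assumes \<psi>: "smooth_in K \<psi>" and K: "compact K" and h: "integrable lborel (\<lambda>z. indicator K z * h z)"
  shows "integrable lborel (\<lambda>z. h z * laplacian \<psi> z)"
proof -
  have cK: "closed K" using K compact_imp_closed by blast
  note L = smooth_in_laplacian[OF \<psi> cK]
  have [measurable]: "laplacian \<psi> \<in> borel_measurable borel" using L(1) by (rule borel_measurable_continuous_onI)
  obtain B where B: "\<And>z. \<bar>laplacian \<psi> z\<bar> \<le> B"
    using compact_support_bounded[OF L(1) K L(2)] by blast
  have eq: "(indicator K z * h z) * laplacian \<psi> z = h z * laplacian \<psi> z" for z
    using L(2)[of z] by (cases "z \<in> K") auto
  have i1: "integrable lborel (\<lambda>z. B * (indicator K z * h z))" by (intro integrable_mult_right h)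
  have "(\<lambda>z. indicator K z * h z) \<in> borel_measurable lborel" using h by auto
  then have "(\<lambda>z. (indicator K z * h z) * laplacian \<psi> z) \<in> borel_measurable lborel" by measurable
  then have i2: "(\<lambda>z. h z * laplacian \<psi> z) \<in> borel_measurable lborel" by (simp only: eq)
  have i3: "norm (h z * laplacian \<psi> z) \<le> norm (B * (indicator K z * h z))" for z
  proof (cases "z \<in> K")
    case True
    have "\<bar>laplacian \<psi> z\<bar> * \<bar>h z\<bar> \<le> \<bar>B\<bar> * \<bar>h z\<bar>" using B[of z] by (intro mult_right_mono) auto
    then show ?thesis using True by (simp add: abs_mult mult.commute)
  qed (use L(2) in simp)
  show ?thesis by (rule Bochner_Integration.integrable_bound[OF i1 i2 AE_I2[OF i3]])
qed

lemma integrable_ln_norm_laplacian: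
  assumes "smooth_in K \<psi>" "compact K"
  shows "integrable lborel (\<lambda>z. ln (norm (z - a)) * laplacian \<psi> z)"
  by (rule integrable_mult_laplacian[OF assms])
    (intro integrable_ln_norm compact_imp_bounded borel_compact assms)

text \<open>On the disc of radius \<open>s\<close> about \<open>a\<close> the Laplacian of the regularised logarithm is at least \<open>1 / (2 s\<^sup>2)\<close>,
and this disc has area \<open>\<pi> s\<^sup>2\<close>; this is the origin of the constant \<open>\<pi>/2\<close>. As \<open>\<psi> \<ge> 0\<close>, the rest of the
plane may be ignored. The true value of the integral is \<open>2\<pi> * \<psi> a\<close>, but any positive multiple of \<open>\<psi> a\<close>
serves to bound sums over zeros.\<close>

lemma log_potential_lower_bound:
  assumes \<psi>: "smooth_in K \<psi>" and K: "compact K" and pos: "\<And>z. \<psi> z \<ge> 0"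
  shows "pi / 2 * \<psi> a \<le> (\<integral>z. ln (norm (z - a)) * laplacian \<psi> z \<partial>lborel)"
proof -
  have cK: "closed K" using K compact_imp_closed by blast
  note lap = smooth_in_laplacian[OF \<psi> cK]
  have [measurable]: "laplacian \<psi> \<in> borel_measurable borel" using lap(1) by (rule borel_measurable_continuous_onI)
  have [measurable]: "\<psi> \<in> borel_measurable borel" using smooth_in_continuous[OF \<psi>] by (rule borel_measurable_continuous_onI)
  define s where "s n = inverse (real (Suc n))" for n
  have s: "0 < s n" "s n \<le> 1" for n unfolding s_def by (auto simp: field_simps)
  have s0: "s \<longlonglongrightarrow> 0" unfolding s_def by (rule LIMSEQ_inverse_real_of_nat)
  define h where "h n z = ln ((norm (z - a))\<^sup>2 + (s n)\<^sup>2) / 2" for n z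
  define k where "k n z = 2 * (s n)\<^sup>2 / ((norm (z - a))\<^sup>2 + (s n)\<^sup>2)\<^sup>2" for n z
  define J where "J n = (\<integral>z. h n z * laplacian \<psi> z \<partial>lborel)" for n
  have J: "J n = (\<integral>z. \<psi> z * k n z \<partial>lborel)" "integrable lborel (\<lambda>z. \<psi> z * k n z)" for n
    unfolding J_def h_def k_def
    using integral_regularized_log_laplacian[OF \<psi> K s(1)] by blast+
  (* h n z lies between ln |z - a| and ln (|z - a|^2 + 1) / 2, which gives a majorant *)
  define w where "w z = \<bar>ln (norm (z - a)) * laplacian \<psi> z\<bar> + \<bar>ln ((norm (z - a))\<^sup>2 + 1) / 2 * laplacian \<psi> z\<bar>" for z
  have "J \<longlonglongrightarrow> (\<integral>z. ln (norm (z - a)) * laplacian \<psi> z \<partial>lborel)"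
    unfolding J_def
  proof (rule integral_dominated_convergence[where w=w])
    show "integrable lborel w"
      using integral_regularized_log_laplacian(2)[OF \<psi> K, of 1 a] integrable_ln_norm_laplacian[OF \<psi> K]
      unfolding w_def by (intro Bochner_Integration.integrable_add integrable_abs) auto
    have "AE z in lborel. z \<noteq> a" by (rule AE_lborel_singleton)
    then show "AE z in lborel. (\<lambda>n. h n z * laplacian \<psi> z) \<longlonglongrightarrow> ln (norm (z - a)) * laplacian \<psi> z"
    proof eventually_elim
      fix z assume "z \<noteq> a"
      then have p: "norm (z - a) > 0" by simp
      have lim: "(\<lambda>n. (norm (z - a))\<^sup>2 + (s n)\<^sup>2) \<longlonglongrightarrow> (norm (z - a))\<^sup>2 + 0\<^sup>2"
        by (intro tendsto_intros s0)
      have "(\<lambda>n. h n z) \<longlonglongrightarrow> ln ((norm (z - a))\<^sup>2 + 0\<^sup>2) / 2"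
        unfolding h_def by (intro tendsto_divide tendsto_ln lim tendsto_const) (use p in auto)
      also have "ln ((norm (z - a))\<^sup>2 + 0\<^sup>2) / 2 = ln (norm (z - a))"
        using p by (simp add: ln_realpow)
      finally show "(\<lambda>n. h n z * laplacian \<psi> z) \<longlonglongrightarrow> ln (norm (z - a)) * laplacian \<psi> z"
        by (intro tendsto_intros)
    qed
    show "AE z in lborel. norm (h n z * laplacian \<psi> z) \<le> w z" for n
      using AE_lborel_singleton[of a]
    proof eventually_elim
      fix z assume "z \<noteq> a"
      then have p: "norm (z - a) > 0" by simp
      have sn: "0 \<le> (s n)\<^sup>2" "(s n)\<^sup>2 \<le> 1" using s[of n] by (auto simp: power_le_one)
      have "ln (norm (z - a)) = ln ((norm (z - a))\<^sup>2) / 2" using p by (simp add: ln_realpow)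
      also have "\<dots> \<le> h n z" unfolding h_def using p sn by (simp add: add_pos_nonneg)
      finally have 1: "ln (norm (z - a)) \<le> h n z" .
      have 2: "h n z \<le> ln ((norm (z - a))\<^sup>2 + 1) / 2" unfolding h_def using p sn by (simp add: add_pos_nonneg)
      from 1 2 have "\<bar>h n z\<bar> \<le> \<bar>ln (norm (z - a))\<bar> + \<bar>ln ((norm (z - a))\<^sup>2 + 1) / 2\<bar>" by linarith
      then have "\<bar>h n z\<bar> * \<bar>laplacian \<psi> z\<bar> \<le> (\<bar>ln (norm (z - a))\<bar> + \<bar>ln ((norm (z - a))\<^sup>2 + 1) / 2\<bar>) * \<bar>laplacian \<psi> z\<bar>"
        by (intro mult_right_mono) auto
      then show "norm (h n z * laplacian \<psi> z) \<le> w z" by (simp add: w_def abs_mult algebra_simps)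
    qed
  qed (auto simp: h_def)
  moreover have "\<forall>\<^sub>F n in sequentially. pi / 2 * (\<psi> a - \<eta>) \<le> J n" if "\<eta> > 0" for \<eta>
  proof -
    have "isCont \<psi> a" using smooth_in_continuous[OF \<psi>, of UNIV] by (simp add: continuous_on_eq_continuous_at)
    then have "\<exists>d>0. \<forall>z. dist z a < d \<longrightarrow> dist (\<psi> z) (\<psi> a) < \<eta>"
      using that by (simp add: continuous_at_eps_delta)
    then obtain d where d: "d > 0" "\<And>z. dist z a < d \<Longrightarrow> dist (\<psi> z) (\<psi> a) < \<eta>"
      by auto
    have "\<forall>\<^sub>F n in sequentially. s n < d" using order_tendstoD(2)[OF s0 d(1)] .
    then show ?thesis
    proof eventually_elim
      fix n assume n: "s n < d"
      define c where "c = (\<psi> a - \<eta>) / (2 * (s n)\<^sup>2)"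
      have "(\<integral>z. c * indicator (ball a (s n)) z \<partial>lborel) \<le> (\<integral>z. \<psi> z * k n z \<partial>lborel)"
      proof (rule integral_mono)
        show "integrable lborel (\<lambda>z. c * indicator (ball a (s n)) z)"
          using emeasure_lborel_ball_finite[of a "s n"] by (intro integrable_mult_right integrable_real_indicator) auto
        show "integrable lborel (\<lambda>z. \<psi> z * k n z)" by (rule J)
        fix z
        have kpos: "0 \<le> k n z" unfolding k_def by simp
        show "c * indicator (ball a (s n)) z \<le> \<psi> z * k n z"
        proof (cases "z \<in> ball a (s n)")
          case True
          then have "norm (z - a) < s n" by (simp add: dist_norm norm_minus_commute)
          then have "(norm (z - a))\<^sup>2 \<le> (s n)\<^sup>2" by (intro power_mono) auto
          then have "(norm (z - a))\<^sup>2 + (s n)\<^sup>2 \<le> 2 * (s n)\<^sup>2" by simp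
          then have "((norm (z - a))\<^sup>2 + (s n)\<^sup>2)\<^sup>2 \<le> (2 * (s n)\<^sup>2)\<^sup>2" by (intro power_mono) auto
          then have "2 * (s n)\<^sup>2 / (2 * (s n)\<^sup>2)\<^sup>2 \<le> k n z"
            unfolding k_def using s[of n] by (intro divide_left_mono mult_pos_pos) (auto simp: add_nonneg_pos)
          then have kl: "1 / (2 * (s n)\<^sup>2) \<le> k n z" using s(1)[of n] by (simp add: power2_eq_square)
          have "dist (\<psi> z) (\<psi> a) < \<eta>" using True n by (intro d) (auto simp: dist_commute)
          then have "\<psi> a - \<eta> \<le> \<psi> z" by (simp add: dist_real_def)
          then have "c \<le> \<psi> z * (1 / (2 * (s n)\<^sup>2))" unfolding c_def using s(1)[of n] by (simp add: divide_right_mono)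
          also have "\<dots> \<le> \<psi> z * k n z" using kl pos by (rule mult_left_mono)
          finally show ?thesis using True by simp
        next
          case False
          then show ?thesis using pos kpos by simp
        qed
      qed
      moreover have "(\<integral>z. c * indicator (ball a (s n)) z \<partial>lborel) = pi / 2 * (\<psi> a - \<eta>)"
        using s(1)[of n] by (simp add: content_ball unit_ball_vol_2 c_def power2_eq_square)
      ultimately show "pi / 2 * (\<psi> a - \<eta>) \<le> J n" by (simp add: J)
    qed
  qed
  ultimately have le: "pi / 2 * (\<psi> a - \<eta>) \<le> (\<integral>z. ln (norm (z - a)) * laplacian \<psi> z \<partial>lborel)" if "\<eta> > 0" for \<eta>
    using that by (intro tendsto_lowerbound) auto
  show ?thesis
  proof (rule field_le_epsilon)
    fix e :: real assume "e > 0"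
    then have "pi / 2 * (\<psi> a - e / (pi / 2)) \<le> (\<integral>z. ln (norm (z - a)) * laplacian \<psi> z \<partial>lborel)"
      by (intro le) simp
    moreover have "pi / 2 * (\<psi> a - e / (pi / 2)) = pi / 2 * \<psi> a - e" by (simp add: right_diff_distrib)
    ultimately show "pi / 2 * \<psi> a \<le> (\<integral>z. ln (norm (z - a)) * laplacian \<psi> z \<partial>lborel) + e"
      by linarith
  qed
qed

text \<open>The gradient of \<open>ln |G|\<close> is given by the logarithmic derivative: the derivative in direction \<open>w\<close> is
\<open>Re (G'/G * w)\<close>. Second derivatives in the directions \<open>1\<close> and \<open>\<i>\<close> cancel because \<open>\<i>\<^sup>2 = -1\<close>.\<close>

lemma integral_ln_nonvanishing_laplacian:
  assumes \<psi>: "smooth_in K \<psi>" and K: "compact K" "K \<subseteq> \<Omega>" and \<Omega>: "open \<Omega>"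
    and G: "G holomorphic_on \<Omega>" "\<And>z. z \<in> \<Omega> \<Longrightarrow> G z \<noteq> 0"
  shows "integrable lborel (\<lambda>z. ln (norm (G z)) * laplacian \<psi> z)"
    and "(\<integral>z. ln (norm (G z)) * laplacian \<psi> z \<partial>lborel) = 0"
proof -
  define q where "q z = deriv G z / G z" for z
  have q: "q holomorphic_on \<Omega>" unfolding q_def
    by (intro holomorphic_intros holomorphic_deriv G \<Omega>)
  define h where "h z = ln (norm (G z))" for z
  have h: "(h has_derivative (\<lambda>w. Re (q z * w))) (at z)" if "z \<in> \<Omega>" for z
  proof -
    have "(G has_derivative (\<lambda>w. deriv G z * w)) (at z)"
      using holomorphic_derivI[OF G(1) \<Omega> that] by (simp add: has_field_derivative_def)
    moreover have "(norm has_derivative (\<lambda>h. h \<bullet> sgn (G z))) (at (G z))"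
      using G(2)[OF that] by (rule has_derivative_norm)
    ultimately have "(norm \<circ> G has_derivative (\<lambda>h. h \<bullet> sgn (G z)) \<circ> (\<lambda>w. deriv G z * w)) (at z)"
      by (rule diff_chain_at)
    then have "((\<lambda>z. norm (G z)) has_derivative (\<lambda>w. (deriv G z * w) \<bullet> sgn (G z))) (at z)"
      by (simp add: o_def)
    moreover have "0 < norm (G z)" using G(2)[OF that] by simp
    ultimately have "(h has_derivative (\<lambda>w. ((deriv G z * w) \<bullet> sgn (G z)) * inverse (norm (G z)))) (at z)"
      unfolding h_def[abs_def] by (rule has_derivative_ln[rotated])
    moreover have "((deriv G z * w) \<bullet> sgn (G z)) * inverse (norm (G z)) = Re (q z * w)" for w
    proof -
      have "q z * w = (deriv G z * w) * cnj (G z) / (norm (G z))\<^sup>2"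
        using complex_div_cnj[of "deriv G z * w" "G z"] by (simp add: q_def)
      then have "Re (q z * w) = Re ((deriv G z * w) * cnj (G z)) / (norm (G z))\<^sup>2"
        by (metis Re_divide_of_real of_real_power)
      moreover have "(deriv G z * w) \<bullet> sgn (G z) = Re ((deriv G z * w) * cnj (G z)) / norm (G z)"
        by (simp add: sgn_div_norm inner_complex_def divide_inverse algebra_simps)
      ultimately show ?thesis by (simp add: power2_eq_square divide_inverse)
    qed
    ultimately show ?thesis by simp
  qed
  have h2: "((\<lambda>z. Re (q z * e)) has_derivative (\<lambda>w. Re (deriv q z * w * e))) (at z)" if "z \<in> \<Omega>" for z e
  proof (rule has_derivative_Re)
    have "(q has_derivative (\<lambda>w. deriv q z * w)) (at z)"
      using holomorphic_derivI[OF q \<Omega> that] by (simp add: has_field_derivative_def)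
    then show "((\<lambda>z. q z * e) has_derivative (\<lambda>w. deriv q z * w * e)) (at z)"
      by (rule has_derivative_mult_left)
  qed
  have c: "continuous_on \<Omega> (\<lambda>z. Re (deriv q z * e * e))" for e
    by (intro continuous_intros holomorphic_on_imp_continuous_on holomorphic_deriv q \<Omega>)
  note ibp_e = integral_ibp_twice[OF \<psi> K \<Omega>, where h=h and h'="\<lambda>z w. Re (q z * w)"]
  have ibp: "integrable lborel (\<lambda>z. h z * dir_deriv e (dir_deriv e \<psi>) z)"
    "integrable lborel (\<lambda>z. \<psi> z * Re (deriv q z * e * e))"
    "(\<integral>z. h z * dir_deriv e (dir_deriv e \<psi>) z \<partial>lborel) = (\<integral>z. \<psi> z * Re (deriv q z * e * e) \<partial>lborel)" for e
    using ibp_e[where e=e and h''="\<lambda>z w. Re (deriv q z * w * e)"] h h2 c by blast+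
  have lap: "h z * laplacian \<psi> z = h z * dir_deriv 1 (dir_deriv 1 \<psi>) z + h z * dir_deriv \<i> (dir_deriv \<i> \<psi>) z" for z
    by (simp add: laplacian_dir_deriv algebra_simps)
  have "integrable lborel (\<lambda>z. h z * laplacian \<psi> z)"
    unfolding lap by (intro Bochner_Integration.integrable_add ibp(1))
  then show "integrable lborel (\<lambda>z. ln (norm (G z)) * laplacian \<psi> z)" by (simp add: h_def)
  have "(\<integral>z. h z * laplacian \<psi> z \<partial>lborel) = (\<integral>z. \<psi> z * Re (deriv q z * 1 * 1) + \<psi> z * Re (deriv q z * \<i> * \<i>) \<partial>lborel)"
    unfolding lap Bochner_Integration.integral_add[OF ibp(1) ibp(1)] Bochner_Integration.integral_add[OF ibp(2) ibp(2)] ibp(3) ..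
  also have "\<dots> = 0" by (simp add: mult.assoc)
  finally show "(\<integral>z. ln (norm (G z)) * laplacian \<psi> z \<partial>lborel) = 0" by (simp add: h_def)
qed

text \<open>Zeros are divided out one at a time. Orders at the remaining points are unaffected, since the factors
divided out so far do not vanish there.\<close>

lemma holomorphic_divide_out_zeros:
  assumes \<Omega>: "open \<Omega>" and F: "F holomorphic_on \<Omega>"
    and nz: "\<And>a. a \<in> A \<Longrightarrow> eventually (\<lambda>z. F z \<noteq> 0) (at a)" and A: "finite A" "A \<subseteq> \<Omega>"
  shows "\<exists>G. G holomorphic_on \<Omega> \<and> (\<forall>a\<in>A. G a \<noteq> 0) \<and>
            (\<forall>z\<in>\<Omega>. F z = G z * (\<Prod>a\<in>A. (z - a) ^ nat (zorder F a)))"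
  using A nz
proof (induction A rule: finite_induct)
  case empty
  then show ?case using F by auto
next
  case (insert b A)
  then obtain G where G: "G holomorphic_on \<Omega>" "\<forall>a\<in>A. G a \<noteq> 0"
    "\<And>z. z \<in> \<Omega> \<Longrightarrow> F z = G z * (\<Prod>a\<in>A. (z - a) ^ nat (zorder F a))" by auto
  define P where "P z = (\<Prod>a\<in>A. (z - a) ^ nat (zorder F a))" for z
  have b: "b \<in> \<Omega>" using insert by auto
  have Pb: "P b \<noteq> 0" unfolding P_def using insert.hyps by auto
  have Phol: "P holomorphic_on S" for S unfolding P_def by (intro holomorphic_intros)
  have Pan: "P analytic_on {b}" using Phol[of UNIV] analytic_at by blast
  have Gan: "G analytic_on {b}" using G(1) \<Omega> b analytic_at by blast
  have evO: "eventually (\<lambda>z. z \<in> \<Omega>) (nhds b)" using \<Omega> b by (rule eventually_nhds_in_open)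
  have ev: "eventually (\<lambda>z. F z = G z * P z) (nhds b)"
    using evO by eventually_elim (use G(3) in \<open>simp add: P_def\<close>)
  have "eventually (\<lambda>z. F z = G z * P z) (at b)"
    using ev by (auto simp: eventually_at_filter elim: eventually_mono)
  moreover have "eventually (\<lambda>z. F z \<noteq> 0) (at b)" using insert.prems(2)[of b] by simp
  ultimately have evat: "eventually (\<lambda>z. G z * P z \<noteq> 0) (at b)"
    by eventually_elim simp
  have zo: "zorder F b = zorder G b"
  proof -
    have "zorder F b = zorder (\<lambda>z. G z * P z) b"
      using ev by (intro zorder_cong) (auto simp: eventually_at_filter elim: eventually_mono)
    also have "\<dots> = zorder G b + zorder P b" by (rule zorder_times_analytic[OF Gan Pan evat])
    also have "zorder P b = 0" by (rule zorder_eq_0I[OF Pan Pb])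
    finally show ?thesis by simp
  qed
  obtain r0 where r0: "r0 > 0" "ball b r0 \<subseteq> \<Omega>" using \<Omega> b openE by blast
  have "\<exists>w\<in>ball b r0. G w \<noteq> 0"
  proof -
    have "eventually (\<lambda>z. z \<in> ball b r0) (at b)" using r0 by (intro eventually_at_in_open') auto
    with evat have "eventually (\<lambda>z. z \<in> ball b r0 \<and> G z \<noteq> 0) (at b)" by eventually_elim auto
    from eventually_happens'[OF at_neq_bot this] show ?thesis by blast
  qed
  have "b \<in> ball b r0" using r0(1) by simp
  from zorder_exist_zero[OF holomorphic_on_subset[OF G(1) r0(2)] open_ball connected_ball this \<open>\<exists>w\<in>ball b r0. G w \<noteq> 0\<close>]
  obtain r where r: "r > 0" "cball b r \<subseteq> ball b r0" "zor_poly G b holomorphic_on cball b r"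
    "\<And>w. w \<in> cball b r \<Longrightarrow> G w = zor_poly G b w * (w - b) ^ nat (zorder G b) \<and> zor_poly G b w \<noteq> 0"
    by blast
  define m where "m = nat (zorder G b)"
  define H where "H z = (if z \<in> ball b r then zor_poly G b z else G z / (z - b) ^ m)" for z
  have Heq: "G z = H z * (z - b) ^ m" if "z \<in> \<Omega>" for z
    using r(1) r(4)[of z] by (auto simp: H_def m_def)
  have "H holomorphic_on (\<Omega> - {b}) \<union> ball b r"
  proof (rule holomorphic_on_Un)
    have "(\<lambda>z. G z / (z - b) ^ m) holomorphic_on (\<Omega> - {b})"
      by (intro holomorphic_intros holomorphic_on_subset[OF G(1)]) auto
    then show "H holomorphic_on \<Omega> - {b}"
      by (rule holomorphic_transform) (use r(4) in \<open>auto simp: H_def m_def\<close>)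
    have "zor_poly G b holomorphic_on ball b r" using r(3) holomorphic_on_subset ball_subset_cball by blast
    then show "H holomorphic_on ball b r"
      by (rule holomorphic_transform) (auto simp: H_def)
  qed (use \<Omega> in auto)
  then have Hhol: "H holomorphic_on \<Omega>" by (rule holomorphic_on_subset) (use r(1) in auto)
  have "H a \<noteq> 0" if "a \<in> insert b A" for a
  proof (cases "a = b")
    case True
    then show ?thesis using r(1) r(4)[of b] by (simp add: H_def)
  next
    case False
    then have "a \<in> A" "a \<in> \<Omega>" using that insert.prems by auto
    with Heq[of a] G(2) show ?thesis by auto
  qed
  moreover have "F z = H z * (\<Prod>a\<in>insert b A. (z - a) ^ nat (zorder F a))" if "z \<in> \<Omega>" for z
    using G(3)[OF that] Heq[OF that] insert.hyps zo by (simp add: m_def mult.assoc)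
  ultimately show ?case using Hhol by blast
qed

text \<open>Near \<open>K\<close> the function \<open>ln |F|\<close> is the sum of a harmonic function and of finitely many logarithmic
potentials.\<close>

lemma ln_norm_factorization:
  assumes \<Omega>: "open \<Omega>" and K: "K \<subseteq> \<Omega>"
    and F: "F holomorphic_on \<Omega>" and nz: "\<And>a. a \<in> \<Omega> \<Longrightarrow> eventually (\<lambda>z. F z \<noteq> 0) (at a)"
    and fin: "finite {z\<in>K. F z = 0}"
  obtains G \<Omega>' where "open \<Omega>'" "K \<subseteq> \<Omega>'" "G holomorphic_on \<Omega>'" "\<And>z. z \<in> \<Omega>' \<Longrightarrow> G z \<noteq> 0"
    "\<And>z. z \<in> K \<Longrightarrow> F z \<noteq> 0 \<Longrightarrow>
       ln (norm (F z)) = ln (norm (G z)) + (\<Sum>a\<in>{z\<in>K. F z = 0}. real (nat (zorder F a)) * ln (norm (z - a)))"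
proof -
  define A where "A = {z\<in>K. F z = 0}"
  have A: "finite A" "A \<subseteq> \<Omega>" using fin K by (auto simp: A_def)
  define n where "n a = nat (zorder F a)" for a
  obtain G where G: "G holomorphic_on \<Omega>" "\<forall>a\<in>A. G a \<noteq> 0"
      "\<And>z. z \<in> \<Omega> \<Longrightarrow> F z = G z * (\<Prod>a\<in>A. (z - a) ^ n a)"
    using holomorphic_divide_out_zeros[OF \<Omega> F nz A] A unfolding n_def by blast
  define \<Omega>' where "\<Omega>' = {z\<in>\<Omega>. G z \<noteq> 0}"
  have GK: "z \<in> \<Omega>'" if "z \<in> K" for z
    using that K G(2) G(3)[of z] by (cases "F z = 0") (auto simp: A_def \<Omega>'_def)
  have ln_eq: "ln (norm (F z)) = ln (norm (G z)) + (\<Sum>a\<in>{z\<in>K. F z = 0}. real (nat (zorder F a)) * ln (norm (z - a)))"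
    if z: "z \<in> K" "F z \<noteq> 0" for z
  proof -
    have zA: "z \<notin> A" "z \<in> \<Omega>" "G z \<noteq> 0" using z K GK by (auto simp: A_def \<Omega>'_def)
    have "ln (norm (F z)) = ln (norm (G z)) + ln (\<Prod>a\<in>A. norm (z - a) ^ n a)"
      unfolding G(3)[OF zA(2)] norm_mult prod_norm[symmetric] norm_power
      using zA A by (intro ln_mult_pos) (auto intro!: prod_pos zero_less_power)
    also have "ln (\<Prod>a\<in>A. norm (z - a) ^ n a) = (\<Sum>a\<in>A. ln (norm (z - a) ^ n a))"
      using zA A by (intro ln_prod) auto
    also have "\<dots> = (\<Sum>a\<in>A. real (n a) * ln (norm (z - a)))"
      using zA by (intro sum.cong) (auto intro!: ln_realpow)
    finally show ?thesis by (simp add: A_def n_def)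
  qed
  have "\<Omega>' = \<Omega> \<inter> G -` (- {0})" by (auto simp: \<Omega>'_def)
  then have "open \<Omega>'"
    using continuous_open_preimage[OF holomorphic_on_imp_continuous_on[OF G(1)] \<Omega> open_Compl[OF closed_singleton]] by simp
  moreover have "G holomorphic_on \<Omega>'" by (rule holomorphic_on_subset[OF G(1)]) (auto simp: \<Omega>'_def)
  moreover have "K \<subseteq> \<Omega>'" using GK by blast
  moreover have "G z \<noteq> 0" if "z \<in> \<Omega>'" for z using that by (simp add: \<Omega>'_def)
  ultimately show ?thesis using ln_eq by (intro that[of \<Omega>' G])
qed

lemma integrable_ln_holomorphic:
  assumes \<Omega>: "open \<Omega>" and K: "compact K" "K \<subseteq> \<Omega>"
    and F: "F holomorphic_on \<Omega>" and nz: "\<And>a. a \<in> \<Omega> \<Longrightarrow> eventually (\<lambda>z. F z \<noteq> 0) (at a)"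
    and fin: "finite {z\<in>K. F z = 0}"
  shows "integrable lborel (\<lambda>z. indicator K z * ln (norm (F z)))"
proof -
  obtain G \<Omega>' where G: "open \<Omega>'" "K \<subseteq> \<Omega>'" "G holomorphic_on \<Omega>'" "\<And>z. z \<in> \<Omega>' \<Longrightarrow> G z \<noteq> 0"
    "\<And>z. z \<in> K \<Longrightarrow> F z \<noteq> 0 \<Longrightarrow>
       ln (norm (F z)) = ln (norm (G z)) + (\<Sum>a\<in>{z\<in>K. F z = 0}. real (nat (zorder F a)) * ln (norm (z - a)))"
    by (rule ln_norm_factorization[OF \<Omega> K(2) F nz fin], assumption, rule that)
  have [measurable]: "K \<in> sets borel" using K(1) by (rule borel_compact)
  have contG: "continuous_on K (\<lambda>z. ln (norm (G z)))"
    using G(2,4) by (intro continuous_intros holomorphic_on_imp_continuous_on holomorphic_on_subset[OF G(3)]) auto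
  have iG: "integrable lborel (\<lambda>z. indicator K z * ln (norm (G z)))"
    using borel_integrable_compact[OF K(1) contG] by simp
  define S where "S z = indicator K z * ln (norm (G z)) + (\<Sum>a\<in>{z\<in>K. F z = 0}. real (nat (zorder F a)) * (indicator K z * ln (norm (z - a))))" for z
  have iS: "integrable lborel S"
    unfolding S_def by (intro Bochner_Integration.integrable_add iG Bochner_Integration.integrable_sum integrable_mult_right
      integrable_ln_norm compact_imp_bounded[OF K(1)]) measurable
  have AE: "AE z in lborel. S z = indicator K z * ln (norm (F z))"
    using AE_not_in[OF finite_imp_null_set_lborel[OF fin]]
    by eventually_elim (auto simp: S_def G(5) indicator_def)
  have "(\<lambda>z. if z \<in> \<Omega> then F z else 0) \<in> borel_measurable borel"
    by (rule borel_measurable_continuous_on_if) (use \<Omega> F in \<open>auto intro: holomorphic_on_imp_continuous_on\<close>)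
  then have "(\<lambda>z. indicator K z * ln (norm (if z \<in> \<Omega> then F z else 0))) \<in> borel_measurable lborel"
    by measurable
  moreover have "indicator K z * ln (norm (if z \<in> \<Omega> then F z else 0)) = indicator K z * ln (norm (F z))" for z
    using K by (cases "z \<in> K") auto
  ultimately have "(\<lambda>z. indicator K z * ln (norm (F z))) \<in> borel_measurable lborel" by simp
  with AE iS show ?thesis
    using integrable_cong_AE[of S lborel "\<lambda>z. indicator K z * ln (norm (F z))"] by simp
qed

text \<open>The mass inequality \<open>c * \<Sum> \<psi> a \<le> \<integral> ln |F| \<Delta>\<psi>\<close>: in the decomposition of \<open>ln |F|\<close> the harmonic part
contributes nothing and each logarithm is bounded from below.\<close>

lemma zeros_le_log_laplacian:
  assumes \<psi>: "smooth_in K \<psi>" and pos: "\<And>z. \<psi> z \<ge> 0" and K: "compact K" "K \<subseteq> \<Omega>" and \<Omega>: "open \<Omega>"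
    and F: "F holomorphic_on \<Omega>" and nz: "\<And>a. a \<in> \<Omega> \<Longrightarrow> eventually (\<lambda>z. F z \<noteq> 0) (at a)"
    and fin: "finite {z\<in>K. F z = 0}"
  shows "pi / 2 * (\<Sum>a\<in>{z\<in>K. F z = 0}. of_int (zorder F a) * \<psi> a) \<le> (\<integral>z. ln (norm (F z)) * laplacian \<psi> z \<partial>lborel)"
proof -
  define A where "A = {z\<in>K. F z = 0}"
  define n where "n a = nat (zorder F a)" for a
  have A: "finite A" "A \<subseteq> \<Omega>" using fin K by (auto simp: A_def)
  note lap0 = smooth_in_laplacian(2)[OF \<psi> compact_imp_closed[OF K(1)]]
  obtain G \<Omega>' where G: "open \<Omega>'" "K \<subseteq> \<Omega>'" "G holomorphic_on \<Omega>'" "\<And>z. z \<in> \<Omega>' \<Longrightarrow> G z \<noteq> 0"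
    "\<And>z. z \<in> K \<Longrightarrow> F z \<noteq> 0 \<Longrightarrow>
       ln (norm (F z)) = ln (norm (G z)) + (\<Sum>a\<in>{z\<in>K. F z = 0}. real (nat (zorder F a)) * ln (norm (z - a)))"
    by (rule ln_norm_factorization[OF \<Omega> K(2) F nz fin], assumption, rule that)
  note lnG = integral_ln_nonvanishing_laplacian[OF \<psi> K(1) G(2,1,3,4)]
  have n: "of_int (zorder F a) = real (n a)" if "a \<in> A" for a
  proof -
    have a: "a \<in> \<Omega>" using that A by auto
    then have "F analytic_on {a}" using F \<Omega> analytic_at by blast
    moreover have "frequently (\<lambda>z. F z \<noteq> 0) (at a)" using nz[OF a] by (simp add: eventually_frequently)
    ultimately have "zorder F a \<ge> 0" by (rule zorder_ge_0)
    then show ?thesis by (simp add: n_def)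
  qed
  define S where "S z = (\<Sum>a\<in>A. real (n a) * (ln (norm (z - a)) * laplacian \<psi> z))" for z
  have i: "integrable lborel (\<lambda>z. real (n a) * (ln (norm (z - a)) * laplacian \<psi> z))" for a
    by (intro integrable_mult_right integrable_ln_norm_laplacian[OF \<psi> K(1)])
  have iS: "integrable lborel S" unfolding S_def by (intro Bochner_Integration.integrable_sum i)
  have iF: "integrable lborel (\<lambda>z. ln (norm (F z)) * laplacian \<psi> z)"
    by (intro integrable_mult_laplacian[OF \<psi> K(1)] integrable_ln_holomorphic[OF \<Omega> K F nz fin])
  have "pi / 2 * (\<Sum>a\<in>A. of_int (zorder F a) * \<psi> a) = (\<Sum>a\<in>A. real (n a) * (pi / 2 * \<psi> a))"
    unfolding sum_distrib_left by (intro sum.cong) (auto simp: n)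
  also have "\<dots> \<le> (\<Sum>a\<in>A. real (n a) * (\<integral>z. ln (norm (z - a)) * laplacian \<psi> z \<partial>lborel))"
    by (intro sum_mono mult_left_mono log_potential_lower_bound[OF \<psi> K(1) pos]) auto
  also have "\<dots> = (\<Sum>a\<in>A. \<integral>z. real (n a) * (ln (norm (z - a)) * laplacian \<psi> z) \<partial>lborel)" by simp
  also have "\<dots> = (\<integral>z. S z \<partial>lborel)"
    unfolding S_def by (intro Bochner_Integration.integral_sum[symmetric] i)
  also have "\<dots> = (\<integral>z. ln (norm (G z)) * laplacian \<psi> z + S z \<partial>lborel)"
    by (simp only: Bochner_Integration.integral_add[OF lnG(1) iS] lnG(2) add_0_left)
  also have "\<dots> = (\<integral>z. ln (norm (F z)) * laplacian \<psi> z \<partial>lborel)"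
  proof (rule integral_cong_AE)
    show "AE z in lborel. ln (norm (G z)) * laplacian \<psi> z + S z = ln (norm (F z)) * laplacian \<psi> z"
      using AE_not_in[OF finite_imp_null_set_lborel[OF A(1)]]
    proof eventually_elim
      fix z assume z: "z \<notin> A"
      show "ln (norm (G z)) * laplacian \<psi> z + S z = ln (norm (F z)) * laplacian \<psi> z"
      proof (cases "z \<in> K")
        case True
        then have "F z \<noteq> 0" using z by (simp add: A_def)
        from G(5)[OF True this] show ?thesis
          by (simp add: S_def A_def n_def distrib_right sum_distrib_right mult.assoc)
      qed (simp add: S_def lap0)
    qed
  qed (use iF borel_measurable_integrable[OF Bochner_Integration.integrable_add[OF lnG(1) iS]] in auto)
  finally show ?thesis unfolding A_def .
qed

section \<open>Circular means\<close>

definition circ_avg :: "(complex \<Rightarrow> real) \<Rightarrow> complex \<Rightarrow> real \<Rightarrow> real" where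
  "circ_avg u c r = (\<integral>t. u (c + of_real r * cis t) * indicator {0..2*pi} t \<partial>lborel) / (2*pi)"

lemma measurable_cis [measurable]: "cis \<in> borel_measurable borel"
  by (intro borel_measurable_continuous_onI continuous_intros)

lemma integrable_bounded_interval:
  fixes f :: "real \<Rightarrow> real"
  assumes [measurable]: "f \<in> borel_measurable borel" and "\<And>t. \<bar>f t\<bar> \<le> B"
  shows "integrable lborel (\<lambda>t. f t * indicator {a..b} t)"
proof (rule Bochner_Integration.integrable_bound)
  show "integrable lborel (\<lambda>t::real. B * indicator {a..b} t)"
    by (intro integrable_mult_right integrable_real_indicator) (auto simp: emeasure_lborel_Icc_eq)
  show "AE t in lborel. norm (f t * indicator {a..b} t) \<le> norm (B * indicator {a..b} t)"
    using assms(2) by (intro AE_I2) (auto simp: indicator_def intro: order_trans[OF _ abs_ge_self])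
qed simp

text \<open>The part of the shifted interval beyond \<open>2\<pi>\<close> is moved back by one period.\<close>

lemma integral_periodic_shift:
  fixes f :: "real \<Rightarrow> real"
  assumes [measurable]: "f \<in> borel_measurable borel" and B: "\<And>t. \<bar>f t\<bar> \<le> B" and per: "\<And>t. f (t + 2*pi) = f t"
    and a: "0 \<le> a" "a \<le> 2*pi"
  shows "(\<integral>t. f (a + t) * indicator {0..2*pi} t \<partial>lborel) = (\<integral>t. f t * indicator {0..2*pi} t \<partial>lborel)"
proof -
  have tr: "(\<integral>t. g (c + t) \<partial>lborel) = (\<integral>t. g t \<partial>lborel)" if [measurable]: "g \<in> borel_measurable borel" for g :: "real \<Rightarrow> real" and c
    by (subst (2) lborel_distr_plus[of c, symmetric]) (simp add: integral_distr)
  have int: "integrable lborel (\<lambda>t. f t * indicator {b..c} t)" for b c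
    by (rule integrable_bounded_interval[OF assms(1) B])
  have split: "(\<integral>t. f t * indicator {b..d} t \<partial>lborel) = (\<integral>t. f t * indicator {b..c} t \<partial>lborel) + (\<integral>t. f t * indicator {c..d} t \<partial>lborel)"
    if "b \<le> c" "c \<le> d" for b c d
  proof -
    have "(\<integral>t. f t * indicator {b..d} t \<partial>lborel) = (\<integral>t. f t * indicator {b..c} t + f t * indicator {c..d} t \<partial>lborel)"
    proof (rule integral_cong_AE)
      have "AE t in lborel. t \<noteq> c" by (rule AE_lborel_singleton)
      then show "AE t in lborel. f t * indicator {b..d} t = f t * indicator {b..c} t + f t * indicator {c..d} t"
        by eventually_elim (use that in \<open>auto simp: indicator_def\<close>)
    qed auto
    then show ?thesis using int by simp
  qed
  have "(\<integral>t. f (a + t) * indicator {0..2*pi} t \<partial>lborel) = (\<integral>t. f (a + t) * indicator {a..a + 2*pi} (a + t) \<partial>lborel)"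
    by (intro Bochner_Integration.integral_cong) (auto simp: indicator_def)
  also have "\<dots> = (\<integral>t. f t * indicator {a..a + 2*pi} t \<partial>lborel)"
    by (rule tr[of "\<lambda>t. f t * indicator {a..a + 2*pi} t"]) simp
  also have "\<dots> = (\<integral>t. f t * indicator {a..2*pi} t \<partial>lborel) + (\<integral>t. f t * indicator {2*pi..a + 2*pi} t \<partial>lborel)"
    by (rule split) (use a in auto)
  also have "(\<integral>t. f t * indicator {2*pi..a + 2*pi} t \<partial>lborel) = (\<integral>t. f (2*pi + t) * indicator {2*pi..a + 2*pi} (2*pi + t) \<partial>lborel)"
    by (rule tr[symmetric, of "\<lambda>t. f t * indicator {2*pi..a + 2*pi} t"]) simp
  also have "\<dots> = (\<integral>t. f t * indicator {0..a} t \<partial>lborel)"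
    by (intro Bochner_Integration.integral_cong) (auto simp: indicator_def per add.commute)
  also have "(\<integral>t. f t * indicator {a..2*pi} t \<partial>lborel) + \<dots> = (\<integral>t. f t * indicator {0..2*pi} t \<partial>lborel)"
    using split[of 0 a "2*pi"] a by simp
  finally show ?thesis .
qed

text \<open>Averaging over all rotations of \<open>w\<close> gives the mean over the circle of radius \<open>|w|\<close>, whatever the argument of
\<open>w\<close>. This turns averages over rotations, which come from rotation invariance of Lebesgue measure, into the
circular means of the definition of subharmonicity.\<close>

lemma circ_avg_cmod:
  assumes [measurable]: "u \<in> borel_measurable borel" and B: "\<And>z. \<bar>u z\<bar> \<le> B"
  shows "(\<integral>t. u (z + cis t * w) * indicator {0..2*pi} t \<partial>lborel) / (2*pi) = circ_avg u z (norm w)"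
proof -
  obtain a where a: "0 \<le> a" "a < 2*pi" "w = of_real (norm w) * cis a"
    using Arg2pi[of w] unfolding is_Arg_def cis_conv_exp by blast
  have "cis t * w = of_real (norm w) * cis (a + t)" for t
    by (subst a(3)) (simp add: cis_mult[symmetric] mult_ac)
  then have "(\<integral>t. u (z + cis t * w) * indicator {0..2*pi} t \<partial>lborel) = (\<integral>t. u (z + of_real (norm w) * cis (a + t)) * indicator {0..2*pi} t \<partial>lborel)"
    by simp
  also have "\<dots> = (\<integral>t. u (z + of_real (norm w) * cis t) * indicator {0..2*pi} t \<partial>lborel)"
    by (rule integral_periodic_shift[where f="\<lambda>t. u (z + of_real (norm w) * cis t)" and B=B])
      (use a B in \<open>auto simp: cis_mult[symmetric]\<close>)
  finally show ?thesis by (simp add: circ_avg_def)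
qed

section \<open>Convolution with a smooth kernel\<close>

definition conv :: "(complex \<Rightarrow> real) \<Rightarrow> (complex \<Rightarrow> real) \<Rightarrow> complex \<Rightarrow> real" where
  "conv W \<theta> z = (\<integral>w. W w * \<theta> (z - w) \<partial>lborel)"

lemma uniformly_continuous_compact_support:
  fixes g :: "complex \<Rightarrow> real"
  assumes c: "continuous_on UNIV g" and g0: "\<And>z. z \<notin> cball 0 \<delta> \<Longrightarrow> g z = 0" and e: "e > 0"
  shows "\<exists>d>0. \<forall>x y. dist x y < d \<longrightarrow> \<bar>g x - g y\<bar> < e"
proof -
  have "uniformly_continuous_on (cball 0 (\<delta> + 1)) g"
    by (rule compact_uniformly_continuous) (use c continuous_on_subset in auto)
  then obtain d where d: "d > 0" "\<And>x y. x \<in> cball 0 (\<delta> + 1) \<Longrightarrow> y \<in> cball 0 (\<delta> + 1) \<Longrightarrow> dist x y < d \<Longrightarrow> dist (g x) (g y) < e"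
    using e unfolding uniformly_continuous_on_def by (metis dist_commute)
  have "\<bar>g x - g y\<bar> < e" if xy: "dist x y < min d 1" for x y
  proof (cases "x \<in> cball 0 (\<delta> + 1) \<and> y \<in> cball 0 (\<delta> + 1)")
    case True
    then show ?thesis using d(2)[of x y] xy by (simp add: dist_real_def)
  next
    case False
    have "\<bar>norm x - norm y\<bar> < 1" using xy norm_triangle_ineq3[of x y] by (simp add: dist_norm)
    then have "\<not> norm x \<le> \<delta>" "\<not> norm y \<le> \<delta>" using False by auto
    then show ?thesis using g0 e by simp
  qed
  with d(1) show ?thesis by (intro exI[of _ "min d 1"]) auto
qed

lemma dir_deriv_Re_Im:
  assumes "smooth_in K \<psi>"
  shows "dir_deriv h \<psi> z = Re h * dir_deriv 1 \<psi> z + Im h * dir_deriv \<i> \<psi> z"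
  using derivative_along_Re_Im[OF smooth_in_has_derivative[OF assms], of h z] .

text \<open>Uniformity in \<open>y\<close> lets the linearisation be integrated against a merely bounded function, so that
convolutions can be differentiated under the integral sign.\<close>

lemma smooth_in_uniform_linearization:
  assumes \<theta>: "smooth_in (cball 0 \<delta>) \<theta>" and e: "e > 0"
  shows "\<exists>d>0. \<forall>y h. norm h < d \<longrightarrow> \<bar>\<theta> (y + h) - \<theta> y - dir_deriv h \<theta> y\<bar> \<le> e * norm h"
proof -
  have sm: "smooth_in (cball 0 \<delta>) (dir_deriv v \<theta>)" for v using \<theta> by (intro smooth_in_dir_deriv) auto
  have uc: "\<exists>d>0. \<forall>x y. dist x y < d \<longrightarrow> \<bar>dir_deriv v \<theta> x - dir_deriv v \<theta> y\<bar> < e / 2" for v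
    by (rule uniformly_continuous_compact_support[where \<delta>=\<delta>])
      (use smooth_in_continuous[OF sm[of v]] smooth_in_zero[OF sm[of v]] e in auto)
  obtain d1 where d1: "d1 > 0" "\<And>x y. dist x y < d1 \<Longrightarrow> \<bar>dir_deriv 1 \<theta> x - dir_deriv 1 \<theta> y\<bar> < e / 2"
    using uc[of 1] by blast
  obtain d2 where d2: "d2 > 0" "\<And>x y. dist x y < d2 \<Longrightarrow> \<bar>dir_deriv \<i> \<theta> x - dir_deriv \<i> \<theta> y\<bar> < e / 2"
    using uc[of \<i>] by blast
  have "\<bar>\<theta> (y + h) - \<theta> y - dir_deriv h \<theta> y\<bar> \<le> e * norm h" if h: "norm h < min d1 d2" for y h
  proof -
    have close: "\<bar>dir_deriv h \<theta> x - dir_deriv h \<theta> y\<bar> \<le> e * norm h" if "dist x y \<le> norm h" for x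
    proof -
      have "dir_deriv h \<theta> x - dir_deriv h \<theta> y = Re h * (dir_deriv 1 \<theta> x - dir_deriv 1 \<theta> y) + Im h * (dir_deriv \<i> \<theta> x - dir_deriv \<i> \<theta> y)"
        unfolding dir_deriv_Re_Im[OF \<theta>, of h] by (simp add: algebra_simps)
      also have "\<bar>\<dots>\<bar> \<le> \<bar>Re h\<bar> * \<bar>dir_deriv 1 \<theta> x - dir_deriv 1 \<theta> y\<bar> + \<bar>Im h\<bar> * \<bar>dir_deriv \<i> \<theta> x - dir_deriv \<i> \<theta> y\<bar>"
        by (metis abs_mult abs_triangle_ineq)
      also have "\<dots> \<le> norm h * (e / 2) + norm h * (e / 2)"
        using d1(2)[of x y] d2(2)[of x y] that h
        by (intro add_mono mult_mono abs_Re_le_cmod abs_Im_le_cmod) auto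
      finally show ?thesis by (simp add: mult.commute)
    qed
    have line: "((\<lambda>s. \<theta> (y + s *\<^sub>R h) - s * dir_deriv h \<theta> y) has_real_derivative dir_deriv h \<theta> (y + s *\<^sub>R h) - dir_deriv h \<theta> y) (at s within {0..1})" for s
    proof -
      have "((\<lambda>s. y + s *\<^sub>R h) has_derivative (\<lambda>x. x *\<^sub>R h)) (at s)"
        by (auto intro!: derivative_eq_intros)
      from diff_chain_at[OF this smooth_in_has_derivative[OF \<theta>]]
      have "((\<lambda>s. \<theta> (y + s *\<^sub>R h)) has_derivative (\<lambda>x. dir_deriv (x *\<^sub>R h) \<theta> (y + s *\<^sub>R h))) (at s)"
        by (simp add: o_def)
      moreover have "dir_deriv (x *\<^sub>R h) \<theta> q = dir_deriv h \<theta> q * x" for x q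
        unfolding dir_deriv_Re_Im[OF \<theta>, of h] dir_deriv_Re_Im[OF \<theta>, of "x *\<^sub>R h"] by (simp add: algebra_simps)
      ultimately have "((\<lambda>s. \<theta> (y + s *\<^sub>R h)) has_real_derivative dir_deriv h \<theta> (y + s *\<^sub>R h)) (at s)"
        by (simp add: has_field_derivative_def)
      then have "((\<lambda>s. \<theta> (y + s *\<^sub>R h) - s * dir_deriv h \<theta> y) has_real_derivative dir_deriv h \<theta> (y + s *\<^sub>R h) - dir_deriv h \<theta> y) (at s)"
        by (auto intro!: derivative_eq_intros)
      then show ?thesis by (rule has_field_derivative_at_within)
    qed
    have "norm ((\<theta> (y + 1 *\<^sub>R h) - 1 * dir_deriv h \<theta> y) - (\<theta> (y + 0 *\<^sub>R h) - 0 * dir_deriv h \<theta> y)) \<le> (e * norm h) * norm (1 - 0 :: real)"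
      by (rule field_differentiable_bound[of "{0..1}", OF _ line]) (auto intro!: close simp: dist_norm mult_left_le_one_le)
    then show ?thesis by simp
  qed
  with d1(1) d2(1) show ?thesis by (intro exI[of _ "min d1 d2"]) auto
qed

context
  fixes W :: "complex \<Rightarrow> real" and B R :: real
  assumes W_meas [measurable]: "W \<in> borel_measurable borel"
    and W_bound: "\<And>z. \<bar>W z\<bar> \<le> B" and W_supp: "\<And>z. norm z > R \<Longrightarrow> W z = 0"
begin

lemma conv_integrable:
  assumes "continuous_on UNIV \<theta>" "\<And>z. z \<notin> cball 0 \<delta> \<Longrightarrow> \<theta> z = 0"
  shows "integrable lborel (\<lambda>w. W w * \<theta> (z - w))"
proof -
  have [measurable]: "\<theta> \<in> borel_measurable borel" using assms(1) by (rule borel_measurable_continuous_onI)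
  obtain C where C: "\<And>z. \<bar>\<theta> z\<bar> \<le> C"
    using compact_support_bounded[OF assms(1) compact_cball assms(2)] by blast
  show ?thesis
  proof (rule integrable_bounded_support[of _ "B * C" R])
    show "\<bar>W w * \<theta> (z - w)\<bar> \<le> B * C" for w
      unfolding abs_mult using W_bound C by (intro mult_mono) (auto intro: order_trans[OF abs_ge_zero W_bound])
  qed (auto simp: W_supp)
qed

lemma conv_has_derivative:
  assumes \<theta>: "smooth_in (cball 0 \<delta>) \<theta>"
  shows "(conv W \<theta> has_derivative (\<lambda>h. conv W (dir_deriv h \<theta>) z)) (at z)"
proof -
  have sm: "smooth_in (cball 0 \<delta>) (dir_deriv v \<theta>)" for v using \<theta> by (intro smooth_in_dir_deriv) auto
  have i0: "integrable lborel (\<lambda>w. W w * \<theta> (z - w))" for z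
    by (rule conv_integrable[of _ \<delta>, OF smooth_in_continuous[OF \<theta>] smooth_in_zero[OF \<theta>]])
  have i1: "integrable lborel (\<lambda>w. W w * dir_deriv v \<theta> (z - w))" for z v
    by (rule conv_integrable[of _ \<delta>, OF smooth_in_continuous[OF sm] smooth_in_zero[OF sm]])
  have lin: "conv W (dir_deriv h \<theta>) z = Re h * conv W (dir_deriv 1 \<theta>) z + Im h * conv W (dir_deriv \<i> \<theta>) z" for h
  proof -
    have "conv W (dir_deriv h \<theta>) z = (\<integral>w. Re h * (W w * dir_deriv 1 \<theta> (z - w)) + Im h * (W w * dir_deriv \<i> \<theta> (z - w)) \<partial>lborel)"
      unfolding conv_def by (intro Bochner_Integration.integral_cong refl, subst dir_deriv_Re_Im[OF \<theta>]) (simp add: algebra_simps)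
    also have "\<dots> = Re h * conv W (dir_deriv 1 \<theta>) z + Im h * conv W (dir_deriv \<i> \<theta>) z"
      unfolding conv_def by (subst Bochner_Integration.integral_add) (auto intro!: integrable_mult_right i1)
    finally show ?thesis .
  qed
  have bl: "bounded_linear (\<lambda>h. conv W (dir_deriv h \<theta>) z)"
  proof -
    have "(\<lambda>h. conv W (dir_deriv h \<theta>) z) = (\<lambda>h. Re h * conv W (dir_deriv 1 \<theta>) z + Im h * conv W (dir_deriv \<i> \<theta>) z)"
      by (rule ext) (rule lin)
    moreover have "bounded_linear (\<lambda>h. Re h * a + Im h * b)" for a b
      by (intro bounded_linear_add bounded_linear_mult_const bounded_linear_Re bounded_linear_Im)
    ultimately show ?thesis by simp
  qed
  (* e / (I + 1) below avoids dividing by 0 when W vanishes *)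
  define I where "I = (\<integral>w. \<bar>W w\<bar> \<partial>lborel)"
  have intW: "integrable lborel (\<lambda>w. \<bar>W w\<bar>)"
    by (intro integrable_abs integrable_bounded_support[of W B R] W_meas W_bound W_supp)
  have I0: "I \<ge> 0" unfolding I_def by simp
  show ?thesis
    unfolding has_derivative_at_alt
  proof (intro conjI bl allI impI)
    fix e :: real assume e: "e > 0"
    then obtain d where d: "d > 0" "\<And>y h. norm h < d \<Longrightarrow> \<bar>\<theta> (y + h) - \<theta> y - dir_deriv h \<theta> y\<bar> \<le> (e / (I + 1)) * norm h"
      using smooth_in_uniform_linearization[OF \<theta>, of "e / (I + 1)"] I0 by auto
    have "norm (conv W \<theta> y - conv W \<theta> z - conv W (dir_deriv (y - z) \<theta>) z) \<le> e * norm (y - z)" if y: "norm (y - z) < d" for y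
    proof -
      define E where "E w = W w * \<theta> (y - w) - W w * \<theta> (z - w) - W w * dir_deriv (y - z) \<theta> (z - w)" for w
      have "conv W \<theta> y - conv W \<theta> z - conv W (dir_deriv (y - z) \<theta>) z = (\<integral>w. E w \<partial>lborel)"
        unfolding conv_def E_def using i0 i1 by simp
      also have "norm \<dots> \<le> (\<integral>w. norm (E w) \<partial>lborel)" by (rule integral_norm_bound)
      also have "\<dots> \<le> (\<integral>w. \<bar>W w\<bar> * (e / (I + 1) * norm (y - z)) \<partial>lborel)"
      proof (rule integral_mono)
        show "integrable lborel (\<lambda>w. norm (E w))" unfolding E_def by (intro integrable_norm Bochner_Integration.integrable_diff i0 i1)
        show "integrable lborel (\<lambda>w. \<bar>W w\<bar> * (e / (I + 1) * norm (y - z)))" by (intro integrable_mult_left intW)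
        fix w
        have "E w = W w * (\<theta> ((z - w) + (y - z)) - \<theta> (z - w) - dir_deriv (y - z) \<theta> (z - w))"
          unfolding E_def by (simp add: algebra_simps)
        then show "norm (E w) \<le> \<bar>W w\<bar> * (e / (I + 1) * norm (y - z))"
          using d(2)[OF y, of "z - w"] by (simp only: real_norm_def abs_mult) (intro mult_left_mono, auto)
      qed
      also have "\<dots> = I * (e / (I + 1) * norm (y - z))" unfolding I_def by simp
      also have "\<dots> = (I / (I + 1)) * (e * norm (y - z))" by simp
      also have "\<dots> \<le> 1 * (e * norm (y - z))" using I0 e by (intro mult_right_mono) auto
      finally show ?thesis by simp
    qed
    with d(1) show "\<exists>d>0. \<forall>y. norm (y - z) < d \<longrightarrow> norm (conv W \<theta> y - conv W \<theta> z - conv W (dir_deriv (y - z) \<theta>) z) \<le> e * norm (y - z)"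
      by blast
  qed
qed

text \<open>Derivatives fall on the kernel, which stays smooth with the same support; hence the induction.\<close>

lemma conv_Ck: "smooth_in (cball 0 \<delta>) \<theta> \<Longrightarrow> Ck k (conv W \<theta>)"
proof (induction k arbitrary: \<theta>)
  case 0
  show ?case
    using conv_has_derivative[OF 0] has_derivative_continuous continuous_at_imp_continuous_on by (simp, blast)
next
  case (Suc k)
  have "Ck_on (Suc k) UNIV (conv W \<theta>)"
  proof (rule Ck_on_SucI[OF open_UNIV conv_has_derivative[OF Suc.prems]])
    fix h
    have "Ck k (conv W (dir_deriv h \<theta>))" by (rule Suc.IH, rule smooth_in_dir_deriv[OF Suc.prems]) simp
    then show "Ck_on k UNIV (\<lambda>z. conv W (dir_deriv h \<theta>) z)" by (simp add: Ck_on_UNIV)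
  qed
  then show ?case by (simp only: Ck_on_UNIV)
qed

lemma conv_smooth_in:
  assumes \<theta>: "smooth_in (cball 0 \<delta>) \<theta>" and W0: "\<And>z. z \<notin> K0 \<Longrightarrow> W z = 0" and K1: "\<And>x. x \<in> K0 \<Longrightarrow> cball x \<delta> \<subseteq> K1"
  shows "smooth_in K1 (conv W \<theta>)"
  unfolding smooth_in_def
proof (intro conjI allI impI conv_Ck[OF \<theta>])
  fix z assume z: "z \<notin> K1"
  have "W w * \<theta> (z - w) = 0" for w
  proof (cases "w \<in> K0")
    case True
    with K1[OF this] z have "z - w \<notin> cball 0 \<delta>" by (auto simp: dist_norm norm_minus_commute)
    then show ?thesis using \<theta> by (simp add: smooth_in_def)
  qed (simp add: W0)
  then have "(\<lambda>w. W w * \<theta> (z - w)) = (\<lambda>w. 0)" by (rule ext)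
  then show "conv W \<theta> z = 0" by (simp only: conv_def) simp
qed

end

section \<open>A radial mollifier\<close>

definition mollifier :: "real \<Rightarrow> complex \<Rightarrow> real" where
  "mollifier \<delta> z = bump 0 (\<delta>\<^sup>2 - (norm z)\<^sup>2) / (\<integral>w. bump 0 (\<delta>\<^sup>2 - (norm (w::complex))\<^sup>2) \<partial>lborel)"

lemma bump_smooth_in:
  assumes "\<delta> > 0"
  shows "smooth_in (cball 0 \<delta>) (\<lambda>z. bump 0 (\<delta>\<^sup>2 - (norm z)\<^sup>2))"
  unfolding smooth_in_def
proof (intro conjI allI impI)
  show "Ck k (\<lambda>z. bump 0 (\<delta>\<^sup>2 - (norm z)\<^sup>2))" for k
    using Ck_bump[of k 0 "\<delta>\<^sup>2"] by (simp only: Ck_on_UNIV)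
  fix z :: complex assume "z \<notin> cball 0 \<delta>"
  then have "\<delta>\<^sup>2 \<le> (norm z)\<^sup>2" using assms by (intro power_mono) auto
  then show "bump 0 (\<delta>\<^sup>2 - (norm z)\<^sup>2) = 0" by (simp add: bump_def)
qed

lemma integral_bump_pos:
  assumes "\<delta> > 0"
  shows "(\<integral>w. bump 0 (\<delta>\<^sup>2 - (norm (w::complex))\<^sup>2) \<partial>lborel) > 0"
proof -
  note sm = bump_smooth_in[OF assms]
  have i: "integrable lborel (\<lambda>w::complex. bump 0 (\<delta>\<^sup>2 - (norm w)\<^sup>2))"
    by (rule integrable_continuous_support[OF smooth_in_continuous[OF sm] compact_cball smooth_in_zero[OF sm]])
  define c where "c = exp (- (1 / (\<delta>\<^sup>2 / 2)))"
  have "(\<integral>w. c * indicator (ball 0 (\<delta>/2)) (w::complex) \<partial>lborel) \<le> (\<integral>w. bump 0 (\<delta>\<^sup>2 - (norm (w::complex))\<^sup>2) \<partial>lborel)"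
  proof (rule integral_mono[OF _ i])
    show "integrable lborel (\<lambda>w. c * indicator (ball 0 (\<delta>/2)) (w::complex))"
      using emeasure_lborel_ball_finite[of "0::complex" "\<delta>/2"] by (intro integrable_mult_right integrable_real_indicator) auto
    fix w :: complex
    show "c * indicator (ball 0 (\<delta>/2)) w \<le> bump 0 (\<delta>\<^sup>2 - (norm w)\<^sup>2)"
    proof (cases "w \<in> ball 0 (\<delta>/2)")
      case True
      then have "(norm w)\<^sup>2 \<le> (\<delta>/2)\<^sup>2" by (intro power_mono) auto
      then have "(norm w)\<^sup>2 \<le> \<delta>\<^sup>2 / 4" by (simp add: power_divide)
      then have le: "\<delta>\<^sup>2 / 2 \<le> \<delta>\<^sup>2 - (norm w)\<^sup>2"
        using zero_le_power2[of \<delta>] by linarith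
      have p: "0 < \<delta>\<^sup>2 / 2" using assms by simp
      have "1 / (\<delta>\<^sup>2 - (norm w)\<^sup>2) \<le> 1 / (\<delta>\<^sup>2 / 2)"
        by (rule frac_le[OF _ _ p le]) auto
      moreover have "(norm w)\<^sup>2 < \<delta>\<^sup>2" using le p by linarith
      ultimately show ?thesis using True by (simp add: bump_def c_def)
    qed (simp add: bump_def)
  qed
  moreover have "(\<integral>w. c * indicator (ball 0 (\<delta>/2)) (w::complex) \<partial>lborel) > 0"
    using assms by (simp add: c_def content_ball unit_ball_vol_2)
  ultimately show ?thesis by linarith
qed

lemma mollifier_props:
  assumes "\<delta> > 0"
  shows "smooth_in (cball 0 \<delta>) (mollifier \<delta>)" and "mollifier \<delta> z \<ge> 0"
    and "(\<integral>w. mollifier \<delta> w \<partial>lborel) = 1"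
    and "mollifier \<delta> (c * z) = mollifier \<delta> (of_real (norm c) * z)"
    and "integrable lborel (mollifier \<delta>)" and "\<exists>C. \<forall>z. \<bar>mollifier \<delta> z\<bar> \<le> C"
proof -
  note sm = bump_smooth_in[OF assms] and pos = integral_bump_pos[OF assms]
  define N where "N = (\<integral>w. bump 0 (\<delta>\<^sup>2 - (norm (w::complex))\<^sup>2) \<partial>lborel)"
  have m: "mollifier \<delta> = (\<lambda>z. bump 0 (\<delta>\<^sup>2 - (norm z)\<^sup>2) * (1/N))"
    by (auto simp: mollifier_def N_def)
  have "Ck_on k UNIV (mollifier \<delta>)" for k unfolding m
    by (intro Ck_on_mult open_UNIV Ck_on_const Ck_bump)
  then show s: "smooth_in (cball 0 \<delta>) (mollifier \<delta>)"
    using sm unfolding smooth_in_def Ck_on_UNIV by (simp add: m)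
  show "mollifier \<delta> z \<ge> 0" using pos by (simp add: mollifier_def bump_def)
  show "(\<integral>w. mollifier \<delta> w \<partial>lborel) = 1"
    using pos unfolding m N_def by simp
  show "mollifier \<delta> (c * z) = mollifier \<delta> (of_real (norm c) * z)"
    by (simp add: m norm_mult)
  have c: "continuous_on UNIV (mollifier \<delta>)" using smooth_in_continuous[OF s] .
  show "integrable lborel (mollifier \<delta>)"
    by (rule integrable_continuous_support[OF c compact_cball smooth_in_zero[OF s]])
  show "\<exists>C. \<forall>z. \<bar>mollifier \<delta> z\<bar> \<le> C"
    using compact_support_bounded[OF c compact_cball smooth_in_zero[OF s]] by blast
qed

lemma integrable_pair_bounded:
  fixes f :: "real \<Rightarrow> complex \<Rightarrow> real"
  assumes [measurable]: "case_prod f \<in> borel_measurable (lborel \<Otimes>\<^sub>M lborel)"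
    and B: "\<And>t w. \<bar>f t w\<bar> \<le> C" and z: "\<And>t w. t \<notin> {a..b} \<or> w \<notin> cball 0 R \<Longrightarrow> f t w = 0"
  shows "integrable (lborel \<Otimes>\<^sub>M lborel) (case_prod f)"
proof (rule Bochner_Integration.integrable_bound)
  have S: "{a..b} \<times> cball 0 R \<in> sets ((lborel :: real measure) \<Otimes>\<^sub>M (lborel :: complex measure))" by simp
  have "emeasure ((lborel :: real measure) \<Otimes>\<^sub>M (lborel :: complex measure)) ({a..b} \<times> cball 0 R)
     = emeasure lborel {a..b} * emeasure lborel (cball (0::complex) R)"
    by (rule lborel.emeasure_pair_measure_Times) auto
  also have "\<dots> < \<infinity>" using emeasure_lborel_cball_finite[of "0::complex" R]
    by (auto simp: emeasure_lborel_Icc_eq ennreal_mult_less_top)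
  finally show "integrable (lborel \<Otimes>\<^sub>M lborel) (\<lambda>p. C * indicator ({a..b} \<times> cball (0::complex) R) p)"
    using S by (intro integrable_mult_right integrable_real_indicator)
  show "AE p in (lborel :: real measure) \<Otimes>\<^sub>M (lborel :: complex measure). norm (case_prod f p) \<le> norm (C * indicator ({a..b} \<times> cball 0 R) p)"
  proof (intro AE_I2)
    fix p :: "real \<times> complex"
    obtain t w where p: "p = (t, w)" by force
    show "norm (case_prod f p) \<le> norm (C * indicator ({a..b} \<times> cball 0 R) p)"
      using B[of t w] z[of t w] by (cases "t \<in> {a..b} \<and> w \<in> cball 0 R") (auto simp: p)
  qed
qed measurable

section \<open>Mollifying functions that are nearly subharmonic\<close>

context
  fixes W :: "complex \<Rightarrow> real" and B R \<delta> :: real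
  assumes W_meas [measurable]: "W \<in> borel_measurable borel"
    and W_bound: "\<And>z. \<bar>W z\<bar> \<le> B" and W_supp: "\<And>z. norm z > R \<Longrightarrow> W z = 0" and \<delta>: "\<delta> > 0"
begin

lemma mollifier_meas [measurable]: "mollifier \<delta> \<in> borel_measurable borel"
  using smooth_in_continuous[OF mollifier_props(1)[OF \<delta>]] by (rule borel_measurable_continuous_onI)

lemma mollifier_zero: "w \<notin> cball 0 \<delta> \<Longrightarrow> mollifier \<delta> w = 0"
  by (rule smooth_in_zero[OF mollifier_props(1)[OF \<delta>]])

lemma mollifier_rotate: "norm c = 1 \<Longrightarrow> mollifier \<delta> (c * w) = mollifier \<delta> w"
  using mollifier_props(4)[OF \<delta>, of c w] by simp

lemma integrable_mollifier_mult:
  assumes [measurable]: "g \<in> borel_measurable borel" and "\<And>w. \<bar>g w\<bar> \<le> C"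
  shows "integrable lborel (\<lambda>w. g w * mollifier \<delta> w)"
proof -
  obtain D where D: "\<And>z. \<bar>mollifier \<delta> z\<bar> \<le> D" using mollifier_props(6)[OF \<delta>] by blast
  show ?thesis
  proof (rule integrable_bounded_support[of _ "C * D" \<delta>])
    show "\<bar>g w * mollifier \<delta> w\<bar> \<le> C * D" for w
      unfolding abs_mult by (intro mult_mono assms D) (auto intro: order_trans[OF abs_ge_zero assms(2)])
    show "g w * mollifier \<delta> w = 0" if "norm w > \<delta>" for w using mollifier_zero[of w] that by simp
  qed measurable
qed

text \<open>The kernel is even, so the convolution is an average of translates of \<open>W\<close>.\<close>

lemma conv_mollifier: "conv W (mollifier \<delta>) z = (\<integral>w. W (z + w) * mollifier \<delta> w \<partial>lborel)"
proof -
  have "conv W (mollifier \<delta>) z = (\<integral>w. W (z + w) * mollifier \<delta> (z - (z + w)) \<partial>lborel)"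
    unfolding conv_def by (rule integral_lborel_translate[symmetric]) measurable
  moreover have "mollifier \<delta> (z - (z + w)) = mollifier \<delta> w" for w
    using mollifier_rotate[of "-1" w] by simp
  ultimately show ?thesis by simp
qed

lemma conv_mollifier_Fubini:
  fixes h :: "real \<Rightarrow> complex \<Rightarrow> complex"
  assumes h [measurable]: "case_prod h \<in> borel_measurable (lborel \<Otimes>\<^sub>M lborel)"
  shows "(\<integral>w. (\<integral>t. W (h t w) * indicator {0..2*pi} t \<partial>lborel) * mollifier \<delta> w \<partial>lborel)
       = (\<integral>t. (\<integral>w. W (h t w) * mollifier \<delta> w \<partial>lborel) * indicator {0..2*pi} t \<partial>lborel)"
    and "integrable lborel (\<lambda>w. (\<integral>t. W (h t w) * indicator {0..2*pi} t \<partial>lborel) * mollifier \<delta> w)"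
proof -
  obtain D where D: "\<And>z. \<bar>mollifier \<delta> z\<bar> \<le> D" using mollifier_props(6)[OF \<delta>] by blast
  have B0: "0 \<le> B" using W_bound[of 0] by linarith
  define f where "f t w = W (h t w) * mollifier \<delta> w * indicator {0..2*pi} t" for t w
  have f: "integrable (lborel \<Otimes>\<^sub>M lborel) (case_prod f)"
  proof (rule integrable_pair_bounded[of _ "B * D" 0 "2*pi" \<delta>])
    have "(\<lambda>p. W (case_prod h p) * mollifier \<delta> (snd p) * indicator {0..2*pi} (fst p)) \<in> borel_measurable (lborel \<Otimes>\<^sub>M lborel)"
      by measurable
    then show "case_prod f \<in> borel_measurable (lborel \<Otimes>\<^sub>M lborel)"
      by (simp add: f_def case_prod_beta')
    show "\<bar>f t w\<bar> \<le> B * D" for t w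
    proof -
      have "\<bar>f t w\<bar> \<le> \<bar>W (h t w)\<bar> * \<bar>mollifier \<delta> w\<bar>"
        by (auto simp: f_def abs_mult indicator_def)
      also have "\<dots> \<le> B * D" by (intro mult_mono W_bound D B0) auto
      finally show ?thesis .
    qed
    show "f t w = 0" if "t \<notin> {0..2*pi} \<or> w \<notin> cball 0 \<delta>" for t w
      using that mollifier_zero by (auto simp: f_def)
  qed
  have row: "(\<integral>w. f t w \<partial>lborel) = (\<integral>w. W (h t w) * mollifier \<delta> w \<partial>lborel) * indicator {0..2*pi} t" for t
    unfolding f_def by simp
  have col: "(\<integral>t. f t w \<partial>lborel) = (\<integral>t. W (h t w) * indicator {0..2*pi} t \<partial>lborel) * mollifier \<delta> w" for w
  proof -
    have "(\<integral>t. f t w \<partial>lborel) = (\<integral>t. (W (h t w) * indicator {0..2*pi} t) * mollifier \<delta> w \<partial>lborel)"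
      unfolding f_def by (intro Bochner_Integration.integral_cong) auto
    then show ?thesis by simp
  qed
  show "(\<integral>w. (\<integral>t. W (h t w) * indicator {0..2*pi} t \<partial>lborel) * mollifier \<delta> w \<partial>lborel)
       = (\<integral>t. (\<integral>w. W (h t w) * mollifier \<delta> w \<partial>lborel) * indicator {0..2*pi} t \<partial>lborel)"
    using lborel_pair.Fubini_integral[OF f] unfolding row col .
  show "integrable lborel (\<lambda>w. (\<integral>t. W (h t w) * indicator {0..2*pi} t \<partial>lborel) * mollifier \<delta> w)"
    using lborel_pair.integrable_snd[OF f] unfolding col .
qed

text \<open>Averaging the integral over all rotations of the variable \<open>w\<close>, which leave both Lebesgue measure and the
kernel invariant, writes the convolution as an average of circular means about \<open>z\<close>. This stands in for
polar coordinates.\<close>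

lemma conv_mollifier_circ_avg:
  shows "conv W (mollifier \<delta>) z = (\<integral>w. circ_avg W z (norm w) * mollifier \<delta> w \<partial>lborel)"
    and "integrable lborel (\<lambda>w. circ_avg W z (norm w) * mollifier \<delta> w)"
proof -
  have m: "(\<lambda>(t, w). z + cis t * w) \<in> borel_measurable (lborel \<Otimes>\<^sub>M lborel)" by measurable
  note fub = conv_mollifier_Fubini[OF m]
  have avg: "circ_avg W z (norm w) * mollifier \<delta> w
      = 1 / (2*pi) * ((\<integral>t. W (z + cis t * w) * indicator {0..2*pi} t \<partial>lborel) * mollifier \<delta> w)" for w
    using circ_avg_cmod[OF W_meas W_bound, of z w] by (simp add: field_simps)
  have row: "(\<integral>w. W (z + cis t * w) * mollifier \<delta> w \<partial>lborel) = conv W (mollifier \<delta>) z" for t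
  proof -
    have "(\<integral>w. W (z + cis t * w) * mollifier \<delta> w \<partial>lborel) = (\<integral>w. W (z + cis t * w) * mollifier \<delta> (cis t * w) \<partial>lborel)"
      by (simp add: mollifier_rotate)
    also have "\<dots> = (\<integral>w. W (z + w) * mollifier \<delta> w \<partial>lborel)"
      by (rule integral_lborel_rotate[where f="\<lambda>w. W (z + w) * mollifier \<delta> w"]) auto
    finally show ?thesis by (simp add: conv_mollifier)
  qed
  show "conv W (mollifier \<delta>) z = (\<integral>w. circ_avg W z (norm w) * mollifier \<delta> w \<partial>lborel)"
    unfolding avg using fub(1) by (simp add: row)
  show "integrable lborel (\<lambda>w. circ_avg W z (norm w) * mollifier \<delta> w)"
    unfolding avg by (rule integrable_mult_right[OF fub(2)])
qed

lemma circ_avg_conv_mollifier: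
  shows "circ_avg (conv W (mollifier \<delta>)) z r = (\<integral>w. circ_avg W (z + w) r * mollifier \<delta> w \<partial>lborel)"
    and "integrable lborel (\<lambda>w. circ_avg W (z + w) r * mollifier \<delta> w)"
proof -
  have m: "(\<lambda>(t, w). z + of_real r * cis t + w) \<in> borel_measurable (lborel \<Otimes>\<^sub>M lborel)" by measurable
  note fub = conv_mollifier_Fubini[OF m]
  have avg: "circ_avg W (z + w) r * mollifier \<delta> w
      = 1 / (2*pi) * ((\<integral>t. W (z + of_real r * cis t + w) * indicator {0..2*pi} t \<partial>lborel) * mollifier \<delta> w)" for w
    by (simp add: circ_avg_def add_ac)
  show "circ_avg (conv W (mollifier \<delta>)) z r = (\<integral>w. circ_avg W (z + w) r * mollifier \<delta> w \<partial>lborel)"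
    unfolding avg circ_avg_def[of "conv W (mollifier \<delta>)"] conv_mollifier using fub(1) by simp
  show "integrable lborel (\<lambda>w. circ_avg W (z + w) r * mollifier \<delta> w)"
    unfolding avg by (rule integrable_mult_right[OF fub(2)])
qed

context
  fixes L r0 :: real and X K :: "complex set"
  assumes sub: "\<And>c r. 0 < r \<Longrightarrow> r < r0 \<Longrightarrow> W c \<le> circ_avg W c r + L * r\<^sup>2 * indicator X c"
    and L: "L \<ge> 0" and X [measurable]: "X \<in> sets borel" and XK: "\<And>x. x \<in> X \<Longrightarrow> cball x \<delta> \<subseteq> K"
begin

lemma conv_mollifier_ge:
  assumes "\<delta> < r0"
  shows "W z - L * \<delta>\<^sup>2 \<le> conv W (mollifier \<delta>) z"
proof -
  have int: "integrable lborel (\<lambda>w. c * mollifier \<delta> w)" for c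
    by (intro integrable_mult_right mollifier_props(5)[OF \<delta>])
  have "W z - L * \<delta>\<^sup>2 = (\<integral>w. (W z - L * \<delta>\<^sup>2) * mollifier \<delta> w \<partial>lborel)"
    using mollifier_props(3)[OF \<delta>] by simp
  also have "\<dots> \<le> (\<integral>w. circ_avg W z (norm w) * mollifier \<delta> w \<partial>lborel)"
  proof (rule integral_mono_AE[OF int conv_mollifier_circ_avg(2)])
    have "AE w in lborel. w \<noteq> (0::complex)" by (rule AE_lborel_singleton)
    then show "AE w in lborel. (W z - L * \<delta>\<^sup>2) * mollifier \<delta> w \<le> circ_avg W z (norm w) * mollifier \<delta> w"
    proof eventually_elim
      fix w :: complex assume w: "w \<noteq> 0"
      show "(W z - L * \<delta>\<^sup>2) * mollifier \<delta> w \<le> circ_avg W z (norm w) * mollifier \<delta> w"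
      proof (cases "norm w \<le> \<delta>")
        case True
        have "W z \<le> circ_avg W z (norm w) + L * (norm w)\<^sup>2 * indicator X z"
          using w True assms by (intro sub) auto
        also have "L * (norm w)\<^sup>2 * indicator X z \<le> L * \<delta>\<^sup>2 * 1"
          using True L by (intro mult_mono power_mono) (auto simp: indicator_def)
        finally show ?thesis using mollifier_props(2)[OF \<delta>] by (intro mult_right_mono) auto
      next
        case False
        then show ?thesis using mollifier_zero[of w] by simp
      qed
    qed
  qed
  also have "\<dots> = conv W (mollifier \<delta>) z" by (rule conv_mollifier_circ_avg(1)[symmetric])
  finally show ?thesis .
qed

text \<open>A convolution is an average of translates, and every translate satisfies the sub-mean inequality with an
error on a translate of \<open>X\<close>; all these translates lie in \<open>K\<close>.\<close>

lemma conv_mollifier_submean: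
  assumes r: "0 < r" "r < r0"
  shows "conv W (mollifier \<delta>) z \<le> circ_avg (conv W (mollifier \<delta>)) z r + L * indicator K z * r\<^sup>2"
proof -
  have i1: "integrable lborel (\<lambda>w. W (z + w) * mollifier \<delta> w)"
    by (rule integrable_mollifier_mult[of _ B]) (auto intro: W_bound)
  have i3: "integrable lborel (\<lambda>w. (L * indicator K z * r\<^sup>2) * mollifier \<delta> w)"
    by (intro integrable_mult_right mollifier_props(5)[OF \<delta>])
  have "conv W (mollifier \<delta>) z \<le> (\<integral>w. circ_avg W (z + w) r * mollifier \<delta> w + (L * indicator K z * r\<^sup>2) * mollifier \<delta> w \<partial>lborel)"
    unfolding conv_mollifier
  proof (rule integral_mono[OF i1])
    show "integrable lborel (\<lambda>w. circ_avg W (z + w) r * mollifier \<delta> w + (L * indicator K z * r\<^sup>2) * mollifier \<delta> w)"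
      by (intro Bochner_Integration.integrable_add circ_avg_conv_mollifier(2) i3)
    fix w :: complex
    show "W (z + w) * mollifier \<delta> w \<le> circ_avg W (z + w) r * mollifier \<delta> w + (L * indicator K z * r\<^sup>2) * mollifier \<delta> w"
    proof (cases "norm w \<le> \<delta>")
      case True
      have "indicator X (z + w) \<le> (indicator K z :: real)"
        using XK[of "z + w"] True by (auto simp: indicator_def dist_norm subset_eq)
      then have "L * r\<^sup>2 * indicator X (z + w) \<le> L * r\<^sup>2 * indicator K z"
        using L by (intro mult_left_mono) auto
      then have "W (z + w) \<le> circ_avg W (z + w) r + L * indicator K z * r\<^sup>2"
        using sub[OF r, of "z + w"] by (simp add: mult_ac)
      then have "W (z + w) * mollifier \<delta> w \<le> (circ_avg W (z + w) r + L * indicator K z * r\<^sup>2) * mollifier \<delta> w"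
        using mollifier_props(2)[OF \<delta>] by (intro mult_right_mono) auto
      then show ?thesis by (simp add: distrib_right)
    next
      case False
      then show ?thesis using mollifier_zero[of w] by simp
    qed
  qed
  also have "\<dots> = (\<integral>w. circ_avg W (z + w) r * mollifier \<delta> w \<partial>lborel) + (\<integral>w. (L * indicator K z * r\<^sup>2) * mollifier \<delta> w \<partial>lborel)"
    by (intro Bochner_Integration.integral_add circ_avg_conv_mollifier(2) i3)
  also have "\<dots> = circ_avg (conv W (mollifier \<delta>)) z r + L * indicator K z * r\<^sup>2"
    using mollifier_props(3)[OF \<delta>] by (simp add: circ_avg_conv_mollifier(1))
  finally show ?thesis .
qed

end

lemma conv_mollifier_le:
  assumes "\<And>w. norm w \<le> \<delta> \<Longrightarrow> W (z + w) \<le> b"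
  shows "conv W (mollifier \<delta>) z \<le> b"
proof -
  have "conv W (mollifier \<delta>) z \<le> (\<integral>w. b * mollifier \<delta> w \<partial>lborel)"
    unfolding conv_mollifier
  proof (rule integral_mono)
    show "integrable lborel (\<lambda>w. W (z + w) * mollifier \<delta> w)"
      by (rule integrable_mollifier_mult[of _ B]) (auto intro: W_bound)
    show "integrable lborel (\<lambda>w. b * mollifier \<delta> w)"
      by (intro integrable_mult_right mollifier_props(5)[OF \<delta>])
    fix w
    show "W (z + w) * mollifier \<delta> w \<le> b * mollifier \<delta> w"
      using assms[of w] mollifier_zero[of w] mollifier_props(2)[OF \<delta>, of w]
      by (cases "norm w \<le> \<delta>") (auto intro: mult_right_mono)
  qed
  then show ?thesis using mollifier_props(3)[OF \<delta>] by simp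
qed

lemma conv_mollifier_nonneg:
  assumes "\<And>z. 0 \<le> W z"
  shows "0 \<le> conv W (mollifier \<delta>) z"
  unfolding conv_mollifier using assms mollifier_props(2)[OF \<delta>]
  by (intro Bochner_Integration.integral_nonneg) auto

end

lemma trig_integral:
  fixes p a b c d e :: real
  shows "(\<integral>t. (p + (cos t * a + sin t * b) + (cos t * cos t * c + cos t * sin t * d + sin t * sin t * e)) * indicator {0..2*pi} t \<partial>lborel)
    = 2*pi * p + pi * c + pi * e"
proof -
  define F where "F t = p * t + (sin t * a - cos t * b) + ((t + sin t * cos t) / 2 * c + sin t * sin t / 2 * d + (t - sin t * cos t) / 2 * e)" for t
  have "(\<integral>t. (p + (cos t * a + sin t * b) + (cos t * cos t * c + cos t * sin t * d + sin t * sin t * e)) * indicator {0..2*pi} t \<partial>lborel) = F (2*pi) - F 0"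
  proof (rule integral_FTC_Icc_real)
    fix t :: real
    have half: "(1 + (x - y)) / 2 = x" "(1 - (x - y)) / 2 = y" if "x + y = 1" for x y :: real
      using that by simp_all
    note cs = half[OF sin_cos_squared_add3[of t]]
    have "(F has_real_derivative p + (cos t * a + sin t * b) + ((1 + (cos t * cos t - sin t * sin t)) / 2 * c
        + cos t * sin t * d + (1 - (cos t * cos t - sin t * sin t)) / 2 * e)) (at t)"
      unfolding F_def[abs_def]
      by (auto intro!: derivative_eq_intros simp: field_simps)
    then show "(F has_real_derivative p + (cos t * a + sin t * b) + (cos t * cos t * c + cos t * sin t * d + sin t * sin t * e)) (at t)"
      unfolding cs .
  qed (auto intro!: continuous_intros)
  also have "\<dots> = 2*pi * p + pi * c + pi * e" by (simp add: F_def)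
  finally show ?thesis .
qed

text \<open>Taylor expansion along the ray with direction \<open>cis t\<close>. The two mixed derivatives
form one coefficient, which the mean over \<open>t\<close> multiplies by \<open>0\<close>.\<close>

lemma smooth_second_order_bound:
  assumes \<psi>: "smooth_in K \<psi>" "closed K" and \<epsilon>: "\<epsilon> > 0"
  shows "\<exists>d>0. \<forall>r t. 0 < r \<longrightarrow> r < d \<longrightarrow>
     \<psi> (z + of_real r * cis t) \<le> \<psi> z + r * (cos t * dir_deriv 1 \<psi> z + sin t * dir_deriv \<i> \<psi> z)
       + r\<^sup>2 / 2 * (cos t * cos t * dir_deriv 1 (dir_deriv 1 \<psi>) z
           + cos t * sin t * (dir_deriv \<i> (dir_deriv 1 \<psi>) z + dir_deriv 1 (dir_deriv \<i> \<psi>) z)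
           + sin t * sin t * dir_deriv \<i> (dir_deriv \<i> \<psi>) z + 4 * \<epsilon>)"
proof -
  have sm: "smooth_in K (dir_deriv v \<psi>)" for v using \<psi> by (intro smooth_in_dir_deriv)
  have sm2: "smooth_in K (dir_deriv u (dir_deriv v \<psi>))" for u v using sm \<psi> by (intro smooth_in_dir_deriv)
  have "\<exists>d>0. \<forall>y. dist y z < d \<longrightarrow> \<bar>dir_deriv u (dir_deriv v \<psi>) y - dir_deriv u (dir_deriv v \<psi>) z\<bar> < \<epsilon>" for u v
  proof -
    have "isCont (dir_deriv u (dir_deriv v \<psi>)) z"
      using smooth_in_continuous[OF sm2, of UNIV u v] by (simp add: continuous_on_eq_continuous_at)
    then show ?thesis using \<epsilon> by (simp add: continuous_at_eps_delta dist_real_def)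
  qed
  then obtain d where d: "\<And>u v. d u v > (0::real)"
    "\<And>u v y. dist y z < d u v \<Longrightarrow> \<bar>dir_deriv u (dir_deriv v \<psi>) y - dir_deriv u (dir_deriv v \<psi>) z\<bar> < \<epsilon>"
    by metis
  define d0 where "d0 = min (min (d 1 1) (d 1 \<i>)) (min (d \<i> 1) (d \<i> \<i>))"
  have "\<psi> (z + of_real r * cis t) \<le> \<psi> z + r * (cos t * dir_deriv 1 \<psi> z + sin t * dir_deriv \<i> \<psi> z)
       + r\<^sup>2 / 2 * (cos t * cos t * dir_deriv 1 (dir_deriv 1 \<psi>) z
           + cos t * sin t * (dir_deriv \<i> (dir_deriv 1 \<psi>) z + dir_deriv 1 (dir_deriv \<i> \<psi>) z)
           + sin t * sin t * dir_deriv \<i> (dir_deriv \<i> \<psi>) z + 4 * \<epsilon>)" if r: "0 < r" "r < d0" for r t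
  proof -
    define p where "p s = z + of_real s * cis t" for s
    define D1 where "D1 y = cos t * dir_deriv 1 \<psi> y + sin t * dir_deriv \<i> \<psi> y" for y
    define D2 where "D2 y = cos t * cos t * dir_deriv 1 (dir_deriv 1 \<psi>) y
           + cos t * sin t * (dir_deriv \<i> (dir_deriv 1 \<psi>) y + dir_deriv 1 (dir_deriv \<i> \<psi>) y)
           + sin t * sin t * dir_deriv \<i> (dir_deriv \<i> \<psi>) y" for y
    have along: "((\<lambda>s. g (p s)) has_real_derivative cos t * dir_deriv 1 g (p s) + sin t * dir_deriv \<i> g (p s)) (at s)"
      if g: "smooth_in K g" for g s
    proof -
      have "(p has_derivative (\<lambda>x. of_real x * cis t)) (at s)"
        unfolding p_def[abs_def] by (auto intro!: derivative_eq_intros)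
      from diff_chain_at[OF this smooth_in_has_derivative[OF g]]
      have "((\<lambda>s. g (p s)) has_derivative (\<lambda>x. dir_deriv (of_real x * cis t) g (p s))) (at s)"
        by (simp add: o_def)
      moreover have "dir_deriv (of_real x * cis t) g (p s) = (cos t * dir_deriv 1 g (p s) + sin t * dir_deriv \<i> g (p s)) * x" for x
        by (subst dir_deriv_Re_Im[OF g]) (simp add: algebra_simps)
      ultimately show ?thesis by (simp add: has_field_derivative_def)
    qed
    have der1: "((\<lambda>s. \<psi> (p s)) has_real_derivative D1 (p s)) (at s)" for s
      unfolding D1_def by (rule along[OF \<psi>(1)])
    have der2: "((\<lambda>s. D1 (p s)) has_real_derivative D2 (p s)) (at s)" for s
      unfolding D1_def D2_def
      by (auto intro!: derivative_eq_intros along[OF sm] simp: algebra_simps)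
    define diff where "diff m = (if m = 0 then (\<lambda>s. \<psi> (p s)) else if m = 1 then (\<lambda>s. D1 (p s)) else (\<lambda>s. D2 (p s)))" for m :: nat
    have "\<exists>s. 0 < s \<and> s < r \<and> \<psi> (p r) = (\<Sum>m<2. diff m 0 / fact m * r ^ m) + diff 2 s / fact 2 * r ^ 2"
    proof (rule Maclaurin[OF r(1)])
      show "\<forall>m s. m < 2 \<and> 0 \<le> s \<and> s \<le> r \<longrightarrow> (diff m has_real_derivative diff (Suc m) s) (at s)"
        using der1 der2 by (auto simp: diff_def less_Suc_eq numeral_2_eq_2)
    qed (auto simp: diff_def)
    then obtain s where s: "0 < s" "s < r" "\<psi> (p r) = \<psi> (p 0) + D1 (p 0) * r + D2 (p s) / 2 * r\<^sup>2"
      by (auto simp: diff_def numeral_2_eq_2)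
    have p0: "p 0 = z" by (simp add: p_def)
    have dist: "dist (p s) z < d0" using s(1,2) r by (simp add: p_def dist_norm norm_mult)
    have close: "\<bar>c * (dir_deriv u (dir_deriv v \<psi>) (p s) - dir_deriv u (dir_deriv v \<psi>) z)\<bar> \<le> 1 * \<epsilon>"
      if "\<bar>c\<bar> \<le> 1" "d0 \<le> d u v" for c u v
      unfolding abs_mult using d(2)[of "p s" u v] dist that by (intro mult_mono) auto
    have ct: "\<bar>cos t * cos t\<bar> \<le> 1" "\<bar>cos t * sin t\<bar> \<le> 1" "\<bar>sin t * sin t\<bar> \<le> 1"
    proof -
      have m: "\<bar>x * y\<bar> \<le> 1" if "\<bar>x\<bar> \<le> 1" "\<bar>y\<bar> \<le> 1" for x y :: real
        using that by (simp add: abs_mult mult_le_one)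
      show "\<bar>cos t * cos t\<bar> \<le> 1" "\<bar>cos t * sin t\<bar> \<le> 1" "\<bar>sin t * sin t\<bar> \<le> 1"
        by (intro m abs_cos_le_one abs_sin_le_one)+
    qed
    have "D2 (p s) - D2 z =
        cos t * cos t * (dir_deriv 1 (dir_deriv 1 \<psi>) (p s) - dir_deriv 1 (dir_deriv 1 \<psi>) z)
      + cos t * sin t * (dir_deriv \<i> (dir_deriv 1 \<psi>) (p s) - dir_deriv \<i> (dir_deriv 1 \<psi>) z)
      + cos t * sin t * (dir_deriv 1 (dir_deriv \<i> \<psi>) (p s) - dir_deriv 1 (dir_deriv \<i> \<psi>) z)
      + sin t * sin t * (dir_deriv \<i> (dir_deriv \<i> \<psi>) (p s) - dir_deriv \<i> (dir_deriv \<i> \<psi>) z)"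
      by (simp add: D2_def algebra_simps)
    moreover have dd: "d0 \<le> d 1 1" "d0 \<le> d \<i> 1" "d0 \<le> d 1 \<i>" "d0 \<le> d \<i> \<i>"
      by (auto simp: d0_def)
    ultimately have "D2 (p s) \<le> D2 z + 4 * \<epsilon>"
      using close[OF ct(1) dd(1)] close[OF ct(2) dd(2)] close[OF ct(2) dd(3)] close[OF ct(3) dd(4)]
      by linarith
    then have "r\<^sup>2 / 2 * D2 (p s) \<le> r\<^sup>2 / 2 * (D2 z + 4 * \<epsilon>)" by (intro mult_left_mono) auto
    then have "\<psi> (p r) \<le> \<psi> z + r * D1 z + r\<^sup>2 / 2 * (D2 z + 4 * \<epsilon>)"
      using s(3) by (simp add: p0 mult_ac)
    then show ?thesis by (simp add: p_def D1_def D2_def)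
  qed
  moreover have "d0 > 0" using d(1) by (simp add: d0_def)
  ultimately show ?thesis by blast
qed

text \<open>For small \<open>r\<close> the circular mean of a smooth function is \<open>\<psi> z + r\<^sup>2/4 * \<Delta>\<psi> z + o(r\<^sup>2)\<close>; hence the factor
\<open>4\<close>.\<close>

lemma laplacian_ge_if_submean:
  assumes \<psi>: "smooth_in K \<psi>" "compact K" and r0: "r0 > 0"
    and sub: "\<And>r. 0 < r \<Longrightarrow> r < r0 \<Longrightarrow> \<psi> z \<le> circ_avg \<psi> z r + C * r\<^sup>2"
  shows "- 4 * C \<le> laplacian \<psi> z"
proof (rule field_le_epsilon)
  fix e :: real assume "e > 0"
  define \<epsilon> where "\<epsilon> = e / 8"
  have \<epsilon>: "\<epsilon> > 0" using \<open>e > 0\<close> by (simp add: \<epsilon>_def)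
  have cK: "closed K" using \<psi>(2) compact_imp_closed by blast
  obtain A where A: "\<And>z. \<bar>\<psi> z\<bar> \<le> A"
    using compact_support_bounded[OF smooth_in_continuous[OF \<psi>(1)] \<psi>(2) smooth_in_zero[OF \<psi>(1)]] by blast
  have [measurable]: "\<psi> \<in> borel_measurable borel" using smooth_in_continuous[OF \<psi>(1)] by (rule borel_measurable_continuous_onI)
  define a b c d f where "a = dir_deriv 1 \<psi> z" and "b = dir_deriv \<i> \<psi> z"
    and "c = dir_deriv 1 (dir_deriv 1 \<psi>) z" and "d = dir_deriv \<i> (dir_deriv 1 \<psi>) z + dir_deriv 1 (dir_deriv \<i> \<psi>) z"
    and "f = dir_deriv \<i> (dir_deriv \<i> \<psi>) z"
  obtain d0 where d0: "d0 > 0" "\<And>r t. 0 < r \<Longrightarrow> r < d0 \<Longrightarrow>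
     \<psi> (z + of_real r * cis t) \<le> \<psi> z + r * (cos t * a + sin t * b)
       + r\<^sup>2 / 2 * (cos t * cos t * c + cos t * sin t * d + sin t * sin t * f + 4 * \<epsilon>)"
    using smooth_second_order_bound[OF \<psi>(1) cK \<epsilon>, of z] unfolding a_def b_def c_def d_def f_def by blast
  define r where "r = min d0 r0 / 2"
  have r: "0 < r" "r < d0" "r < r0" using d0(1) r0 by (auto simp: r_def)
  define P where "P t = (\<psi> z + r\<^sup>2 / 2 * (4 * \<epsilon>)) + (cos t * (r * a) + sin t * (r * b))
      + (cos t * cos t * (r\<^sup>2 / 2 * c) + cos t * sin t * (r\<^sup>2 / 2 * d) + sin t * sin t * (r\<^sup>2 / 2 * f))" for t
  have le: "\<psi> (z + of_real r * cis t) \<le> P t" for t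
    using d0(2)[OF r(1,2), of t] unfolding P_def by (simp add: algebra_simps)
  have cP: "continuous_on S P" for S unfolding P_def[abs_def] by (intro continuous_intros)
  have "2 * pi * circ_avg \<psi> z r = (\<integral>t. \<psi> (z + of_real r * cis t) * indicator {0..2*pi} t \<partial>lborel)"
    by (simp add: circ_avg_def)
  also have "\<dots> \<le> (\<integral>t. P t * indicator {0..2*pi} t \<partial>lborel)"
  proof (rule integral_mono)
    show "integrable lborel (\<lambda>t. \<psi> (z + of_real r * cis t) * indicator {0..2*pi} t)"
      by (rule integrable_bounded_interval[where B=A]) (auto intro: A)
    show "integrable lborel (\<lambda>t. P t * indicator {0..2*pi} t)"
      using borel_integrable_atLeastAtMost'[OF cP[of "{0..2*pi}"]] unfolding set_integrable_def by (simp add: mult.commute)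
  qed (use le in \<open>auto simp: indicator_def\<close>)
  also have "\<dots> = 2 * pi * (\<psi> z + r\<^sup>2 / 2 * (4 * \<epsilon>)) + pi * (r\<^sup>2 / 2 * c) + pi * (r\<^sup>2 / 2 * f)"
    unfolding P_def by (rule trig_integral)
  also have "\<dots> = 2 * pi * (\<psi> z + r\<^sup>2 / 4 * (c + f) + 2 * \<epsilon> * r\<^sup>2)" by (simp add: algebra_simps)
  finally have "circ_avg \<psi> z r \<le> \<psi> z + r\<^sup>2 / 4 * (c + f) + 2 * \<epsilon> * r\<^sup>2" by simp
  with sub[OF r(1,3)] have "0 \<le> r\<^sup>2 / 4 * (c + f) + 2 * \<epsilon> * r\<^sup>2 + C * r\<^sup>2" by linarith
  also have "\<dots> = r\<^sup>2 / 4 * (c + f + 8 * \<epsilon> + 4 * C)" by (simp add: algebra_simps)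
  finally have "0 \<le> c + f + 8 * \<epsilon> + 4 * C" using r(1) by (simp add: zero_le_mult_iff)
  moreover have "laplacian \<psi> z = c + f" by (simp add: laplacian_dir_deriv c_def f_def)
  ultimately show "- 4 * C \<le> laplacian \<psi> z + e" by (simp add: \<epsilon>_def)
qed

text \<open>The sub-mean inequality bounds the convolutions from below by \<open>W z - L \<delta>\<^sup>2\<close> and upper semicontinuity bounds
their upper limit by \<open>W z\<close>. So they converge at every point, which matters because the limit is taken in
an integral against a Riesz measure, where null sets for Lebesgue measure can have mass.\<close>

lemma smooth_approximation:
  fixes W :: "complex \<Rightarrow> real"
  assumes usc: "\<And>a. open {z. W z < a}" and W: "\<And>z. 0 \<le> W z" "\<And>z. W z \<le> B"
    and K0: "bounded K0" "\<And>z. z \<notin> K0 \<Longrightarrow> W z = 0"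
    and K1: "compact K1" "\<And>x. x \<in> K0 \<Longrightarrow> cball x d \<subseteq> K1"
    and sub: "\<And>c r. 0 < r \<Longrightarrow> r < r0 \<Longrightarrow> W c \<le> circ_avg W c r + L * r\<^sup>2 * indicator X c"
    and L: "L \<ge> 0" and X: "X \<in> sets borel" and XK: "\<And>x. x \<in> X \<Longrightarrow> cball x d \<subseteq> K"
    and d: "d > 0" and r0: "r0 > 0"
  shows "\<exists>\<psi>. (\<forall>n::nat. smooth_in K1 (\<psi> n)) \<and> (\<forall>n z. 0 \<le> \<psi> n z \<and> \<psi> n z \<le> B) \<and>
     (\<forall>z. (\<lambda>n. \<psi> n z) \<longlonglongrightarrow> W z) \<and> (\<forall>n z. - 4 * (L * indicator K z) \<le> laplacian (\<psi> n) z)"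
proof -
  have meas: "W \<in> borel_measurable borel"
    using usc by (intro borel_measurableI_less) auto
  obtain R where R: "\<And>z. z \<in> K0 \<Longrightarrow> norm z \<le> R" using K0(1) unfolding bounded_iff by auto
  have bound: "\<bar>W z\<bar> \<le> B" for z using W[of z] by simp
  have supp: "W z = 0" if "norm z > R" for z using K0(2)[of z] R[of z] that by force
  (* Suc (Suc n) keeps every radius strictly below both d and r0 *)
  define \<delta> where "\<delta> n = min d r0 * inverse (real (Suc (Suc n)))" for n
  have \<delta>pos: "\<delta> n > 0" for n using d r0 by (simp add: \<delta>_def)
  have "\<delta> n < min d r0" for n
  proof -
    have "min d r0 * inverse (real (Suc (Suc n))) < min d r0 * 1"
      using d r0 by (intro mult_strict_left_mono) (auto simp: field_simps)
    then show ?thesis by (simp add: \<delta>_def)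
  qed
  then have \<delta>: "\<delta> n < d" "\<delta> n < r0" for n by (simp_all add: min_less_iff_conj)
  have "(\<lambda>n. min d r0 * inverse (real (Suc (Suc n)))) \<longlonglongrightarrow> min d r0 * 0"
    by (intro tendsto_mult tendsto_const LIMSEQ_Suc[OF LIMSEQ_inverse_real_of_nat])
  then have \<delta>0: "\<delta> \<longlonglongrightarrow> 0" unfolding \<delta>_def by simp
  define \<psi> where "\<psi> n = conv W (mollifier (\<delta> n))" for n
  have XK': "cball x (\<delta> n) \<subseteq> K" if "x \<in> X" for x n
    using XK[OF that] \<delta>(1)[of n] by (meson less_imp_le order_trans subset_cball)
  have K1': "cball x (\<delta> n) \<subseteq> K1" if "x \<in> K0" for x n
    using K1(2)[OF that] \<delta>(1)[of n] by (meson less_imp_le order_trans subset_cball)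
  have sm: "smooth_in K1 (\<psi> n)" for n
    unfolding \<psi>_def by (rule conv_smooth_in[OF meas bound supp mollifier_props(1)[OF \<delta>pos] K0(2) K1'])
  have "0 \<le> \<psi> n z" "\<psi> n z \<le> B" for n z
    unfolding \<psi>_def using conv_mollifier_nonneg[OF meas bound supp \<delta>pos W(1)] conv_mollifier_le[OF meas bound supp \<delta>pos W(2)] by auto
  moreover have "- 4 * (L * indicator K z) \<le> laplacian (\<psi> n) z" for n z
  proof (rule laplacian_ge_if_submean[OF sm K1(1) r0])
    fix r :: real assume "0 < r" "r < r0"
    from conv_mollifier_submean[OF meas bound supp \<delta>pos sub L X XK' this]
    show "\<psi> n z \<le> circ_avg (\<psi> n) z r + L * indicator K z * r\<^sup>2" unfolding \<psi>_def .
  qed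
  moreover have "(\<lambda>n. \<psi> n z) \<longlonglongrightarrow> W z" for z
  proof (rule order_tendstoI)
    fix a assume a: "a < W z"
    have "(\<lambda>n. W z - L * (\<delta> n)\<^sup>2) \<longlonglongrightarrow> W z - L * 0\<^sup>2" by (intro tendsto_intros \<delta>0)
    then have "\<forall>\<^sub>F n in sequentially. a < W z - L * (\<delta> n)\<^sup>2" using a by (intro order_tendstoD(1)) auto
    then show "\<forall>\<^sub>F n in sequentially. a < \<psi> n z"
    proof eventually_elim
      fix n assume "a < W z - L * (\<delta> n)\<^sup>2"
      also have "\<dots> \<le> \<psi> n z" unfolding \<psi>_def
        by (rule conv_mollifier_ge[OF meas bound supp \<delta>pos sub L X XK' \<delta>(2)])
      finally show "a < \<psi> n z" .
    qed
  next
    fix a assume a: "W z < a"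
    define b where "b = (W z + a) / 2"
    have b: "W z < b" "b < a" using a by (auto simp: b_def)
    then obtain \<rho> where \<rho>: "\<rho> > 0" "ball z \<rho> \<subseteq> {z. W z < b}" using usc[of b] openE by blast
    have "\<forall>\<^sub>F n in sequentially. \<delta> n < \<rho>" using order_tendstoD(2)[OF \<delta>0 \<rho>(1)] .
    then show "\<forall>\<^sub>F n in sequentially. \<psi> n z < a"
    proof eventually_elim
      fix n assume n: "\<delta> n < \<rho>"
      have "\<psi> n z \<le> b" unfolding \<psi>_def
      proof (rule conv_mollifier_le[OF meas bound supp \<delta>pos])
        fix w :: complex assume "norm w \<le> \<delta> n"
        then have "z + w \<in> ball z \<rho>" using n by (simp add: dist_norm)
        with \<rho>(2) show "W (z + w) \<le> b" by auto
      qed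
      with b show "\<psi> n z < a" by simp
    qed
  qed
  ultimately show ?thesis using sm by blast
qed

section \<open>Comparing the two Riesz measures in the plane\<close>

text \<open>Integrate the nonnegative function \<open>(m - ln |F|) * (\<Delta>\<psi> + C * 1\<^sub>K)\<close>. The integral over \<open>K\<close> on the right does
not depend on \<open>\<psi>\<close>.\<close>

lemma zeros_le_integral_laplacian:
  assumes \<psi>: "smooth_in K1 \<psi>" and pos: "\<And>z. \<psi> z \<ge> 0" and \<Omega>: "open \<Omega>"
    and K1: "compact K1" "K1 \<subseteq> \<Omega>" and K: "compact K" "K \<subseteq> \<Omega>"
    and F: "F holomorphic_on \<Omega>" and nz: "\<And>a. a \<in> \<Omega> \<Longrightarrow> eventually (\<lambda>z. F z \<noteq> 0) (at a)"
    and fin: "\<And>K. compact K \<Longrightarrow> K \<subseteq> \<Omega> \<Longrightarrow> finite {z\<in>K. F z = 0}"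
    and lap: "\<And>z. - (C * indicator K z) \<le> laplacian \<psi> z"
    and m: "\<And>K. compact K \<Longrightarrow> K \<subseteq> \<Omega> \<Longrightarrow> integrable lborel (\<lambda>z. indicator K z * m z)"
    and le: "\<And>z. z \<in> \<Omega> \<Longrightarrow> F z \<noteq> 0 \<Longrightarrow> ln (norm (F z)) \<le> m z"
  shows "pi / 2 * (\<Sum>a\<in>{z\<in>K1. F z = 0}. of_int (zorder F a) * \<psi> a)
     \<le> (\<integral>z. m z * laplacian \<psi> z \<partial>lborel) + C * (\<integral>z. indicator K z * m z - indicator K z * ln (norm (F z)) \<partial>lborel)"
proof -
  have cK1: "closed K1" using K1 compact_imp_closed by blast
  note L = smooth_in_laplacian[OF \<psi> cK1]
  have im: "integrable lborel (\<lambda>z. m z * laplacian \<psi> z)"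
    by (intro integrable_mult_laplacian[OF \<psi> K1(1)] m K1)
  have il: "integrable lborel (\<lambda>z. ln (norm (F z)) * laplacian \<psi> z)"
    by (intro integrable_mult_laplacian[OF \<psi> K1(1)] integrable_ln_holomorphic[OF \<Omega> K1 F nz fin[OF K1]])
  note zeros = zeros_le_log_laplacian[OF \<psi> pos K1 \<Omega> F nz fin[OF K1]]
  have ilK: "integrable lborel (\<lambda>z. indicator K z * ln (norm (F z)))"
    by (rule integrable_ln_holomorphic[OF \<Omega> K F nz fin[OF K]])
  define A where "A = {z\<in>K1. F z = 0} \<union> {z\<in>K. F z = 0}"
  have A: "finite A" using fin K1 K by (auto simp: A_def)
  define E where "E z = m z * laplacian \<psi> z - ln (norm (F z)) * laplacian \<psi> z + C * (indicator K z * m z - indicator K z * ln (norm (F z)))" for z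
  have "0 \<le> (\<integral>z. E z \<partial>lborel)"
  proof (rule integral_nonneg_AE)
    show "AE z in lborel. 0 \<le> E z"
      using AE_not_in[OF finite_imp_null_set_lborel[OF A]]
    proof eventually_elim
      fix z assume z: "z \<notin> A"
      have E: "E z = (m z - ln (norm (F z))) * (laplacian \<psi> z + C * indicator K z)"
        by (simp add: E_def algebra_simps)
      show "0 \<le> E z"
      proof (cases "z \<in> K1 \<union> K")
        case True
        then have "z \<in> \<Omega>" "F z \<noteq> 0" using z K1 K by (auto simp: A_def)
        then have "0 \<le> m z - ln (norm (F z))" using le by simp
        moreover have "0 \<le> laplacian \<psi> z + C * indicator K z" using lap[of z] by simp
        ultimately show ?thesis unfolding E by (rule mult_nonneg_nonneg)
      next
        case False
        then show ?thesis unfolding E by (simp add: L(2))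
      qed
    qed
  qed
  also have "(\<integral>z. E z \<partial>lborel) = (\<integral>z. m z * laplacian \<psi> z \<partial>lborel) - (\<integral>z. ln (norm (F z)) * laplacian \<psi> z \<partial>lborel)
      + C * (\<integral>z. indicator K z * m z - indicator K z * ln (norm (F z)) \<partial>lborel)"
    unfolding E_def using im il m[OF K] ilK
    by (subst Bochner_Integration.integral_add) auto
  finally show ?thesis using zeros by linarith
qed

section \<open>Truncating the weight\<close>

text \<open>If \<open>y\<close> is a point of \<open>Y\<close> nearest to \<open>c\<close>, then \<open>(infdist z Y)\<^sup>2 \<le> |z - y|\<^sup>2\<close>, with equality at \<open>c\<close>, and the
mean of \<open>|z - y|\<^sup>2\<close> over the circle is \<open>|c - y|\<^sup>2 + r\<^sup>2\<close>.\<close>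

lemma circ_avg_infdist_le:
  assumes Y: "closed Y" "Y \<noteq> {}" and L: "L \<ge> 0"
  shows "circ_avg (\<lambda>z. L * (infdist z Y)\<^sup>2) c r \<le> L * (infdist c Y)\<^sup>2 + L * r\<^sup>2"
proof -
  obtain y where y: "y \<in> Y" "infdist c Y = dist c y"
    using infdist_attains_inf[OF Y] by blast
  define p where "p = L * ((norm (c - y))\<^sup>2 + r\<^sup>2)"
  define a b where "a = 2 * L * r * Re (c - y)" and "b = 2 * L * r * Im (c - y)"
  define P where "P t = p + (cos t * a + sin t * b) + (cos t * cos t * 0 + cos t * sin t * 0 + sin t * sin t * 0)" for t :: real
  have cP: "continuous_on S P" for S unfolding P_def[abs_def] by (intro continuous_intros)
  have le: "L * (infdist (c + of_real r * cis t) Y)\<^sup>2 \<le> P t" for t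
  proof -
    have "(infdist (c + of_real r * cis t) Y)\<^sup>2 \<le> (norm ((c - y) + of_real r * cis t))\<^sup>2"
      using infdist_le[OF y(1), of "c + of_real r * cis t"]
      by (intro power_mono infdist_nonneg) (simp add: dist_norm algebra_simps)
    also have "\<dots> = (Re (c - y) + r * cos t)\<^sup>2 + (Im (c - y) + r * sin t)\<^sup>2"
      by (simp add: cmod_power2)
    also have "\<dots> = (Re (c - y))\<^sup>2 + (Im (c - y))\<^sup>2 + r\<^sup>2 * ((cos t)\<^sup>2 + (sin t)\<^sup>2) + 2 * r * (cos t * Re (c - y) + sin t * Im (c - y))"
    proof -
      have "(x + r * k)\<^sup>2 + (y + r * l)\<^sup>2 = x\<^sup>2 + y\<^sup>2 + r\<^sup>2 * (k\<^sup>2 + l\<^sup>2) + 2 * r * (k * x + l * y)" for x y k l :: real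
        by (simp add: power2_eq_square algebra_simps)
      then show ?thesis .
    qed
    also have "\<dots> = (norm (c - y))\<^sup>2 + r\<^sup>2 + 2 * r * (cos t * Re (c - y) + sin t * Im (c - y))"
      by (simp add: cmod_power2)
    finally have "L * (infdist (c + of_real r * cis t) Y)\<^sup>2 \<le> L * ((norm (c - y))\<^sup>2 + r\<^sup>2 + 2 * r * (cos t * Re (c - y) + sin t * Im (c - y)))"
      using L by (rule mult_left_mono)
    also have "\<dots> = P t" by (simp add: P_def p_def a_def b_def algebra_simps)
    finally show ?thesis .
  qed
  have cont: "continuous_on {0..2*pi} (\<lambda>t. L * (infdist (c + of_real r * cis t) Y)\<^sup>2)"
    by (intro continuous_intros)
  have "2 * pi * circ_avg (\<lambda>z. L * (infdist z Y)\<^sup>2) c r = (\<integral>t. L * (infdist (c + of_real r * cis t) Y)\<^sup>2 * indicator {0..2*pi} t \<partial>lborel)"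
    by (simp add: circ_avg_def)
  also have "\<dots> \<le> (\<integral>t. P t * indicator {0..2*pi} t \<partial>lborel)"
  proof (rule integral_mono)
    show "integrable lborel (\<lambda>t. L * (infdist (c + of_real r * cis t) Y)\<^sup>2 * indicator {0..2*pi} t)"
      using borel_integrable_atLeastAtMost'[OF cont] unfolding set_integrable_def by (simp add: mult.commute)
    show "integrable lborel (\<lambda>t. P t * indicator {0..2*pi} t)"
      using borel_integrable_atLeastAtMost'[OF cP[of "{0..2*pi}"]] unfolding set_integrable_def by (simp add: mult.commute)
  qed (use le in \<open>auto simp: indicator_def\<close>)
  also have "\<dots> = 2 * pi * p + pi * 0 + pi * 0" unfolding P_def by (rule trig_integral)
  finally have "circ_avg (\<lambda>z. L * (infdist z Y)\<^sup>2) c r \<le> p" by simp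
  also have "p = L * (infdist c Y)\<^sup>2 + L * r\<^sup>2" by (simp add: p_def y(2) dist_norm algebra_simps)
  finally show ?thesis .
qed

text \<open>For a nonnegative function the extended-real circular mean of the definition is an ordinary integral.
The function is cut off to \<open>0\<close> outside \<open>\<Omega>\<close> to make it measurable on the whole plane.\<close>

lemma subharmonic_on_le_circ_avg:
  assumes u: "subharmonic_on u U" and \<Omega>: "open \<Omega>" "\<Omega> \<subseteq> U" and pos: "\<And>z. z \<in> \<Omega> \<Longrightarrow> 0 \<le> u z"
    and c: "r > 0" "cball c r \<subseteq> \<Omega>"
  defines "w \<equiv> \<lambda>z. if z \<in> \<Omega> then real_of_ereal (u z) else 0"
  shows "w \<in> borel_measurable borel" 
    and "w c \<le> circ_avg w c r" and "integrable lborel (\<lambda>t. w (c + of_real r * cis t) * indicator {0..2*pi} t)"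
proof -
  have fin: "u z < \<infinity>" if "z \<in> U" for z using u that by (auto simp: subharmonic_on_def)
  have usc: "open {z\<in>U. u z < a}" for a using u by (auto simp: subharmonic_on_def)
  have uw: "u z = ereal (w z)" if "z \<in> \<Omega>" for z
    using pos[OF that] fin[of z] \<Omega> that by (cases "u z") (auto simp: w_def)
  have w0: "w z \<ge> 0" for z using pos by (auto simp: w_def real_of_ereal_pos)
  show [measurable]: "w \<in> borel_measurable borel"
  proof (rule borel_measurableI_less)
    fix a
    have on: "w z < a \<longleftrightarrow> u z < ereal a" if "z \<in> \<Omega>" for z by (simp only: uw[OF that] less_ereal.simps)
    have off: "w z = 0" if "z \<notin> \<Omega>" for z using that by (simp add: w_def)
    have "{z \<in> space borel. w z < a} = (\<Omega> \<inter> {z\<in>U. u z < ereal a}) \<union> (if 0 < a then - \<Omega> else {})"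
    proof (rule set_eqI)
      fix z
      show "z \<in> {z \<in> space borel. w z < a} \<longleftrightarrow> z \<in> (\<Omega> \<inter> {z\<in>U. u z < ereal a}) \<union> (if 0 < a then - \<Omega> else {})"
        using on[of z] off[of z] \<Omega>(2) by (cases "z \<in> \<Omega>") auto
    qed
    moreover have "\<Omega> \<inter> {z\<in>U. u z < ereal a} \<in> sets borel" using usc \<Omega> by (intro borel_open open_Int)
    ultimately show "{z \<in> space borel. w z < a} \<in> sets borel" using \<Omega> by auto
  qed
  obtain b where b: "\<And>z. z \<in> cball c r \<Longrightarrow> u z < ereal b"
    using usc_bounded_above_on_compact[of U u "cball c r", OF fin usc compact_cball order_trans[OF c(2) \<Omega>(2)]] by blast
  have circ: "c + of_real r * cis t \<in> \<Omega>" "\<bar>w (c + of_real r * cis t)\<bar> \<le> b" for t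
  proof -
    have m: "c + of_real r * cis t \<in> cball c r" using c(1) by (simp add: dist_norm norm_mult)
    then show i: "c + of_real r * cis t \<in> \<Omega>" using c by auto
    from b[OF m] uw[OF i] w0 show "\<bar>w (c + of_real r * cis t)\<bar> \<le> b" by simp
  qed
  show int: "integrable lborel (\<lambda>t. w (c + of_real r * cis t) * indicator {0..2*pi} t)"
    by (rule integrable_bounded_interval[where B=b]) (auto intro: circ)
  define J where "J = (\<integral>t. w (c + of_real r * cis t) * indicator {0..2*pi} t \<partial>lborel)"
  have J0: "J \<ge> 0" unfolding J_def using w0 by (intro Bochner_Integration.integral_nonneg) auto
  have "(\<integral>\<^sup>+t\<in>{0..2*pi}. e2ennreal (u (c + of_real r * cis t)) \<partial>lborel) = (\<integral>\<^sup>+t. ennreal (w (c + of_real r * cis t) * indicator {0..2*pi} t) \<partial>lborel)"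
    using w0 by (intro nn_integral_cong) (auto simp: uw[OF circ(1)] indicator_def)
  also have "\<dots> = ennreal J" unfolding J_def using w0 by (intro nn_integral_eq_integral int) auto
  finally have 1: "(\<integral>\<^sup>+t\<in>{0..2*pi}. e2ennreal (u (c + of_real r * cis t)) \<partial>lborel) = ennreal J" .
  have "e2ennreal (- u (c + of_real r * cis t)) = 0" for t
    using w0 by (simp add: uw[OF circ(1)] ennreal_neg)
  then have 2: "(\<integral>\<^sup>+t\<in>{0..2*pi}. e2ennreal (- u (c + of_real r * cis t)) \<partial>lborel) = 0" by simp
  have "u c \<le> circle_mean u c r" using u c \<Omega> by (auto simp: subharmonic_on_def)
  also have "circle_mean u c r = ereal (circ_avg w c r)"
    unfolding circle_mean_def 1 2 circ_avg_def J_def[symmetric] using J0 by (simp add: zero_ennreal.rep_eq)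
  finally have "u c \<le> ereal (circ_avg w c r)" .
  moreover have "c \<in> \<Omega>" using c by force
  ultimately show "w c \<le> circ_avg w c r" using uw[of c] by simp
qed

text \<open>With \<open>Y\<close> the set of points at distance at least \<open>2\<rho>\<close> from \<open>Q\<close> and \<open>g = L * (infdist z Y)\<^sup>2\<close>, \<open>L = B/\<rho>\<^sup>2\<close>,
the function \<open>W\<close> is \<open>max (u - g - \<epsilon>) 0\<close>. Within distance \<open>\<rho>\<close> of \<open>Q\<close> one has \<open>g \<ge> B \<ge> u\<close>, so \<open>W = 0\<close>; beyond
that, \<open>u < \<epsilon>\<close> off \<open>T\<close>, so \<open>W\<close> is supported in \<open>T\<close>. Where \<open>W > 0\<close>, the sub-mean inequality for \<open>u\<close> carries
over with error \<open>L r\<^sup>2\<close> coming from \<open>g\<close>, and without error where \<open>g\<close> vanishes on the whole circle. Where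
\<open>W = 0\<close> the inequality is trivial. The bound on the Laplacian does not depend on \<open>\<epsilon>\<close> or \<open>T\<close>.\<close>

lemma truncated_weight_approximation:
  fixes u :: "complex \<Rightarrow> ereal"
  assumes u: "subharmonic_on u U" and \<Omega>: "open \<Omega>" "\<Omega> \<subseteq> U" and pos: "\<And>z. z \<in> \<Omega> \<Longrightarrow> 0 \<le> u z"
    and Q: "closed Q" and \<rho>: "\<rho> > 0" and Yne: "{z. 2 * \<rho> \<le> infdist z Q} \<noteq> {}"
    and B: "B > 0" "\<And>z. z \<in> \<Omega> \<Longrightarrow> infdist z Q \<le> \<rho> \<Longrightarrow> u z < ereal B"
    and T: "compact T" "T \<subseteq> \<Omega>" and \<epsilon>: "\<epsilon> > 0"
    and small: "\<And>z. z \<in> \<Omega> \<Longrightarrow> z \<notin> T \<Longrightarrow> \<rho> < infdist z Q \<Longrightarrow> u z < ereal \<epsilon>"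
  defines "W \<equiv> \<lambda>z. if z \<in> \<Omega> then max (real_of_ereal (u z) - B / \<rho>\<^sup>2 * (infdist z {z. 2 * \<rho> \<le> infdist z Q})\<^sup>2 - \<epsilon>) 0 else 0"
  shows "\<exists>K1 \<psi> A. compact K1 \<and> T \<subseteq> K1 \<and> K1 \<subseteq> \<Omega> \<and> (\<forall>z. z \<notin> T \<longrightarrow> W z = 0) \<and>
     (\<forall>n::nat. smooth_in K1 (\<psi> n)) \<and> (\<forall>n z. 0 \<le> \<psi> n z \<and> \<psi> n z \<le> A) \<and>
     (\<forall>z. (\<lambda>n. \<psi> n z) \<longlonglongrightarrow> W z) \<and>
     (\<forall>n z. - (4 * (B / \<rho>\<^sup>2) * indicator {z. \<rho> / 2 \<le> infdist z Q \<and> infdist z Q \<le> 3 * \<rho>} z) \<le> laplacian (\<psi> n) z)"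
proof -
  define Y where "Y = {z. 2 * \<rho> \<le> infdist z Q}"
  define L where "L = B / \<rho>\<^sup>2"
  define g where "g z = L * (infdist z Y)\<^sup>2" for z
  define w where "w z = (if z \<in> \<Omega> then real_of_ereal (u z) else 0)" for z
  have cY: "closed Y" unfolding Y_def by (intro closed_Collect_le continuous_intros)
  have Y: "Y \<noteq> {}" using Yne by (simp add: Y_def)
  have L0: "L \<ge> 0" using B by (simp add: L_def)
  have g0: "g z \<ge> 0" for z using L0 by (simp add: g_def)
  have contg: "continuous_on S g" for S unfolding g_def[abs_def] by (intro continuous_intros)
  have W: "W z = (if z \<in> \<Omega> then max (w z - g z - \<epsilon>) 0 else 0)" for z
    by (simp add: W_def w_def g_def L_def Y_def)
  have fin: "u z < \<infinity>" if "z \<in> U" for z using u that by (auto simp: subharmonic_on_def)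
  have usc: "open {z\<in>U. u z < a}" for a using u by (auto simp: subharmonic_on_def)
  have uw: "u z = ereal (w z)" if "z \<in> \<Omega>" for z
    using pos[OF that] fin[of z] \<Omega> that by (cases "u z") (auto simp: w_def)
  have w0: "w z \<ge> 0" for z using pos by (auto simp: w_def real_of_ereal_pos)
  have inner: "g z \<ge> B" if "infdist z Q \<le> \<rho>" for z
  proof -
    obtain y where y: "y \<in> Y" "infdist z Y = dist z y" using infdist_attains_inf[OF cY Y] by blast
    have "2 * \<rho> \<le> infdist z Q + dist y z"
      using y(1) infdist_triangle[of y Q z] by (simp add: Y_def)
    then have "\<rho> \<le> infdist z Y" using that y(2) by (simp add: dist_commute)
    then have "\<rho>\<^sup>2 \<le> (infdist z Y)\<^sup>2" using \<rho> by (intro power_mono) auto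
    then have "L * \<rho>\<^sup>2 \<le> g z" unfolding g_def using L0 by (rule mult_left_mono)
    then show ?thesis using \<rho> by (simp add: L_def)
  qed
  have WT: "W z = 0" if "z \<notin> T" for z
  proof (cases "z \<in> \<Omega>")
    case True
    have "w z - g z - \<epsilon> \<le> 0"
    proof (cases "infdist z Q \<le> \<rho>")
      case le: True
      then show ?thesis using inner[OF le] B(2)[OF True le] uw[OF True] \<epsilon> by simp
    next
      case False
      then show ?thesis using small[OF True that] uw[OF True] g0[of z] by simp
    qed
    then show ?thesis by (simp add: W)
  qed (simp add: W)
  have Winner: "\<rho> < infdist z Q" if "W z > 0" for z
  proof (rule ccontr)
    assume "\<not> \<rho> < infdist z Q"
    then have le: "infdist z Q \<le> \<rho>" by simp
    have z: "z \<in> \<Omega>" using that by (auto simp: W split: if_splits)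
    then have "w z - g z - \<epsilon> \<le> 0" using inner[OF le] B(2)[OF z le] uw[OF z] \<epsilon> by simp
    with that z show False by (simp add: W)
  qed
  obtain e0 where e0: "e0 > 0" "(\<Union>x\<in>T. cball x e0) \<subseteq> \<Omega>"
    using compact_subset_open_imp_cball_epsilon_subset[OF T(1) \<Omega>(1) T(2)] by blast
  define d where "d = min e0 (\<rho> / 2)"
  (* d \<le> \<rho> / 2 keeps small circles about points beyond 5/2 \<rho> from Q inside Y, where g vanishes *)
  have d: "d > 0" "d \<le> e0" "d \<le> \<rho> / 2" using e0 \<rho> by (auto simp: d_def)
  define K1 where "K1 = (\<Union>x\<in>T. cball x d)"
  have K1: "compact K1" unfolding K1_def by (rule compact_minkowski_sum_cball[OF T(1)])
  have K1\<Omega>: "K1 \<subseteq> \<Omega>" using e0(2) subset_cball[OF d(2)] unfolding K1_def by blast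
  have TK1: "T \<subseteq> K1" unfolding K1_def using d(1) by force
  obtain A where A: "\<And>z. z \<in> T \<Longrightarrow> u z < ereal A"
    using usc_bounded_above_on_compact[of U u T, OF fin usc T(1) order_trans[OF T(2) \<Omega>(2)]] by blast
  define A' where "A' = max A 0"
  have WA: "W z \<le> A'" for z
  proof (cases "z \<in> T")
    case True
    then have z: "z \<in> \<Omega>" using T by auto
    then have "w z < A" using A[OF True] uw[OF z] by simp
    then show ?thesis using g0[of z] \<epsilon> z by (simp add: W A'_def)
  qed (simp add: WT A'_def)
  have W0: "W z \<ge> 0" for z by (simp add: W)
  have Wusc: "open {z. W z < a}" for a
  proof (cases "a > 0")
    case False
    then have "{z. W z < a} = {}" using W0 by (auto simp: not_less intro: order_trans)
    then show ?thesis by simp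
  next
    case True
    (* inserting a constant q between w and a + \<epsilon> + g separates the semicontinuous from the continuous part *)
    have "{z. W z < a} = - T \<union> (\<Union>q. (\<Omega> \<inter> {z\<in>U. u z < ereal q}) \<inter> {z. q < a + \<epsilon> + g z})"
    proof (intro equalityI subsetI)
      fix z assume z: "z \<in> {z. W z < a}"
      show "z \<in> - T \<union> (\<Union>q. (\<Omega> \<inter> {z\<in>U. u z < ereal q}) \<inter> {z. q < a + \<epsilon> + g z})"
      proof (cases "z \<in> T")
        case True
        then have zO: "z \<in> \<Omega>" using T by auto
        then have "w z < a + \<epsilon> + g z" using z by (simp add: W)
        then obtain q where "w z < q" "q < a + \<epsilon> + g z" using dense by blast
        then show ?thesis using zO \<Omega> uw[OF zO] by auto
      qed simp
    next
      fix z assume "z \<in> - T \<union> (\<Union>q. (\<Omega> \<inter> {z\<in>U. u z < ereal q}) \<inter> {z. q < a + \<epsilon> + g z})"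
      then show "z \<in> {z. W z < a}"
        using WT[of z] True uw[of z] by (auto simp: W)
    qed
    moreover have "open (- T)" using T(1) compact_imp_closed by blast
    moreover have "open {z. q < a + \<epsilon> + g z}" for q
      by (intro open_Collect_less continuous_intros contg)
    ultimately show ?thesis using \<Omega>(1) usc by (auto intro!: open_Un open_UN open_Int)
  qed
  have measW [measurable]: "W \<in> borel_measurable borel" using Wusc by (intro borel_measurableI_less) auto
  define X where "X = {z. \<rho> \<le> infdist z Q \<and> infdist z Q \<le> 5 / 2 * \<rho>}"
  have sub: "W c \<le> circ_avg W c r + L * r\<^sup>2 * indicator X c" if r: "0 < r" "r < d" for c r
  proof (cases "W c > 0")
    case False
    have "0 \<le> circ_avg W c r"
      unfolding circ_avg_def using W0 by (intro divide_nonneg_nonneg Bochner_Integration.integral_nonneg) auto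
    then show ?thesis using False W0[of c] L0 by (simp add: not_less add_nonneg_nonneg order_antisym_conv)
  next
    case True
    then have cT: "c \<in> T" using WT[of c] by force
    then have ball: "cball c r \<subseteq> \<Omega>" using r K1\<Omega> unfolding K1_def by (force simp: subset_eq)
    have c\<Omega>: "c \<in> \<Omega>" using cT T by auto
    have on: "c + of_real r * cis t \<in> \<Omega>" for t
    proof -
      have "c + of_real r * cis t \<in> cball c r" using r by (simp add: dist_norm norm_mult)
      then show ?thesis using ball by auto
    qed
    have cis_dist: "dist c (c + of_real r * cis t) = r" for t using r by (simp add: dist_norm norm_mult)
    have w_eq: "(\<lambda>z. if z \<in> \<Omega> then real_of_ereal (u z) else 0) = w" by (simp add: w_def fun_eq_iff)
    have wc: "w c \<le> circ_avg w c r" and iw: "integrable lborel (\<lambda>t. w (c + of_real r * cis t) * indicator {0..2*pi} t)"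
      using subharmonic_on_le_circ_avg(2,3)[OF u \<Omega> pos r(1) ball] unfolding w_eq by (simp_all only: w_def)
    have contgc: "continuous_on {0..2*pi} (\<lambda>t. g (c + of_real r * cis t))"
      unfolding g_def by (intro continuous_intros)
    have ig: "integrable lborel (\<lambda>t. g (c + of_real r * cis t) * indicator {0..2*pi} t)"
      using borel_integrable_atLeastAtMost'[OF contgc] unfolding set_integrable_def by (simp add: mult.commute)
    have ie: "integrable lborel (\<lambda>t::real. \<epsilon> * indicator {0..2*pi} t)"
      by (rule integrable_bounded_interval[where B=\<epsilon>]) (use \<epsilon> in auto)
    have iW: "integrable lborel (\<lambda>t. W (c + of_real r * cis t) * indicator {0..2*pi} t)"
      by (rule integrable_bounded_interval[where B=A']) (use WA W0 in auto)
    have "(\<integral>t. w (c + of_real r * cis t) * indicator {0..2*pi} t - g (c + of_real r * cis t) * indicator {0..2*pi} t - \<epsilon> * indicator {0..2*pi} t \<partial>lborel)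
       \<le> (\<integral>t. W (c + of_real r * cis t) * indicator {0..2*pi} t \<partial>lborel)"
    proof (rule integral_mono[OF _ iW])
      show "integrable lborel (\<lambda>t. w (c + of_real r * cis t) * indicator {0..2*pi} t - g (c + of_real r * cis t) * indicator {0..2*pi} t - \<epsilon> * indicator {0..2*pi} t)"
        by (intro Bochner_Integration.integrable_diff iw ig ie)
    qed (use on in \<open>auto simp: W indicator_def\<close>)
    also have "(\<integral>t. w (c + of_real r * cis t) * indicator {0..2*pi} t - g (c + of_real r * cis t) * indicator {0..2*pi} t - \<epsilon> * indicator {0..2*pi} t \<partial>lborel)
      = 2 * pi * circ_avg w c r - 2 * pi * circ_avg g c r - 2 * pi * \<epsilon>"
      using iw ig ie by (simp add: circ_avg_def)
    finally have "2 * pi * (circ_avg w c r - circ_avg g c r - \<epsilon>) \<le> 2 * pi * circ_avg W c r"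
      by (simp add: circ_avg_def[of W] algebra_simps)
    then have avgW: "circ_avg w c r - circ_avg g c r - \<epsilon> \<le> circ_avg W c r" by simp
    have gavg: "circ_avg g c r \<le> g c + L * r\<^sup>2 * indicator X c"
    proof (cases "c \<in> X")
      case True
      then show ?thesis using circ_avg_infdist_le[OF cY Y L0, of c r] by (simp add: g_def[abs_def])
    next
      case False
      then have far: "5 / 2 * \<rho> < infdist c Q" using Winner[OF \<open>W c > 0\<close>] by (auto simp: X_def)
      have "g (c + of_real r * cis t) = 0" for t
      proof -
        have "infdist c Q \<le> infdist (c + of_real r * cis t) Q + r"
          using infdist_triangle[of c Q "c + of_real r * cis t"] cis_dist by simp
        then have "c + of_real r * cis t \<in> Y" using far r d(3) by (simp add: Y_def)
        then show ?thesis by (simp add: g_def)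
      qed
      then show ?thesis using g0 by (simp add: circ_avg_def False)
    qed
    have "W c = w c - g c - \<epsilon>" using True c\<Omega> by (simp add: W split: if_splits)
    then show ?thesis using wc avgW gavg by linarith
  qed
  have Xm: "X \<in> sets borel"
    unfolding X_def by (intro borel_closed closed_Collect_conj closed_Collect_le continuous_intros)
  have XK: "cball x d \<subseteq> {z. \<rho> / 2 \<le> infdist z Q \<and> infdist z Q \<le> 3 * \<rho>}" if "x \<in> X" for x
  proof
    fix z assume "z \<in> cball x d"
    then have "dist x z \<le> \<rho> / 2" using d(3) by simp
    then show "z \<in> {z. \<rho> / 2 \<le> infdist z Q \<and> infdist z Q \<le> 3 * \<rho>}"
      using that infdist_triangle[of x Q z] infdist_triangle[of z Q x] by (simp add: X_def dist_commute)
  qed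
  have K1T: "cball x d \<subseteq> K1" if "x \<in> T" for x using that by (auto simp: K1_def)
  from smooth_approximation[OF Wusc W0 WA compact_imp_bounded[OF T(1)] WT K1 K1T sub L0 Xm XK d(1) d(1)]
  obtain \<psi> where "\<forall>n::nat. smooth_in K1 (\<psi> n)" "\<forall>n z. 0 \<le> \<psi> n z \<and> \<psi> n z \<le> A'" "\<forall>z. (\<lambda>n. \<psi> n z) \<longlonglongrightarrow> W z"
    "\<forall>n z. - 4 * (L * indicator {z. \<rho> / 2 \<le> infdist z Q \<and> infdist z Q \<le> 3 * \<rho>} z) \<le> laplacian (\<psi> n) z"
    by blast
  then show ?thesis
    using K1 TK1 K1\<Omega> WT by (intro exI[of _ K1] exI[of _ \<psi>] exI[of _ A']) (auto simp: L_def mult.assoc)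
qed

section \<open>Test functions and Riesz measures on the sphere\<close>

definition sphere_lift :: "(complex \<Rightarrow> real) \<Rightarrow> sphere \<Rightarrow> real" where
  "sphere_lift h p = (case p of None \<Rightarrow> 0 | Some z \<Rightarrow> h z)"

lemma sphere_lift_Some [simp]: "sphere_lift h (Some z) = h z"
  by (simp add: sphere_lift_def)

lemma sphere_lift_None [simp]: "sphere_lift h None = 0"
  by (simp add: sphere_lift_def)

text \<open>Near \<open>\<infinity>\<close> the lifted function is \<open>0\<close>, elsewhere the second chart is a holomorphic change of variable.\<close>

lemma sphere_lift_test_function:
  assumes \<psi>: "smooth_in K \<psi>" and K: "compact K" "Some ` K \<subseteq> D"
  shows "sphere_lift \<psi> \<in> test_functions D"
proof -
  have 1: "sphere_lift \<psi> \<circ> Some = \<psi>" by (simp add: fun_eq_iff)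
  obtain b where b: "b > 0" "\<And>z. z \<in> K \<Longrightarrow> norm z \<le> b"
    using compact_imp_bounded[OF K(1)] unfolding bounded_pos by blast
  have eq1: "(sphere_lift \<psi> \<circ> inv_chart) w = \<psi> (inverse w)" if "w \<in> - {0}" for w
    using that by (simp add: inv_chart_def)
  have eq2: "(sphere_lift \<psi> \<circ> inv_chart) w = 0" if w: "w \<in> ball 0 (1/b)" for w
  proof (cases "w = 0")
    case False
    then have "0 < norm w" "norm w < inverse b" using w by (auto simp: inverse_eq_divide)
    then have "b < inverse (norm w)" using b(1) less_imp_inverse_less[of "norm w" "inverse b"] by simp
    then have "inverse w \<notin> K" using b(2)[of "inverse w"] by (auto simp: norm_inverse)
    then show ?thesis using False smooth_in_zero[OF \<psi>] by (simp add: inv_chart_def)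
  qed (simp add: inv_chart_def)
  have "Ck k (sphere_lift \<psi> \<circ> inv_chart)" for k
  proof -
    have "Ck_on k UNIV \<psi>" using \<psi> by (simp add: smooth_in_def Ck_on_UNIV)
    then have "Ck_on k (- {0}) (\<lambda>w. \<psi> (inverse w))"
      by (intro Ck_on_compose_holomorphic[of UNIV "- {0}" inverse] holomorphic_intros) auto
    then have "Ck_on k (- {0}) (sphere_lift \<psi> \<circ> inv_chart)"
      using Ck_on_cong[of "- {0}" "sphere_lift \<psi> \<circ> inv_chart" "\<lambda>w. \<psi> (inverse w)" k] eq1 by auto
    moreover have "Ck_on k (ball 0 (1/b)) (sphere_lift \<psi> \<circ> inv_chart)"
      using Ck_on_cong[of "ball 0 (1/b)" "sphere_lift \<psi> \<circ> inv_chart" "\<lambda>w. 0" k] eq2 Ck_on_const[of "ball 0 (1/b)" k 0] by auto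
    ultimately have "Ck_on k (- {0} \<union> ball 0 (1/b)) (sphere_lift \<psi> \<circ> inv_chart)"
      by (intro Ck_on_Un) auto
    moreover have "- {0} \<union> ball 0 (1/b) = (UNIV :: complex set)" using b(1) by auto
    ultimately show ?thesis by (simp add: Ck_on_UNIV)
  qed
  moreover have "{p. sphere_lift \<psi> p \<noteq> 0} \<Subset> D"
  proof (rule relatively_compact_Some[OF K(1) _ K(2)])
    show "{p. sphere_lift \<psi> p \<noteq> 0} \<subseteq> Some ` K"
      using smooth_in_zero[OF \<psi>] by (auto simp: sphere_lift_def split: option.splits)
  qed
  ultimately show ?thesis using \<psi> by (simp add: test_functions_def 1 smooth_in_def)
qed

lemma riesz_measure_space:
  assumes "is_riesz_measure D M \<nu>"
  shows "space \<nu> = D" and "\<And>U. openin riemann_sphere U \<Longrightarrow> U \<subseteq> D \<Longrightarrow> U \<in> sets \<nu>"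
proof -
  have s: "sets \<nu> = sets (sigma D {U. openin riemann_sphere U \<and> U \<subseteq> D})"
    using assms by (simp add: is_riesz_measure_def)
  have sub: "{U. openin riemann_sphere U \<and> U \<subseteq> D} \<subseteq> Pow D" by auto
  show "space \<nu> = D" using sets_eq_imp_space_eq[OF s] space_measure_of[OF sub] by simp
  show "U \<in> sets \<nu>" if "openin riemann_sphere U" "U \<subseteq> D" for U
    using that unfolding s sets_measure_of[OF sub] by (intro sigma_sets.Basic) auto
qed

lemma sphere_lift_measurable:
  assumes \<nu>: "is_riesz_measure D M \<nu>" and \<psi>: "continuous_on UNIV \<psi>" "\<And>z. 0 \<le> \<psi> z"
    and D: "\<And>z. \<psi> z \<noteq> 0 \<Longrightarrow> Some z \<in> D"
  shows "sphere_lift \<psi> \<in> borel_measurable \<nu>"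
proof (rule borel_measurableI_greater)
  fix a
  show "{p \<in> space \<nu>. a < sphere_lift \<psi> p} \<in> sets \<nu>"
  proof (cases "a < 0")
    case True
    then have "a < sphere_lift \<psi> p" for p
      using \<psi>(2) by (cases p) (auto intro: less_le_trans)
    then have "{p \<in> space \<nu>. a < sphere_lift \<psi> p} = space \<nu>" by auto
    then show ?thesis by simp
  next
    case False
    have sub: "Some ` {z. a < \<psi> z} \<subseteq> D" using D False by force
    have "{p \<in> space \<nu>. a < sphere_lift \<psi> p} = Some ` {z. a < \<psi> z}"
    proof (intro equalityI subsetI)
      fix p assume p: "p \<in> {p \<in> space \<nu>. a < sphere_lift \<psi> p}"
      then show "p \<in> Some ` {z. a < \<psi> z}" using False by (cases p) auto
    next
      fix p assume "p \<in> Some ` {z. a < \<psi> z}"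
      then show "p \<in> {p \<in> space \<nu>. a < sphere_lift \<psi> p}" using sub riesz_measure_space(1)[OF \<nu>] by auto
    qed
    moreover have "open {z. a < \<psi> z}" by (intro open_Collect_less continuous_on_const \<psi>(1))
    ultimately show ?thesis
      using riesz_measure_space(2)[OF \<nu>, of "Some ` {z. a < \<psi> z}"] sub by (simp add: openin_Some_image)
  qed
qed

text \<open>For each \<open>\<psi> n\<close> this is the comparison in the plane combined with the defining property of the Riesz
measure. The passage to the limit is by dominated convergence, as \<open>\<nu>\<close> is finite on compact sets.\<close>

lemma zeros_le_riesz_mass:
  fixes M :: "sphere \<Rightarrow> ereal"
  defines "m \<equiv> \<lambda>z. real_of_ereal (M (Some z))"
  assumes \<nu>: "is_riesz_measure D M \<nu>" and D_open: "openin riemann_sphere D" and \<Omega>: "open \<Omega>" "Some ` \<Omega> \<subseteq> D"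
    and K1: "compact K1" "K1 \<subseteq> \<Omega>" and K: "compact K" "K \<subseteq> \<Omega>"
    and F: "F holomorphic_on \<Omega>" and nz: "\<And>a. a \<in> \<Omega> \<Longrightarrow> eventually (\<lambda>z. F z \<noteq> 0) (at a)"
    and fin: "\<And>K. compact K \<Longrightarrow> K \<subseteq> \<Omega> \<Longrightarrow> finite {z\<in>K. F z = 0}"
    and m: "\<And>K. compact K \<Longrightarrow> K \<subseteq> \<Omega> \<Longrightarrow> integrable lborel (\<lambda>z. indicator K z * m z)"
    and le: "\<And>z. z \<in> \<Omega> \<Longrightarrow> F z \<noteq> 0 \<Longrightarrow> ln (norm (F z)) \<le> m z"
    and \<psi>: "\<And>n::nat. smooth_in K1 (\<psi> n)" "\<And>n z. 0 \<le> \<psi> n z" "\<And>n z. \<psi> n z \<le> A"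
    and lim: "\<And>z. (\<lambda>n. \<psi> n z) \<longlonglongrightarrow> W z"
    and lap: "\<And>n z. - (C * indicator K z) \<le> laplacian (\<psi> n) z"
    and W: "(\<integral>\<^sup>+p. ennreal (sphere_lift W p) \<partial>\<nu>) \<le> ennreal I" and I: "I \<ge> 0"
  shows "pi / 2 * (\<Sum>a\<in>{z\<in>K1. F z = 0}. of_int (zorder F a) * W a)
     \<le> 2 * pi * I + C * (\<integral>z. indicator K z * m z - indicator K z * ln (norm (F z)) \<partial>lborel)"
proof -
  let ?\<Gamma> = "C * (\<integral>z. indicator K z * m z - indicator K z * ln (norm (F z)) \<partial>lborel)"
  have SK1: "Some ` K1 \<subseteq> D" using K1 \<Omega> by auto
  have W0: "0 \<le> W z" for z using lim[of z] \<psi>(2) by (intro LIMSEQ_le_const) auto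
  have \<psi>D: "\<psi> n z \<noteq> 0 \<Longrightarrow> Some z \<in> D" for n z using smooth_in_zero[OF \<psi>(1)[of n], of z] SK1 by auto
  have meas [measurable]: "sphere_lift (\<psi> n) \<in> borel_measurable \<nu>" for n
    by (rule sphere_lift_measurable[OF \<nu> smooth_in_continuous[OF \<psi>(1)] \<psi>(2) \<psi>D])
  have limp: "(\<lambda>n. sphere_lift (\<psi> n) p) \<longlonglongrightarrow> sphere_lift W p" for p
    using lim by (cases p) auto
  have measW [measurable]: "sphere_lift W \<in> borel_measurable \<nu>"
    by (rule borel_measurable_LIMSEQ_real[OF limp meas])
  have cK: "compactin riemann_sphere (Some ` K1)" by (rule compactin_Some_image[OF K1(1)])
  (* the sigma-algebra is generated by open sets, so the compact set enters through its complement *)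
  have "D - Some ` K1 \<in> sets \<nu>"
  proof (rule riesz_measure_space(2)[OF \<nu>])
    show "openin riemann_sphere (D - Some ` K1)"
      using D_open compactin_imp_closedin[OF Hausdorff_riemann_sphere cK] by (intro openin_diff)
  qed auto
  then have K1s: "Some ` K1 \<in> sets \<nu>"
    using sets.compl_sets[of "D - Some ` K1" \<nu>] SK1 riesz_measure_space(1)[OF \<nu>] by (simp add: double_diff)
  have K1fin: "emeasure \<nu> (Some ` K1) < \<infinity>" using \<nu> cK SK1 by (simp add: is_riesz_measure_def)
  have A0: "0 \<le> A" using \<psi>(2,3) order_trans by blast
  have "(\<lambda>n. \<integral>p. sphere_lift (\<psi> n) p \<partial>\<nu>) \<longlonglongrightarrow> (\<integral>p. sphere_lift W p \<partial>\<nu>)"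
  proof (rule integral_dominated_convergence[where w="\<lambda>p. A * indicator (Some ` K1) p"])
    show "integrable \<nu> (\<lambda>p. A * indicator (Some ` K1) p)"
      using K1s K1fin by (intro integrable_mult_right integrable_real_indicator)
    show "AE p in \<nu>. norm (sphere_lift (\<psi> n) p) \<le> A * indicator (Some ` K1) p" for n
    proof (rule AE_I2)
      fix p
      show "norm (sphere_lift (\<psi> n) p) \<le> A * indicator (Some ` K1) p"
      proof (cases p)
        case (Some z)
        then show ?thesis
          using \<psi>(2,3)[of n z] smooth_in_zero[OF \<psi>(1)[of n], of z] by (cases "z \<in> K1") auto
      qed (auto simp: A0)
    qed
  qed (use limp in auto)
  then have "(\<lambda>n. 2 * pi * (\<integral>p. sphere_lift (\<psi> n) p \<partial>\<nu>) + ?\<Gamma>) \<longlonglongrightarrow> 2 * pi * (\<integral>p. sphere_lift W p \<partial>\<nu>) + ?\<Gamma>"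
    by (intro tendsto_intros)
  moreover have "(\<lambda>n. pi / 2 * (\<Sum>a\<in>{z\<in>K1. F z = 0}. of_int (zorder F a) * \<psi> n a)) \<longlonglongrightarrow> pi / 2 * (\<Sum>a\<in>{z\<in>K1. F z = 0}. of_int (zorder F a) * W a)"
    by (intro tendsto_intros lim)
  moreover have "pi / 2 * (\<Sum>a\<in>{z\<in>K1. F z = 0}. of_int (zorder F a) * \<psi> n a) \<le> 2 * pi * (\<integral>p. sphere_lift (\<psi> n) p \<partial>\<nu>) + ?\<Gamma>" for n
  proof -
    have "sphere_lift (\<psi> n) \<in> test_functions D" by (rule sphere_lift_test_function[OF \<psi>(1) K1(1) SK1])
    then have "(\<integral>p. sphere_lift (\<psi> n) p \<partial>\<nu>) = 1 / (2*pi) * (\<integral>z. m z * laplacian (sphere_lift (\<psi> n) \<circ> Some) z \<partial>lborel)"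
      using \<nu> unfolding is_riesz_measure_def m_def by blast
    moreover have "sphere_lift (\<psi> n) \<circ> Some = \<psi> n" by (simp add: fun_eq_iff)
    ultimately have "2 * pi * (\<integral>p. sphere_lift (\<psi> n) p \<partial>\<nu>) = (\<integral>z. m z * laplacian (\<psi> n) z \<partial>lborel)" by simp
    then show ?thesis
      using zeros_le_integral_laplacian[OF \<psi>(1,2) \<Omega>(1) K1 K F nz fin lap m le, of n] by simp
  qed
  ultimately have "pi / 2 * (\<Sum>a\<in>{z\<in>K1. F z = 0}. of_int (zorder F a) * W a) \<le> 2 * pi * (\<integral>p. sphere_lift W p \<partial>\<nu>) + ?\<Gamma>"
    by (intro LIMSEQ_le) auto
  moreover have "(\<integral>p. sphere_lift W p \<partial>\<nu>) \<le> I"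
  proof -
    have nn: "AE p in \<nu>. 0 \<le> sphere_lift W p" using W0 by (intro AE_I2) (auto simp: sphere_lift_def split: option.splits)
    have "(\<integral>p. sphere_lift W p \<partial>\<nu>) = enn2real (\<integral>\<^sup>+p. ennreal (sphere_lift W p) \<partial>\<nu>)"
      by (rule integral_eq_nn_integral[OF measW nn])
    also have "\<dots> \<le> I" using W I by (simp add: enn2real_leI)
    finally show ?thesis .
  qed
  then have "2 * pi * (\<integral>p. sphere_lift W p \<partial>\<nu>) \<le> 2 * pi * I" by simp
  ultimately show ?thesis by linarith
qed

section \<open>A collar around the removed set\<close>

lemma compact_vimage_Some:
  assumes "closedin riemann_sphere C" "None \<notin> C"
  shows "compact (Some -` C)"
proof -
  have "(\<exists>K. compact K \<and> closed K \<and> C = Some ` K) \<or> (\<exists>U. open U \<and> C = insert None (range Some) - Some ` U)"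
    using assms(1) unfolding riemann_sphere_def closedin_Alexandroff_compactification by simp
  then obtain K where "compact K" "C = Some ` K" using assms(2) by auto
  moreover from this have "Some -` C = K" by auto
  ultimately show ?thesis by simp
qed

lemma closed_vimage_Some:
  assumes "closedin riemann_sphere C"
  shows "closed (Some -` C)"
proof -
  have "openin riemann_sphere (UNIV - C)" using assms by (simp add: closedin_def topspace_riemann_sphere)
  from open_vimage_Some[OF this] have "open (- (Some -` C))" by (simp add: vimage_Diff Compl_eq_Diff_UNIV)
  then show ?thesis by (simp add: closed_def)
qed

text \<open>The set \<open>Q\<close> is the closure of \<open>D0\<close> in the plane, enlarged by the complement of a large disc if \<open>\<infinity>\<close> lies in
\<open>D\<close>. One of \<open>Q\<close> and the complement of \<open>D\<close> is then compact in the plane, so they have a positive distance,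
and the part of \<open>D\<close> that is not close to \<open>Q\<close> meets every closed subset of the sphere inside \<open>D\<close> in a compact subset of the plane.\<close>

lemma collar_exists:
  assumes D: "openin riemann_sphere D" "D \<noteq> UNIV" and D0: "D0 \<noteq> {}" "D0 \<Subset> D"
  obtains Q \<rho> where "closed Q" "\<rho> > 0" "Some -` D0 \<subseteq> Q"
    "\<And>z. infdist z Q \<le> 4 * \<rho> \<Longrightarrow> Some z \<in> D" "{z. 2 * \<rho> \<le> infdist z Q} \<noteq> {}"
    "compact {z. \<rho> / 2 \<le> infdist z Q \<and> infdist z Q \<le> 3 * \<rho>}"
    "compactin riemann_sphere (Some ` {z. infdist z Q \<le> 2 * \<rho>} \<union> (D \<inter> {None}))"
    "\<And>C. closedin riemann_sphere C \<Longrightarrow> C \<subseteq> D \<Longrightarrow> compact ({z. \<rho> \<le> infdist z Q} \<inter> Some -` C)"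
proof -
  define Cl where "Cl = riemann_sphere closure_of D0"
  have Cl: "closedin riemann_sphere Cl" "Cl \<subseteq> D" "D0 \<subseteq> Cl"
    using D0 by (auto simp: Cl_def relatively_compact_in_def topspace_riemann_sphere intro!: closure_of_subset[THEN subsetD])
  define E where "E = Some -` Cl"
  have cE: "closed E" unfolding E_def by (rule closed_vimage_Some[OF Cl(1)])
  define P where "P = - (Some -` D)"
  have cP: "closed P" using open_vimage_Some[OF D(1)] by (simp add: P_def closed_Compl)
  have ED0: "Some -` D0 \<subseteq> E" using Cl(3) by (auto simp: E_def)
  have sep: "Some z \<in> D" if d: "\<And>x y. x \<in> Q \<Longrightarrow> y \<in> P \<Longrightarrow> d \<le> dist x y" and Q: "closed Q" "Q \<noteq> {}" and z: "infdist z Q < d" for Q d z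
  proof (rule ccontr)
    assume "Some z \<notin> D"
    then have "z \<in> P" by (simp add: P_def)
    obtain q where "q \<in> Q" "infdist z Q = dist z q" using infdist_attains_inf[OF Q] by blast
    with d[OF this(1) \<open>z \<in> P\<close>] z show False by (simp add: dist_commute)
  qed
  have cc: "closed {z. a \<le> infdist z Q \<and> infdist z Q \<le> b}" "closed {z. a \<le> infdist z Q}" for a b :: real and Q :: "complex set"
    by (intro closed_Collect_conj closed_Collect_le continuous_intros)+
  show ?thesis
  proof (cases "None \<in> D")
    case False
    have kE: "compact E" unfolding E_def using False Cl(2) by (intro compact_vimage_Some Cl(1)) auto
    have Ene: "E \<noteq> {}"
    proof -
      obtain p where "p \<in> D0" using D0(1) by auto
      then show ?thesis using Cl(2,3) False by (cases p) (auto simp: E_def)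
    qed
    have "E \<inter> P = {}" using Cl(2) by (auto simp: E_def P_def)
    then obtain d where d: "d > 0" "\<And>x y. x \<in> E \<Longrightarrow> y \<in> P \<Longrightarrow> d \<le> dist x y"
      using separate_compact_closed[OF kE cP] by blast
    define \<rho> where "\<rho> = d / 5"
    have \<rho>: "\<rho> > 0" "4 * \<rho> < d" using d(1) by (auto simp: \<rho>_def)
    have kb: "compact {z. infdist z E \<le> b}" if "b > 0" for b by (rule compact_infdist_le[OF Ene kE that])
    have "{z. 2 * \<rho> \<le> infdist z E} \<noteq> {}"
    proof
      assume "{z. 2 * \<rho> \<le> infdist z E} = {}"
      then have "{z. infdist z E \<le> 2 * \<rho>} = UNIV" by (auto simp: not_le) (metis less_imp_le not_le)
      with kb[of "2 * \<rho>"] \<rho> show False by (simp add: not_compact_UNIV)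
    qed
    moreover have "compact {z. \<rho> / 2 \<le> infdist z E \<and> infdist z E \<le> 3 * \<rho>}"
    proof -
      have "{z. \<rho> / 2 \<le> infdist z E \<and> infdist z E \<le> 3 * \<rho>} = {z. \<rho> / 2 \<le> infdist z E} \<inter> {z. infdist z E \<le> 3 * \<rho>}" by auto
      moreover have "compact ({z. \<rho> / 2 \<le> infdist z E} \<inter> {z. infdist z E \<le> 3 * \<rho>})"
        using \<rho> by (intro closed_Int_compact cc(2) kb) simp
      ultimately show ?thesis by (simp only:)
    qed
    moreover have "compactin riemann_sphere (Some ` {z. infdist z E \<le> 2 * \<rho>} \<union> (D \<inter> {None}))"
      using compactin_Some_image[OF kb[of "2 * \<rho>"]] \<rho> False by simp
    moreover have "compact ({z. \<rho> \<le> infdist z E} \<inter> Some -` C)" if "closedin riemann_sphere C" "C \<subseteq> D" for C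
      using compact_vimage_Some[OF that(1)] that(2) False cc(2) by (intro closed_Int_compact) auto
    moreover have "Some z \<in> D" if "infdist z E \<le> 4 * \<rho>" for z
      using sep[OF d(2) cE Ene] that \<rho> by simp
    ultimately show ?thesis using cE ED0 \<rho>(1) by (intro that[of E \<rho>])
  next
    case True
    then obtain e where e: "e > 0" "inv_chart ` ball 0 e \<subseteq> D"
      using D(1) unfolding openin_riemann_sphere_iff_nbhd by auto
    define R where "R = 2 / e"
    have R: "Some z \<in> D" if "R \<le> norm z" for z
    proof -
      have "0 < norm z" "1 / e < norm z" using that e(1) by (auto simp: R_def field_simps intro: less_le_trans[of 0 "2 / e"] less_le_trans[of "1/e" "2/e"])
      then have "z \<noteq> 0" "inverse (norm z) < e" using less_imp_inverse_less[of "1 / e" "norm z"] e(1) by auto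
      then have "inverse z \<in> ball 0 e" by (simp add: norm_inverse)
      then have "inv_chart (inverse z) \<in> D" using e(2) by auto
      then show ?thesis using \<open>z \<noteq> 0\<close> by (simp add: inv_chart_def)
    qed
    define Q where "Q = E \<union> {z. R \<le> norm z}"
    have cQ: "closed Q" unfolding Q_def by (intro closed_Un cE closed_Collect_le continuous_intros)
    have Pb: "bounded P" unfolding bounded_iff using R by (intro exI[of _ R]) (auto simp: P_def)
    then have kP: "compact P" using cP by (simp add: compact_eq_bounded_closed)
    have Pne: "P \<noteq> {}"
    proof -
      obtain p where "p \<notin> D" using D(2) by auto
      then show ?thesis using True by (cases p) (auto simp: P_def)
    qed
    have Qne: "Q \<noteq> {}" 
    proof -
      have "of_real \<bar>R\<bar> \<in> Q" by (simp add: Q_def abs_ge_self)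
      then show ?thesis by auto
    qed
    have "Q \<inter> P = {}" using Cl(2) R by (auto simp: Q_def E_def P_def)
    then obtain d where d: "d > 0" "\<And>x y. x \<in> Q \<Longrightarrow> y \<in> P \<Longrightarrow> d \<le> dist x y"
      using separate_closed_compact[OF cQ kP] by blast
    define \<rho> where "\<rho> = d / 5"
    have \<rho>: "\<rho> > 0" "4 * \<rho> < d" using d(1) by (auto simp: \<rho>_def)
    have bR: "norm z \<le> R" if "infdist z Q > 0" for z
    proof (rule ccontr)
      assume "\<not> norm z \<le> R"
      then have "z \<in> Q" by (simp add: Q_def)
      with that show False by simp
    qed
    have far: "infdist p Q \<ge> d" if "p \<in> P" for p
    proof -
      obtain q where q: "q \<in> Q" "infdist p Q = dist p q" using infdist_attains_inf[OF cQ Qne] by blast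
      then show ?thesis using d(2)[OF q(1) that] by (simp add: dist_commute)
    qed
    have "{z. 2 * \<rho> \<le> infdist z Q} \<noteq> {}"
    proof -
      obtain p where "p \<in> P" using Pne by auto
      then have "2 * \<rho> \<le> infdist p Q" using far[of p] \<rho> by simp
      then show ?thesis by auto
    qed
    moreover have "compact {z. \<rho> / 2 \<le> infdist z Q \<and> infdist z Q \<le> 3 * \<rho>}"
      unfolding compact_eq_bounded_closed bounded_iff
    proof (intro conjI exI[of _ R] ballI cc(1))
      show "norm z \<le> R" if "z \<in> {z. \<rho> / 2 \<le> infdist z Q \<and> infdist z Q \<le> 3 * \<rho>}" for z
        using that \<rho>(1) by (intro bR) auto
    qed
    moreover have "compactin riemann_sphere (Some ` {z. infdist z Q \<le> 2 * \<rho>} \<union> (D \<inter> {None}))"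
    proof (rule closedin_imp_compactin_sphere)
      have "UNIV - (Some ` {z. infdist z Q \<le> 2 * \<rho>} \<union> (D \<inter> {None})) = Some ` {z. 2 * \<rho> < infdist z Q}"
      proof (rule set_eqI)
        fix p :: sphere
        show "p \<in> UNIV - (Some ` {z. infdist z Q \<le> 2 * \<rho>} \<union> (D \<inter> {None})) \<longleftrightarrow> p \<in> Some ` {z. 2 * \<rho> < infdist z Q}"
          using True by (cases p) (auto simp: image_iff not_le)
      qed
      moreover have "open {z. 2 * \<rho> < infdist z Q}" by (intro open_Collect_less continuous_intros)
      ultimately show "closedin riemann_sphere (Some ` {z. infdist z Q \<le> 2 * \<rho>} \<union> (D \<inter> {None}))"
        by (simp add: closedin_def topspace_riemann_sphere openin_Some_image)
    qed
    moreover have "compact ({z. \<rho> \<le> infdist z Q} \<inter> Some -` C)" if "closedin riemann_sphere C" "C \<subseteq> D" for C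
      unfolding compact_eq_bounded_closed bounded_iff
    proof (intro conjI exI[of _ R] ballI)
      show "closed ({z. \<rho> \<le> infdist z Q} \<inter> Some -` C)"
        by (intro closed_Int cc(2) closed_vimage_Some[OF that(1)])
      show "norm z \<le> R" if "z \<in> {z. \<rho> \<le> infdist z Q} \<inter> Some -` C" for z
        using that \<rho>(1) by (intro bR) auto
    qed
    moreover have "Some z \<in> D" if "infdist z Q \<le> 4 * \<rho>" for z
      using sep[OF d(2) cQ Qne] that \<rho> by simp
    moreover have "Some -` D0 \<subseteq> Q" using ED0 by (auto simp: Q_def)
    ultimately show ?thesis using cQ \<rho>(1) by (intro that[of Q \<rho>])
  qed
qed

lemma usc_borel_measurable:
  fixes u :: "complex \<Rightarrow> ereal"
  assumes "open V" "\<And>a. open {z\<in>V. u z < a}"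
  shows "(\<lambda>z. if z \<in> V then u z else 0) \<in> borel_measurable borel"
proof (rule borel_measurableI_less)
  fix a :: ereal
  have "{z \<in> space borel. (if z \<in> V then u z else 0) < a} = {z\<in>V. u z < a} \<union> (if 0 < a then - V else {})"
    by auto
  moreover have "- V \<in> sets borel" using assms(1) by auto
  ultimately show "{z \<in> space borel. (if z \<in> V then u z else 0) < a} \<in> sets borel"
    using assms(2)[of a] by (auto intro: borel_open)
qed

text \<open>On \<open>K\<close> the function \<open>u\<close> lies between the integrable function \<open>l\<close> and a constant.\<close>

lemma majorant_locally_integrable:
  fixes u :: "complex \<Rightarrow> ereal"
  assumes V: "open V" "\<And>z. z \<in> V \<Longrightarrow> u z < \<infinity>" "\<And>a. open {z\<in>V. u z < a}" and K: "compact K" "K \<subseteq> V"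
    and l: "integrable lborel (\<lambda>z. indicator K z * l z)" and fin: "finite A"
    and le: "\<And>z. z \<in> K - A \<Longrightarrow> ereal (l z) \<le> u z"
  shows "integrable lborel (\<lambda>z. indicator K z * real_of_ereal (u z))"
proof -
  obtain b where b: "\<And>z. z \<in> K \<Longrightarrow> u z < ereal b"
    using usc_bounded_above_on_compact[of V u K, OF V(2,3) K] by blast
  have [measurable]: "K \<in> sets borel" using K(1) by (rule borel_compact)
  have "(\<lambda>z. indicator K z * real_of_ereal (if z \<in> V then u z else 0)) \<in> borel_measurable lborel"
    using usc_borel_measurable[OF V(1,3)] by measurable
  moreover have "indicator K z * real_of_ereal (if z \<in> V then u z else 0) = indicator K z * real_of_ereal (u z)" for z
    using K by (auto simp: indicator_def)
  ultimately have meas: "(\<lambda>z. indicator K z * real_of_ereal (u z)) \<in> borel_measurable lborel" by simp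
  have int: "integrable lborel (\<lambda>z. \<bar>indicator K z * l z\<bar> + \<bar>b\<bar> * indicator K z)"
    using emeasure_compact_finite[OF K(1)]
    by (intro Bochner_Integration.integrable_add integrable_abs l integrable_mult_right integrable_real_indicator) auto
  have "AE z in lborel. norm (indicator K z * real_of_ereal (u z)) \<le> norm (\<bar>indicator K z * l z\<bar> + \<bar>b\<bar> * indicator K z)"
    using AE_not_in[OF finite_imp_null_set_lborel[OF fin]]
  proof eventually_elim
    fix z assume z: "z \<notin> A"
    show "norm (indicator K z * real_of_ereal (u z)) \<le> norm (\<bar>indicator K z * l z\<bar> + \<bar>b\<bar> * indicator K z)"
    proof (cases "z \<in> K")
      case True
      then have "ereal (l z) \<le> u z" "u z < ereal b" using le z b by auto
      then obtain x where "u z = ereal x" "l z \<le> x" "x < b" by (cases "u z") auto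
      then show ?thesis using True by simp
    qed simp
  qed
  then show ?thesis by (rule Bochner_Integration.integrable_bound[OF int meas])
qed

section \<open>Summing the weight over the zeros\<close>

lemma sum_le_weighted_sum_of_fibres:
  fixes w :: "'a \<Rightarrow> real" and n :: "'a \<Rightarrow> real"
  assumes "finite J" and "\<And>a. a \<in> z ` J \<Longrightarrow> real (card {k\<in>J. z k = a}) \<le> n a" and "\<And>a. a \<in> z ` J \<Longrightarrow> 0 \<le> w a"
  shows "(\<Sum>k\<in>J. w (z k)) \<le> (\<Sum>a\<in>z ` J. n a * w a)"
proof -
  have "(\<Sum>k\<in>J. w (z k)) = (\<Sum>a\<in>z ` J. \<Sum>k\<in>{k\<in>J. z k = a}. w (z k))"
    by (rule sum.image_gen[OF assms(1)])
  also have "\<dots> = (\<Sum>a\<in>z ` J. real (card {k\<in>J. z k = a}) * w a)"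
    by (intro sum.cong refl) simp
  also have "\<dots> \<le> (\<Sum>a\<in>z ` J. n a * w a)"
    by (intro sum_mono mult_right_mono assms)
  finally show ?thesis .
qed

theorem corollary1:
  fixes D D0 :: "sphere set"
    and M v :: "sphere \<Rightarrow> ereal"
    and \<nu>\<^sub>M :: "sphere measure"
    and f :: "sphere \<Rightarrow> complex"
    and N :: enat and Z :: "nat \<Rightarrow> sphere"
  assumes "sphere_domain D" and "D \<noteq> UNIV"
    and "sphere_domain D0" and "D0 \<Subset> D"
    and "M \<in> sbh D" and "is_riesz_measure D M \<nu>\<^sub>M"
    and "f \<in> Hol D" and "\<exists>z\<in>D. f z \<noteq> 0"
    and "Z ` seq_indices N \<subseteq> D" and "vanishes_on_seq f D N Z"
    and "\<forall>z \<in> D - D0. log_norm (f z) \<le> M z"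
    and "v \<in> sbh_pos (D - D0)"
    and "tends_to_zero_at_boundary D D0 v"
  shows "(\<integral>\<^sup>+z\<in>D - D0. e2ennreal (v z) \<partial>\<nu>\<^sub>M) < \<infinity> \<longrightarrow>
         (\<Sum>\<^sub>\<infinity>k\<in>{k \<in> seq_indices N. Z k \<in> D - D0}. e2ennreal (v (Z k))) < \<infinity>"
proof
  assume mass: "(\<integral>\<^sup>+z\<in>D - D0. e2ennreal (v z) \<partial>\<nu>\<^sub>M) < \<infinity>"
  have oD: "openin riemann_sphere D" using assms(1) by (simp add: sphere_domain_def)
  have oD0: "openin riemann_sphere D0" "D0 \<noteq> {}" using assms(3) by (auto simp: sphere_domain_def)
  obtain Q \<rho> where Q: "closed Q" and \<rho>: "\<rho> > 0" and D0Q: "Some -` D0 \<subseteq> Q"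
    and near: "\<And>z. infdist z Q \<le> 4 * \<rho> \<Longrightarrow> Some z \<in> D"
    and Yne: "{z. 2 * \<rho> \<le> infdist z Q} \<noteq> {}"
    and kK: "compact {z. \<rho> / 2 \<le> infdist z Q \<and> infdist z Q \<le> 3 * \<rho>}"
    and kH: "compactin riemann_sphere (Some ` {z. infdist z Q \<le> 2 * \<rho>} \<union> (D \<inter> {None}))"
    and kT: "\<And>C. closedin riemann_sphere C \<Longrightarrow> C \<subseteq> D \<Longrightarrow> compact ({z. \<rho> \<le> infdist z Q} \<inter> Some -` C)"
    by (rule collar_exists[OF oD assms(2) oD0(2) assms(4)]) (rule that)
  define K where "K = {z. \<rho> / 2 \<le> infdist z Q \<and> infdist z Q \<le> 3 * \<rho>}"
  (* H is the compact part of D that contributes only finitely many zeros; g vanishes outside it *)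
  define H where "H = Some ` {z. infdist z Q \<le> 2 * \<rho>} \<union> (D \<inter> {None})"
  define \<Omega> where "\<Omega> = Some -` D - Q"
  define F where "F = f \<circ> Some"
  define m where "m z = real_of_ereal (M (Some z))" for z
  have H: "compactin riemann_sphere H" "H \<subseteq> D" using kH near \<rho> by (auto simp: H_def)
  have o\<Omega>: "open \<Omega>" unfolding \<Omega>_def using open_vimage_Some[OF oD] Q by (rule open_Diff)
  have \<Omega>D: "Some ` \<Omega> \<subseteq> D - D0" using D0Q by (auto simp: \<Omega>_def)
  have notQ: "z \<notin> Q" if "0 < infdist z Q" for z using that by force
  have K\<Omega>: "K \<subseteq> \<Omega>" using near notQ \<rho> by (auto simp: K_def \<Omega>_def)

  obtain U where U: "openin riemann_sphere U" "D - D0 \<subseteq> U" "v \<in> sbh_open U" and vpos: "\<And>p. p \<in> D - D0 \<Longrightarrow> 0 \<le> v p"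
    using assms(12) by (auto simp: sbh_pos_def sbh_def)
  have vsub: "subharmonic_on (v \<circ> Some) (Some -` U)" using U(3) by (simp add: sbh_open_def)
  have \<Omega>U: "\<Omega> \<subseteq> Some -` U" using \<Omega>D U(2) by auto
  have vlt: "v p < \<infinity>" if "p \<in> D - D0" for p
    using sbh_open_bounded_above[OF U(3), of "{p}"] that U(2) topspace_riemann_sphere by (force simp: finite_imp_compactin)
  define w where "w z = real_of_ereal (v (Some z))" for z
  have vw: "v (Some z) = ereal (w z)" if "z \<in> \<Omega>" for z
    using vpos[of "Some z"] vlt[of "Some z"] \<Omega>D that by (cases "v (Some z)") (auto simp: w_def)
  have w0: "0 \<le> w z" if "z \<in> \<Omega>" for z using vw[OF that] vpos[of "Some z"] \<Omega>D that by auto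

  have "closedin riemann_sphere (H - D0)"
    using compactin_imp_closedin[OF Hausdorff_riemann_sphere H(1)] oD0(1) by (intro closedin_diff)
  then obtain b where b: "\<And>p. p \<in> H - D0 \<Longrightarrow> v p < ereal b"
    using sbh_open_bounded_above[OF U(3), of "H - D0"] closedin_imp_compactin_sphere H(2) U(2) by blast
  define B where "B = max b 1"
  have B: "B > 0" by (simp add: B_def)
  have vB: "(v \<circ> Some) z < ereal B" if "z \<in> \<Omega>" "infdist z Q \<le> \<rho>" for z
  proof -
    have "Some z \<in> H - D0" using that \<rho> \<Omega>D by (auto simp: H_def)
    then have "v (Some z) < ereal b" by (rule b)
    also have "ereal b \<le> ereal B" by (simp add: B_def)
    finally show ?thesis by simp
  qed

  have Fhol: "F holomorphic_on \<Omega>"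
    using assms(7) by (auto simp: Hol_def F_def \<Omega>_def intro: holomorphic_on_subset)
  have nz: "eventually (\<lambda>z. F z \<noteq> 0) (at a)" if "a \<in> \<Omega>" for a
  proof -
    have "Some a \<in> D" using that \<Omega>D by auto
    then obtain V where V: "openin riemann_sphere V" "Some a \<in> V" "\<forall>q\<in>V - {Some a}. f q \<noteq> 0"
      using Hol_zeros_isolated[OF assms(1,7,8)] by blast
    have "eventually (\<lambda>z. z \<in> Some -` V) (nhds a)"
      using open_vimage_Some[OF V(1)] V(2) by (intro eventually_nhds_in_open) auto
    then show ?thesis
      using V(3) by (auto simp: eventually_at_filter F_def elim: eventually_mono)
  qed
  have fin: "finite {z\<in>K'. F z = 0}" if "compact K'" "K' \<subseteq> \<Omega>" for K'
  proof -
    have "finite {p \<in> Some ` K'. f p = 0}"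
      using that \<Omega>D by (intro Hol_finite_zeros[OF assms(1,7,8)] compactin_Some_image) auto
    moreover have "{p \<in> Some ` K'. f p = 0} = Some ` {z\<in>K'. F z = 0}" by (auto simp: F_def)
    ultimately show ?thesis by (simp add: finite_image_iff)
  qed
  have zo: "0 \<le> zorder F a" if "a \<in> \<Omega>" for a
  proof (rule zorder_ge_0)
    show "F analytic_on {a}" using Fhol o\<Omega> that analytic_at by blast
    show "frequently (\<lambda>z. F z \<noteq> 0) (at a)" using nz[OF that] by (simp add: eventually_frequently)
  qed

  obtain U' where U': "D \<subseteq> U'" "M \<in> sbh_open U'" using assms(5) by (auto simp: sbh_def)
  have Msub: "subharmonic_on (M \<circ> Some) (Some -` U')" using U'(2) by (simp add: sbh_open_def)
  have lnM: "ereal (ln (norm (F z))) \<le> M (Some z)" if "z \<in> \<Omega>" "F z \<noteq> 0" for z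
    using assms(11) \<Omega>D that by (force simp: log_norm_def F_def)
  have mint: "integrable lborel (\<lambda>z. indicator K' z * m z)" if K': "compact K'" "K' \<subseteq> \<Omega>" for K'
    unfolding m_def
  proof (rule majorant_locally_integrable[of "Some -` U'" "\<lambda>z. M (Some z)" K' "\<lambda>z. ln (norm (F z))" "{z\<in>K'. F z = 0}"])
    show "open (Some -` U')" "\<And>a. open {z \<in> Some -` U'. M (Some z) < a}" "\<And>z. z \<in> Some -` U' \<Longrightarrow> M (Some z) < \<infinity>"
      using Msub by (auto simp: subharmonic_on_def)
    show "K' \<subseteq> Some -` U'" using K' \<Omega>D U'(1) by auto
    show "integrable lborel (\<lambda>z. indicator K' z * ln (norm (F z)))"
      by (rule integrable_ln_holomorphic[OF o\<Omega> K' Fhol nz fin[OF K']])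
    show "ereal (ln (norm (F z))) \<le> M (Some z)" if "z \<in> K' - {z\<in>K'. F z = 0}" for z
      using that K' by (intro lnM) auto
  qed (use K' fin in auto)
  have mle: "ln (norm (F z)) \<le> m z" if "z \<in> \<Omega>" "F z \<noteq> 0" for z
  proof -
    have "Some z \<in> D" using that(1) \<Omega>D by auto
    then have "M (Some z) < \<infinity>" using Msub U'(1) by (auto simp: subharmonic_on_def)
    with lnM[OF that] show ?thesis unfolding m_def by (cases "M (Some z)") auto
  qed

  define I where "I = enn2real (\<integral>\<^sup>+z\<in>D - D0. e2ennreal (v z) \<partial>\<nu>\<^sub>M)"
  have I: "ennreal I = (\<integral>\<^sup>+z\<in>D - D0. e2ennreal (v z) \<partial>\<nu>\<^sub>M)" "I \<ge> 0"
    using mass by (simp_all add: I_def)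
  define C where "C = 4 * (B / \<rho>\<^sup>2)"
  (* the bound for all finite sums over zeros outside H; it involves no \<epsilon> *)
  define S where "S = (2 * pi * I + C * (\<integral>z. indicator K z * m z - indicator K z * ln (norm (F z)) \<partial>lborel)) * (2 / pi)"

  (* on A the correction g vanishes, so there the truncated weight W is at least w - \<epsilon> *)
  have bound_\<epsilon>: "(\<Sum>a\<in>A. of_int (zorder F a) * (w a - \<epsilon>)) \<le> S"
    if \<epsilon>: "\<epsilon> > 0" and A: "finite A" "A \<subseteq> {a\<in>\<Omega>. 2 * \<rho> \<le> infdist a Q \<and> F a = 0}" for \<epsilon> A
  proof -
    obtain D\<epsilon> where D\<epsilon>: "D\<epsilon> \<Subset> D" "\<And>z. z \<in> D - (D\<epsilon> \<union> D0) \<Longrightarrow> \<bar>v z\<bar> < ereal \<epsilon>"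
      using assms(13) \<epsilon> unfolding tends_to_zero_at_boundary_def by blast
    define T where "T = {z. \<rho> \<le> infdist z Q} \<inter> Some -` (riemann_sphere closure_of D\<epsilon>)"
    have cl: "riemann_sphere closure_of D\<epsilon> \<subseteq> D" using D\<epsilon>(1) by (simp add: relatively_compact_in_def)
    have D\<epsilon>cl: "D\<epsilon> \<subseteq> riemann_sphere closure_of D\<epsilon>" by (rule closure_of_subset) (simp add: topspace_riemann_sphere)
    have T: "compact T" unfolding T_def using kT[OF closedin_closure_of cl] .
    have T\<Omega>: "T \<subseteq> \<Omega>" using cl notQ \<rho> by (auto simp: T_def \<Omega>_def)
    have small: "(v \<circ> Some) z < ereal \<epsilon>" if "z \<in> \<Omega>" "z \<notin> T" "\<rho> < infdist z Q" for z
    proof -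
      have "Some z \<notin> D\<epsilon>" using that D\<epsilon>cl by (auto simp: T_def)
      then have "\<bar>v (Some z)\<bar> < ereal \<epsilon>" using that \<Omega>D by (intro D\<epsilon>(2)) auto
      then show ?thesis using vw[OF that(1)] by simp
    qed
    define W where "W z = (if z \<in> \<Omega> then max (real_of_ereal ((v \<circ> Some) z) - B / \<rho>\<^sup>2 * (infdist z {z. 2 * \<rho> \<le> infdist z Q})\<^sup>2 - \<epsilon>) 0 else 0)" for z
    have pos: "0 \<le> (v \<circ> Some) z" if "z \<in> \<Omega>" for z using vpos \<Omega>D that by auto
    from truncated_weight_approximation[OF vsub o\<Omega> \<Omega>U pos Q \<rho> Yne B vB T T\<Omega> \<epsilon> small, folded W_def]
    obtain K1 \<psi> A1 where K1: "compact K1" "T \<subseteq> K1" "K1 \<subseteq> \<Omega>" and WT: "\<forall>z. z \<notin> T \<longrightarrow> W z = 0"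
      and \<psi>: "\<forall>n::nat. smooth_in K1 (\<psi> n)" "\<forall>n z. 0 \<le> \<psi> n z \<and> \<psi> n z \<le> A1" "\<forall>z. (\<lambda>n. \<psi> n z) \<longlonglongrightarrow> W z"
      and lap: "\<forall>n z. - (C * indicator K z) \<le> laplacian (\<psi> n) z"
      unfolding K_def C_def by blast
    have W0: "0 \<le> W z" for z by (simp add: W_def)
    have Wle: "W z \<le> w z" if "z \<in> \<Omega>" for z
    proof -
      have "0 \<le> B / \<rho>\<^sup>2 * (infdist z {z. 2 * \<rho> \<le> infdist z Q})\<^sup>2" using B by simp
      moreover have "W z = max (w z - B / \<rho>\<^sup>2 * (infdist z {z. 2 * \<rho> \<le> infdist z Q})\<^sup>2 - \<epsilon>) 0"
        using that by (simp add: W_def w_def)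
      ultimately show ?thesis using w0[OF that] \<epsilon> by linarith
    qed
    have "ennreal (sphere_lift W p) \<le> e2ennreal (v p) * indicator (D - D0) p" for p
    proof (cases p)
      case (Some z)
      show ?thesis
      proof (cases "z \<in> \<Omega>")
        case True
        then have "p \<in> D - D0" using \<Omega>D Some by auto
        then show ?thesis using Some Wle[OF True] vw[OF True] by (simp add: ennreal_leI)
      qed (simp add: Some W_def)
    qed simp
    then have "(\<integral>\<^sup>+p. ennreal (sphere_lift W p) \<partial>\<nu>\<^sub>M) \<le> ennreal I"
      unfolding I(1) by (intro nn_integral_mono)
    from zeros_le_riesz_mass[OF assms(6) oD o\<Omega> _ K1(1,3) kK[folded K_def] K\<Omega> Fhol nz fin mint[unfolded m_def] mle[unfolded m_def] _ _ _ _ _ this I(2), of \<psi> A1 C]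
    have est: "pi / 2 * (\<Sum>a\<in>{z\<in>K1. F z = 0}. of_int (zorder F a) * W a) \<le> S * (pi / 2)"
      using \<Omega>D \<psi> lap unfolding S_def m_def by auto
    have "(\<Sum>a\<in>A. of_int (zorder F a) * (w a - \<epsilon>)) \<le> (\<Sum>a\<in>A. of_int (zorder F a) * W a)"
    proof (intro sum_mono mult_left_mono)
      fix a assume a: "a \<in> A"
      then have "infdist a {z. 2 * \<rho> \<le> infdist z Q} = 0" using A(2) by auto
      then show "w a - \<epsilon> \<le> W a" using a A(2) by (auto simp: W_def w_def)
      show "0 \<le> real_of_int (zorder F a)" using zo a A(2) by auto
    qed
    also have "\<dots> = (\<Sum>a\<in>A \<inter> K1. of_int (zorder F a) * W a)"
      using A(1) K1(2) WT by (intro sum.mono_neutral_right) auto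
    also have "\<dots> \<le> (\<Sum>a\<in>{z\<in>K1. F z = 0}. of_int (zorder F a) * W a)"
      using fin[OF K1(1,3)] A(2) zo W0 K1(3) by (intro sum_mono2) (auto intro!: mult_nonneg_nonneg)
    also have "\<dots> \<le> S" using est by simp
    finally show ?thesis .
  qed
  have bound: "(\<Sum>a\<in>A. of_int (zorder F a) * w a) \<le> S"
    if A: "finite A" "A \<subseteq> {a\<in>\<Omega>. 2 * \<rho> \<le> infdist a Q \<and> F a = 0}" for A
  proof (rule tendsto_upperbound)
    show "((\<lambda>\<epsilon>. \<Sum>a\<in>A. of_int (zorder F a) * (w a - \<epsilon>)) \<longlongrightarrow> (\<Sum>a\<in>A. of_int (zorder F a) * w a)) (at_right 0)"
      by (auto intro!: tendsto_eq_intros)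
    show "\<forall>\<^sub>F \<epsilon> in at_right 0. (\<Sum>a\<in>A. of_int (zorder F a) * (w a - \<epsilon>)) \<le> S"
      using eventually_at_right_less[of 0] by eventually_elim (rule bound_\<epsilon>[OF _ A])
  qed simp

  define Idx where "Idx = {k \<in> seq_indices N. Z k \<in> D - D0}"
  define J1 where "J1 = {k \<in> Idx. Z k \<in> H}"
  have van: "f p = 0 \<and> finite {k \<in> seq_indices N. Z k = p} \<and> int (card {k \<in> seq_indices N. Z k = p}) \<le> sphere_zorder f p"
    if "p \<in> D" "p \<in> Z ` seq_indices N" for p
    using assms(10) that unfolding vanishes_on_seq_def by blast
  have finJ1: "finite J1"
  proof (rule finite_subset)
    show "J1 \<subseteq> (\<Union>p\<in>{p\<in>H. f p = 0} \<inter> Z ` J1. {k \<in> seq_indices N. Z k = p})"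
      using van by (auto simp: J1_def Idx_def)
    have "finite {p\<in>H. f p = 0}" by (rule Hol_finite_zeros[OF assms(1,7,8) H])
    then show "finite (\<Union>p\<in>{p\<in>H. f p = 0} \<inter> Z ` J1. {k \<in> seq_indices N. Z k = p})"
      using van by (intro finite_UN_I finite_Int) (auto simp: J1_def Idx_def)
  qed
  (* a point occurs in Z at most as often as its order as a zero of f allows *)
  have outer: "(\<Sum>k\<in>J. e2ennreal (v (Z k))) \<le> ennreal S" if J: "finite J" "J \<subseteq> Idx - J1" for J
  proof -
    define z where "z k = the (Z k)" for k
    have zk: "Z k = Some (z k) \<and> z k \<in> \<Omega> \<and> 2 * \<rho> \<le> infdist (z k) Q \<and> F (z k) = 0" if "k \<in> J" for k
    proof -
      have k: "k \<in> seq_indices N" "Z k \<in> D" "Z k \<notin> H" using that J(2) by (auto simp: Idx_def J1_def)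
      then have ne: "Z k \<noteq> None" by (auto simp: H_def)
      then have eq: "Z k = Some (z k)" by (simp add: z_def)
      then have far: "2 * \<rho> < infdist (z k) Q" using k(3) by (auto simp: H_def not_le)
      have "f (Z k) = 0" using van[of "Z k"] k(1,2) by blast
      then show ?thesis using far eq k(2) notQ[of "z k"] \<rho> by (auto simp: \<Omega>_def F_def)
    qed
    have "(\<Sum>k\<in>J. e2ennreal (v (Z k))) = (\<Sum>k\<in>J. ennreal (w (z k)))"
    proof (rule sum.cong)
      fix k assume "k \<in> J"
      with zk vw show "e2ennreal (v (Z k)) = ennreal (w (z k))" by (metis e2ennreal_ereal)
    qed simp
    also have "\<dots> = ennreal (\<Sum>k\<in>J. w (z k))" using zk w0 by (intro sum_ennreal) auto
    also have "(\<Sum>k\<in>J. w (z k)) \<le> (\<Sum>a\<in>z ` J. of_int (zorder F a) * w a)"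
    proof (rule sum_le_weighted_sum_of_fibres[OF J(1)])
      fix a assume "a \<in> z ` J"
      then obtain k where k: "k \<in> J" "a = z k" by auto
      then have a: "a \<in> \<Omega>" "Some a = Z k" using zk by auto
      then show "0 \<le> w a" using w0 by simp
      have p: "Some a \<in> D" "Some a \<in> Z ` seq_indices N" using k(1) a J(2) by (auto simp: Idx_def)
      have "card {k\<in>J. z k = a} \<le> card {k \<in> seq_indices N. Z k = Some a}"
        using van[OF p] J(2) zk by (intro card_mono) (auto simp: Idx_def)
      also have "int \<dots> \<le> zorder F a" using van[OF p] by (simp add: F_def)
      finally have "int (card {k\<in>J. z k = a}) \<le> zorder F a" by simp
      then show "real (card {k\<in>J. z k = a}) \<le> of_int (zorder F a)" by linarith
    qed
    also have "\<dots> \<le> S" using J(1) zk by (intro bound) auto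
    finally show ?thesis by (simp add: ennreal_leI)
  qed
  have "(\<Sum>\<^sub>\<infinity>k\<in>Idx. e2ennreal (v (Z k))) \<le> (\<Sum>k\<in>J1. e2ennreal (v (Z k))) + ennreal S"
  proof (rule infsum_le_finite_sums)
    fix J assume J: "finite J" "J \<subseteq> Idx"
    have "(\<Sum>k\<in>J. e2ennreal (v (Z k))) = (\<Sum>k\<in>J \<inter> J1. e2ennreal (v (Z k))) + (\<Sum>k\<in>J - J1. e2ennreal (v (Z k)))"
      using J(1) by (metis sum.Int_Diff)
    also have "\<dots> \<le> (\<Sum>k\<in>J1. e2ennreal (v (Z k))) + ennreal S"
      using J finJ1 by (intro add_mono sum_mono2 outer) auto
    finally show "(\<Sum>k\<in>J. e2ennreal (v (Z k))) \<le> (\<Sum>k\<in>J1. e2ennreal (v (Z k))) + ennreal S" .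
  qed (rule nonneg_summable_on_complete, simp)
  also have "\<dots> < \<infinity>"
  proof -
    have "e2ennreal (v (Z k)) < \<infinity>" if "k \<in> J1" for k
    proof -
      have "Z k \<in> D - D0" using that by (simp add: J1_def Idx_def)
      from vlt[OF this] vpos[OF this] show ?thesis by (cases "v (Z k)") auto
    qed
    then show ?thesis using finJ1 by simp
  qed
  finally show "(\<Sum>\<^sub>\<infinity>k\<in>{k \<in> seq_indices N. Z k \<in> D - D0}. e2ennreal (v (Z k))) < \<infinity>"
    unfolding Idx_def .
qed

end
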